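(* There exists a (deterministic) sequence of real numbers $\{c_j\}_{j\in\mathbb{Z}}$ such that $$c_{j+1}-c_j \in \{\tfrac12, 1, \tfrac32, 2, \dots\}\quad\text{for all } j\in\mathbb{Z},$$ and moreover for every $\varphi\in\mathcal{S}(\mathbb{R})$, $$\lim_{T\to\infty}\frac1T\int_T^{2T}\sum_{j\in\mathbb{Z}}\varphi(c_j-t)\,dt=\int_{\mathbb{R}}\varphi(x)\,dx,$$ and for each $n\ge 2$ and every $\eta\in\mathcal{K}_n$, $$\lim_{T\to\infty}\frac1T\int_T^{2T}\sum_{\substack{j_1,\dots,j_n\in\mathbb{Z}\\ \text{distinct}}}\eta(c_{j_1}-t,\dots,c_{j_n}-t)\,dt=\int_{\mathbb{R}^n}\eta(x)\det_{1\le i,j\le n}\big[S(x_i-x_j)\big]\,d^nx.$$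
   Context: $S(x)=\frac{\sin \pi x}{\pi x}$ for $x\neq 0$ and $S(0)=1$. $\mathcal{S}(\mathbb{R}^n)$ is the Schwartz space. The Fourier transform is $\hat\eta(\xi)=\int_{\mathbb{R}^n}\eta(x)e^{-2\pi i x\cdot\xi}\,d^nx$. $\mathcal{K}_n$ denotes the set of $\eta\in\mathcal{S}(\mathbb{R}^n)$ whose Fourier transform has support contained in $\{\xi\in\mathbb{R}^n:\ \xi_1+\cdots+\xi_n\neq 0\ \text{ or }\ |\xi_1|+\cdots+|\xi_n|<2\}$. The sum over "distinct" $j_1,\dots,j_n$ means over $n$-tuples of pairwise distinct indices. *)

theory Defs
  imports "HOL-Analysis.Analysis" "Jordan_Normal_Form.Determinant"
begin

text \<open>
  The dimension \<open>n\<close> is quantified inside the theorem, so \<open>\<real>\<^sup>n\<close> is the set of extensional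
  functions on \<open>{..<n}\<close>, with the product topology (subspace of \<open>nat \<Rightarrow> real\<close>) and the
  product Lebesgue measure. Values of a function outside \<open>Rn n\<close> are never used.
\<close>

definition Rn :: "nat \<Rightarrow> (nat \<Rightarrow> real) set" where
  "Rn n = {..<n} \<rightarrow>\<^sub>E UNIV"

definition lborel_Rn :: "nat \<Rightarrow> (nat \<Rightarrow> real) measure" where
  "lborel_Rn n = (\<Pi>\<^sub>M i\<in>{..<n}. lborel)"

definition partial_deriv :: "nat \<Rightarrow> ((nat \<Rightarrow> real) \<Rightarrow> complex) \<Rightarrow> (nat \<Rightarrow> real) \<Rightarrow> complex" where
  "partial_deriv i f x = vector_derivative (\<lambda>s. f (x(i := s))) (at (x i))"

definition schwartz_R :: "(real \<Rightarrow> complex) set" where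
  "schwartz_R = {f. \<forall>k. let g = ((\<lambda>h x. vector_derivative h (at x)) ^^ k) f in
     (\<forall>x. g differentiable (at x)) \<and>
     (\<forall>m. \<exists>C. \<forall>x. \<bar>x\<bar> ^ m * cmod (g x) \<le> C)}"

text \<open>
  Smoothness means that all iterated partial derivatives, in any order \<open>is\<close> of the
  coordinates, exist and are continuous; decay means that \<open>x\<^sup>\<alpha> \<partial>\<^sup>\<beta> f\<close> is bounded
  for all multi-indices.
\<close>

definition schwartz_Rn :: "nat \<Rightarrow> ((nat \<Rightarrow> real) \<Rightarrow> complex) set" where
  "schwartz_Rn n = {f. \<forall>is \<in> lists {..<n}. let g = foldr partial_deriv is f in
     continuous_on (Rn n) g \<and>
     (\<forall>i<n. \<forall>x\<in>Rn n. (\<lambda>s. g (x(i := s))) differentiable (at (x i))) \<and>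
     (\<forall>\<alpha> :: nat \<Rightarrow> nat. \<exists>C. \<forall>x\<in>Rn n. (\<Prod>i<n. \<bar>x i\<bar> ^ \<alpha> i) * cmod (g x) \<le> C)}"

definition fourier_Rn :: "nat \<Rightarrow> ((nat \<Rightarrow> real) \<Rightarrow> complex) \<Rightarrow> (nat \<Rightarrow> real) \<Rightarrow> complex" where
  "fourier_Rn n f \<xi> =
     (LINT x|lborel_Rn n. f x * exp (- 2 * of_real pi * \<i> * of_real (\<Sum>i<n. x i * \<xi> i)))"

text \<open>
  \<open>Rn n\<close> is closed in \<open>nat \<Rightarrow> real\<close>, so the closure below is the closure in \<open>\<real>\<^sup>n\<close>.
\<close>

definition support_Rn :: "nat \<Rightarrow> ((nat \<Rightarrow> real) \<Rightarrow> complex) \<Rightarrow> (nat \<Rightarrow> real) set" where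
  "support_Rn n f = closure {x \<in> Rn n. f x \<noteq> 0}"

definition K_space :: "nat \<Rightarrow> ((nat \<Rightarrow> real) \<Rightarrow> complex) set" where
  "K_space n = {\<eta> \<in> schwartz_Rn n. support_Rn n (fourier_Rn n \<eta>) \<subseteq>
     {\<xi> \<in> Rn n. (\<Sum>i<n. \<xi> i) \<noteq> 0 \<or> (\<Sum>i<n. \<bar>\<xi> i\<bar>) < 2}}"

definition sine_kernel :: "real \<Rightarrow> real" where
  "sine_kernel x = (if x = 0 then 1 else sin (pi * x) / (pi * x))"

definition distinct_tuples :: "nat \<Rightarrow> (nat \<Rightarrow> int) set" where
  "distinct_tuples n = {j \<in> {..<n} \<rightarrow>\<^sub>E UNIV. inj_on j {..<n}}"

end

theory Submission
  imports Defs "HOL-Probability.Sinc_Integral" "HOL-Real_Asymp.Real_Asymp"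
begin

text \<open>
  The sequence is \<open>c = A / 2\<close> for a set \<open>A\<close> of integers in which every finite pattern \<open>Y\<close>
  occurs with density \<open>det [S ((y - y') / 2) / 2]\<close>, the correlation function of the
  determinantal process on the half-integers with the sine kernel. On a finite window this
  process exists because the kernel matrix \<open>K\<close> satisfies \<open>0 \<le> K \<le> 1\<close>; \<open>A\<close> is obtained by
  concatenating outcomes on windows of growing length, chosen greedily so that the
  accumulated deviations of all pattern counts stay of lower order.

  Writing \<open>t = a / 2 + s\<close> with \<open>a\<close> an integer and \<open>0 \<le> s < 1 / 2\<close>, the average over \<open>t\<close> tends to
  \<open>2\<^sup>1\<^sup>-\<^sup>n\<close> times the sum over \<open>k \<in> \<int>\<^sup>n\<close> of the integral over \<open>s\<close> of \<open>F (k / 2 - s)\<close>, where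
  \<open>F x = \<eta> x det [S (x\<^sub>i - x\<^sub>j)]\<close>. By Poisson summation
  this is the sum of the Fourier transform of \<open>F\<close> over the points \<open>2 m\<close> with \<open>\<Sum> m\<^sub>i = 0\<close>. Since
  \<open>S\<close> has its spectrum in \<open>[-1/2, 1/2]\<close>, the value at \<open>2 m\<close> is an average of values of
  the transform of \<open>\<eta>\<close> at points \<open>2 m - \<alpha>\<close> with \<open>\<Sum> \<alpha>\<^sub>i = 0\<close> and \<open>\<bar>\<alpha>\<^sub>i\<bar> \<le> 1\<close>. If \<open>m \<noteq> 0\<close>, some
  entry of \<open>m\<close> is positive and another negative, so such a point has \<open>\<ell>\<^sup>1\<close>-norm at least 2 and
  the value vanishes; only \<open>m = 0\<close>, the integral of \<open>F\<close>, remains.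
\<close>

section \<open>Determinantal probabilities on finite windows\<close>

text \<open>The spacing \<open>1 / 2\<close> is dictated by the number 2 in \<open>K_space\<close>.
  The dual lattice then has spacing 2, while multiplication by the determinant spreads the spectrum
  by at most 1 in each coordinate; a coarser lattice would admit frequencies of norm below 2, about
  which nothing is assumed. The window lengths balance two opposite demands. Translates of a pattern
  that cross the end of a window are uncontrolled, which asks for few windows; deviations inside
  long windows add up, which asks for short ones. With \<open>K\<close> windows of length of order
  \<open>K\<close>, hence of order \<open>K^2\<close> sites, the first error is of order
  \<open>K\<close> and the second of order \<open>K^(3/2)\<close>. In place of independence, the
  greedy choice uses that the cross terms of a quadratic potential have mean zero. The periodized
  function is only known to be continuous, with no rate for its Fourier coefficients. Poisson
  summation is therefore proved in the form where every nonconstant coefficient is zero, which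
  avoids any question of convergence of Fourier series.\<close>

text \<open>A determinant indexed by an arbitrary finite set, so that principal minors need no
  enumeration of their index set.\<close>

definition perm_det :: "'a set \<Rightarrow> ('a \<Rightarrow> 'a \<Rightarrow> 'b) \<Rightarrow> 'b :: comm_ring_1" where
  "perm_det B K = (\<Sum>\<sigma> | \<sigma> permutes B. of_int (sign \<sigma>) * (\<Prod>i\<in>B. K i (\<sigma> i)))"

lemma perm_det_empty [simp]: "perm_det {} K = 1"
  by (simp add: perm_det_def)

lemma perm_det_cong:
  assumes "\<And>i j. i \<in> B \<Longrightarrow> j \<in> B \<Longrightarrow> K i j = K' i j"
  shows "perm_det B K = perm_det B K'"
  unfolding perm_det_def
  by (intro sum.cong refl arg_cong2[where f="(*)"] prod.cong assms) (auto simp: permutes_in_image)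

text \<open>Conjugation by \<open>f\<close> maps the permutations of \<open>A\<close> onto those of
  \<open>B\<close> and preserves signs. \<open>?g \<pi>\<close> is the conjugate, extended by the
  identity outside \<open>B\<close> because permutations act on the whole type.\<close>

lemma perm_det_reindex:
  assumes "bij_betw f A B" "finite A"
  shows "perm_det B K = perm_det A (\<lambda>i j. K (f i) (f j))"
proof -
  let ?g = "\<lambda>\<pi> x. if x \<in> B then f (\<pi> (inv_into A f x)) else x"
  have "perm_det B K = (\<Sum>\<pi> | \<pi> permutes A. of_int (sign (?g \<pi>)) * (\<Prod>i\<in>B. K i (?g \<pi> i)))"
    unfolding perm_det_def
    by (rule sum.reindex_bij_betw[symmetric, OF bij_betw_permutations[OF assms(1)]])
  also have "\<dots> = perm_det A (\<lambda>i j. K (f i) (f j))"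
    unfolding perm_det_def
  proof (rule sum.cong[OF refl])
    fix \<pi> assume "\<pi> \<in> {\<pi>. \<pi> permutes A}"
    then interpret permutes_bij_finite \<pi> A B f "inv_into A f" "?g \<pi>"
      by unfold_locales (use assms in \<open>auto simp: bij_betw_def intro: inv_into_f_f\<close>)
    have "(\<Prod>i\<in>B. K i (?g \<pi> i)) = (\<Prod>i\<in>A. K (f i) (?g \<pi> (f i)))"
      by (rule prod.reindex_bij_betw[symmetric, OF assms(1)])
    also have "\<dots> = (\<Prod>i\<in>A. K (f i) (f (\<pi> i)))"
      using assms(1) by (intro prod.cong) (auto simp: bij_betw_def)
    finally show "of_int (sign (?g \<pi>)) * (\<Prod>i\<in>B. K i (?g \<pi> i)) =
       of_int (sign \<pi>) * (\<Prod>i\<in>A. K (f i) (f (\<pi> i)))"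
      by (simp add: sign_p')
  qed
  finally show ?thesis .
qed

lemma det_mat_eq_perm_det:
  "Determinant.det (Matrix.mat n n (\<lambda>(i, j). K i j)) = perm_det {..<n} K"
  by (subst det_def'[of _ n])
     (auto simp: perm_det_def atLeast0LessThan intro!: sum.cong prod.cong dest: permutes_in_image)

text \<open>A permutation that moves a point outside \<open>Y\<close> picks a zero in that row, so
  only the permutations of \<open>Y\<close> contribute.\<close>

lemma perm_det_unit_rows:
  assumes "finite B" "Y \<subseteq> B"
  shows "perm_det B (\<lambda>i j. if i \<in> Y then K i j else of_bool (i = j)) = perm_det Y K"
proof -
  have eq: "(\<Prod>i\<in>B. if i \<in> Y then K i (\<sigma> i) else of_bool (i = \<sigma> i)) =
      (if \<sigma> permutes Y then (\<Prod>i\<in>Y. K i (\<sigma> i)) else 0)" if \<sigma>: "\<sigma> permutes B" for \<sigma>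
  proof (cases "\<forall>i\<in>B - Y. \<sigma> i = i")
    case True
    then have "\<sigma> permutes Y"
      by (intro permutes_superset[OF \<sigma>]) auto
    moreover have "(\<Prod>i\<in>B. if i \<in> Y then K i (\<sigma> i) else of_bool (i = \<sigma> i)) = (\<Prod>i\<in>Y. K i (\<sigma> i))"
      using assms True by (intro prod.mono_neutral_cong_right) auto
    ultimately show ?thesis by simp
  next
    case False
    then have "\<not> \<sigma> permutes Y" using permutes_not_in by fastforce
    moreover from False have "(\<Prod>i\<in>B. if i \<in> Y then K i (\<sigma> i) else of_bool (i = \<sigma> i)) = 0"
      using assms by (intro prod_zero) auto
    ultimately show ?thesis by simp
  qed
  have "perm_det B (\<lambda>i j. if i \<in> Y then K i j else of_bool (i = j)) =
     (\<Sum>\<sigma> | \<sigma> permutes B. of_int (sign \<sigma>) * (if \<sigma> permutes Y then (\<Prod>i\<in>Y. K i (\<sigma> i)) else 0))"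
    unfolding perm_det_def by (intro sum.cong refl) (simp only: eq mem_Collect_eq)
  also have "\<dots> = perm_det Y K"
    unfolding perm_det_def using assms
    by (intro sum.mono_neutral_cong_right finite_permutations) (auto intro: permutes_subset)
  finally show ?thesis .
qed

text \<open>By multilinearity in the rows outside \<open>Y\<close>.\<close>

lemma sum_perm_det_supersets:
  fixes K :: "'a \<Rightarrow> 'a \<Rightarrow> 'b :: comm_ring_1"
  assumes "finite B" "Y \<subseteq> B"
  shows "(\<Sum>X | Y \<subseteq> X \<and> X \<subseteq> B. perm_det B (\<lambda>i j. if i \<in> X then K i j else of_bool (i = j) - K i j))
         = perm_det Y K"
proof -
  let ?S = "{X. Y \<subseteq> X \<and> X \<subseteq> B}"
  have fin: "finite ?S" using assms by (auto intro: finite_subset[of _ "Pow B"])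
  have eq: "(\<Sum>X\<in>?S. (\<Prod>i\<in>B. if i \<in> X then K i (\<sigma> i) else of_bool (i = \<sigma> i) - K i (\<sigma> i))) =
     (\<Prod>i\<in>B. if i \<in> Y then K i (\<sigma> i) else of_bool (i = \<sigma> i))" for \<sigma> :: "'a \<Rightarrow> 'a"
  proof -
    let ?a = "\<lambda>i. K i (\<sigma> i)" and ?b = "\<lambda>i. of_bool (i = \<sigma> i) - K i (\<sigma> i)"
    \<comment> \<open>Outside \<open>Y\<close> the unit entry is \<open>?a i + ?b i\<close>. In the
      expansion of the product, \<open>Z\<close> collects the rows where \<open>?a\<close> is taken,
      and \<open>X = Y \<union> Z\<close>.\<close>
    have "(\<Prod>i\<in>B. if i \<in> Y then ?a i else of_bool (i = \<sigma> i)) =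
       (\<Prod>i\<in>Y. ?a i) * (\<Prod>i\<in>B - Y. ?a i + ?b i)"
      using assms by (subst prod.subset_diff[OF assms(2,1)])
        (auto simp: mult.commute intro!: arg_cong2[where f="(*)"] prod.cong)
    also have "\<dots> = (\<Sum>Z\<in>Pow (B - Y). (\<Prod>i\<in>Y. ?a i) * ((\<Prod>i\<in>Z. ?a i) * (\<Prod>i\<in>B - Y - Z. ?b i)))"
      using assms by (subst prod_add) (auto simp: sum_distrib_left)
    also have "\<dots> = (\<Sum>Z\<in>Pow (B - Y). \<Prod>i\<in>B. if i \<in> Y \<union> Z then ?a i else ?b i)"
    proof (rule sum.cong[OF refl])
      fix Z assume Z: "Z \<in> Pow (B - Y)"
      have B: "B = (Y \<union> Z) \<union> (B - Y - Z)" using Z assms by auto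
      have fin: "finite Y" "finite Z" using Z assms by (auto intro: finite_subset)
      have "(\<Prod>i\<in>B. if i \<in> Y \<union> Z then ?a i else ?b i) =
         (\<Prod>i\<in>Y \<union> Z. if i \<in> Y \<union> Z then ?a i else ?b i) * (\<Prod>i\<in>B - Y - Z. if i \<in> Y \<union> Z then ?a i else ?b i)"
        by (subst B, subst prod.union_disjoint) (use Z fin assms in auto)
      also have "\<dots> = (\<Prod>i\<in>Y \<union> Z. ?a i) * (\<Prod>i\<in>B - Y - Z. ?b i)"
        by (intro arg_cong2[where f="(*)"] prod.cong) auto
      also have "(\<Prod>i\<in>Y \<union> Z. ?a i) = (\<Prod>i\<in>Y. ?a i) * (\<Prod>i\<in>Z. ?a i)"
        using Z fin by (intro prod.union_disjoint) auto
      finally show "(\<Prod>i\<in>Y. ?a i) * ((\<Prod>i\<in>Z. ?a i) * (\<Prod>i\<in>B - Y - Z. ?b i)) =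
         (\<Prod>i\<in>B. if i \<in> Y \<union> Z then ?a i else ?b i)" by (simp add: mult.assoc)
    qed
    also have "\<dots> = (\<Sum>X\<in>?S. \<Prod>i\<in>B. if i \<in> X then ?a i else ?b i)"
      by (rule sum.reindex_bij_witness[of _ "\<lambda>X. X - Y" "\<lambda>Z. Y \<union> Z"]) (use assms in \<open>auto simp: Un_absorb1\<close>)
    finally show ?thesis by simp
  qed
  have "(\<Sum>X\<in>?S. perm_det B (\<lambda>i j. if i \<in> X then K i j else of_bool (i = j) - K i j)) =
    (\<Sum>\<sigma> | \<sigma> permutes B. of_int (sign \<sigma>) *
      (\<Sum>X\<in>?S. (\<Prod>i\<in>B. if i \<in> X then K i (\<sigma> i) else of_bool (i = \<sigma> i) - K i (\<sigma> i))))"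
    unfolding perm_det_def sum_distrib_left by (rule sum.swap)
  also have "\<dots> = perm_det B (\<lambda>i j. if i \<in> Y then K i j else of_bool (i = j))"
    unfolding eq perm_det_def ..
  also have "\<dots> = perm_det Y K" by (rule perm_det_unit_rows[OF assms])
  finally show ?thesis .
qed

text \<open>The determinant is positive for \<open>K = 1 / 2\<close> and does not vanish along the segment from
  \<open>1 / 2\<close> to \<open>K\<close>, except possibly at its end.\<close>

lemma perm_det_mixed_nonneg:
  fixes K :: "nat \<Rightarrow> nat \<Rightarrow> real"
  assumes sym: "\<And>i j. K i j = K j i"
    and psd: "\<And>v. 0 \<le> (\<Sum>i<n. \<Sum>j<n. v i * v j * K i j)"
    and le: "\<And>v. (\<Sum>i<n. \<Sum>j<n. v i * v j * K i j) \<le> (\<Sum>i<n. (v i)\<^sup>2)"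
  shows "0 \<le> perm_det {..<n} (\<lambda>i j. if i \<in> X then K i j else of_bool (i = j) - K i j)"
proof -
  \<comment> \<open>Mixing \<open>K\<close> with the scalar \<open>1 / 2\<close> keeps both
    \<open>Kt t\<close> and \<open>1 - Kt t\<close> at least \<open>(1 - t) / 2\<close> as quadratic
    forms (\<open>lo\<close> and \<open>hi\<close> below), hence definite for
    \<open>t < 1\<close>.\<close>
  define Kt where "Kt t i j = (1 - t) / 2 * of_bool (i = j) + t * K i j" for t :: real and i j
  define A where "A t i j = (if i \<in> X then Kt t i j else of_bool (i = j) - Kt t i j)" for t i j
  define f where "f t = perm_det {..<n} (A t)" for t
  \<comment> \<open>At \<open>t = 0\<close> rows inside and outside \<open>X\<close> coincide: each
    is half a unit row.\<close>
  have f0: "f 0 > 0"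
  proof -
    have "f 0 = (1 / 2) ^ n * perm_det {..<n} (\<lambda>i j. if i \<in> {} then 0 else of_bool (i = j))"
      unfolding f_def perm_det_def sum_distrib_left
    proof (intro sum.cong refl)
      fix \<sigma> :: "nat \<Rightarrow> nat"
      have "(\<Prod>i<n. A 0 i (\<sigma> i)) = (\<Prod>i<n. 1 / 2 * of_bool (i = \<sigma> i))"
        by (intro prod.cong) (auto simp: A_def Kt_def)
      then show "of_int (sign \<sigma>) * (\<Prod>i<n. A 0 i (\<sigma> i)) = (1 / 2) ^ n *
         (of_int (sign \<sigma>) * (\<Prod>i<n. if i \<in> {} then 0 else of_bool (i = \<sigma> i)))"
        by (simp only: prod.distrib) simp
    qed
    then show ?thesis by (subst (asm) perm_det_unit_rows) auto
  qed
  have nz: "f t \<noteq> 0" if t: "0 \<le> t" "t < 1" for t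
  proof
    assume "f t = 0"
    then have "Determinant.det (Matrix.mat n n (\<lambda>(i, j). A t i j)) = 0"
      by (simp add: det_mat_eq_perm_det f_def)
    then obtain v where v: "v \<in> carrier_vec n" "v \<noteq> 0\<^sub>v n"
      and Av: "Matrix.mat n n (\<lambda>(i, j). A t i j) *\<^sub>v v = 0\<^sub>v n"
      by (subst (asm) det_0_iff_vec_prod_zero[of _ n]) auto
    define w where "w i = v $ i" for i
    \<comment> \<open>As operators, \<open>u = Kt w\<close> and \<open>z = (1 - Kt) w\<close>. A
      null vector \<open>w\<close> of the mixed matrix has \<open>u i = 0\<close> for
      \<open>i \<in> X\<close> and \<open>z i = 0\<close> for the other \<open>i\<close>, so
      \<open>u\<close> and \<open>z\<close> are orthogonal.\<close>
    define u where "u i = (\<Sum>j<n. Kt t i j * w j)" for i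
    define z where "z i = w i - u i" for i
    define Ku where "Ku i = (\<Sum>j<n. Kt t i j * u j)" for i
    have row: "(\<Sum>j<n. A t i j * w j) = 0" if "i < n" for i
    proof -
      have "(Matrix.mat n n (\<lambda>(i, j). A t i j) *\<^sub>v v) $ i = 0" using Av that by simp
      then show ?thesis using that v
        by (simp add: scalar_prod_def w_def atLeast0LessThan)
    qed
    have d: "(\<Sum>j<n. of_bool (i = j) * w j) = w i" if "i < n" for i
      using that sum.delta'[of "{..<n}" i w] by (simp add: of_bool_def if_distrib[of "\<lambda>x. x * _"] cong: if_cong)
    have uz: "u i * z i = 0" if "i < n" for i
      using row[OF that] d[OF that]
      by (cases "i \<in> X") (auto simp: A_def u_def z_def left_diff_distrib sum_subtractf)
    have q: "(\<Sum>i<n. \<Sum>j<n. a i * a j * Kt t i j) =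
        (1 - t) / 2 * (\<Sum>i<n. (a i)\<^sup>2) + t * (\<Sum>i<n. \<Sum>j<n. a i * a j * K i j)" for a
    proof -
      have "(\<Sum>i<n. \<Sum>j<n. a i * a j * Kt t i j) =
         (\<Sum>i<n. \<Sum>j<n. (1 - t) / 2 * (a i * (of_bool (i = j) * a j)) + t * (a i * a j * K i j))"
        by (intro sum.cong) (auto simp: Kt_def algebra_simps)
      also have "\<dots> = (1 - t) / 2 * (\<Sum>i<n. a i * (\<Sum>j<n. of_bool (i = j) * a j))
            + t * (\<Sum>i<n. \<Sum>j<n. a i * a j * K i j)"
        by (simp only: sum.distrib sum_distrib_left)
      also have "(\<Sum>i<n. a i * (\<Sum>j<n. of_bool (i = j) * a j)) = (\<Sum>i<n. (a i)\<^sup>2)"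
      proof (intro sum.cong refl)
        fix i assume "i \<in> {..<n}"
        then show "a i * (\<Sum>j<n. of_bool (i = j) * a j) = (a i)\<^sup>2"
          using sum.delta'[of "{..<n}" i a]
          by (simp add: of_bool_def if_distrib[of "\<lambda>x. x * _"] power2_eq_square cong: if_cong)
      qed
      finally show ?thesis .
    qed
    have lo: "(1 - t) / 2 * (\<Sum>i<n. (a i)\<^sup>2) \<le> (\<Sum>i<n. \<Sum>j<n. a i * a j * Kt t i j)" for a
      using mult_nonneg_nonneg[OF t(1) psd[of a]] unfolding q by simp
    have hi: "(1 - t) / 2 * (\<Sum>i<n. (a i)\<^sup>2) \<le> (\<Sum>i<n. (a i)\<^sup>2) - (\<Sum>i<n. \<Sum>j<n. a i * a j * Kt t i j)" for a
      using mult_left_mono[OF le[of a] t(1)] unfolding q by (simp add: field_simps)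
    have symt: "Kt t i j = Kt t j i" for i j
      unfolding Kt_def using sym[of i j] by auto
    have Kz: "(\<Sum>j<n. Kt t i j * z j) = u i - Ku i" for i
      by (simp add: z_def Ku_def u_def right_diff_distrib sum_subtractf)
    have qz: "(\<Sum>i<n. \<Sum>j<n. z i * z j * Kt t i j) = (\<Sum>i<n. z i * (u i - Ku i))"
      unfolding Kz[symmetric] sum_distrib_left by (intro sum.cong) (auto simp: mult_ac)
    have qu: "(\<Sum>i<n. \<Sum>j<n. u i * u j * Kt t i j) = (\<Sum>i<n. u i * Ku i)"
      unfolding Ku_def sum_distrib_left by (intro sum.cong) (auto simp: mult_ac)
    have adj: "(\<Sum>i<n. w i * Ku i) = (\<Sum>i<n. u i * u i)"
    proof -
      have "(\<Sum>i<n. w i * Ku i) = (\<Sum>i<n. \<Sum>j<n. w i * (Kt t i j * u j))"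
        by (simp add: Ku_def sum_distrib_left)
      also have "\<dots> = (\<Sum>j<n. \<Sum>i<n. w i * (Kt t i j * u j))" by (rule sum.swap)
      also have "\<dots> = (\<Sum>j<n. (\<Sum>i<n. Kt t j i * w i) * u j)"
        unfolding sum_distrib_right by (intro sum.cong refl) (simp add: symt mult_ac)
      finally show ?thesis by (simp add: u_def)
    qed
    \<comment> \<open>\<open>K - K\<^sup>2 = K (1 - K) K + (1 - K) K (1 - K)\<close>\<close>
    have "((\<Sum>i<n. (u i)\<^sup>2) - (\<Sum>i<n. u i * Ku i)) + (\<Sum>i<n. z i * (u i - Ku i)) = (\<Sum>i<n. u i * z i)"
      using adj by (simp add: z_def algebra_simps sum.distrib sum_subtractf power2_eq_square)
    also have "\<dots> = 0" using uz by (intro sum.neutral) auto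
    finally have "(1 - t) / 2 * (\<Sum>i<n. (u i)\<^sup>2) + (1 - t) / 2 * (\<Sum>i<n. (z i)\<^sup>2) \<le> 0"
      using hi[of u] lo[of z] unfolding qz qu by linarith
    then have "(1 - t) / 2 * ((\<Sum>i<n. (u i)\<^sup>2) + (\<Sum>i<n. (z i)\<^sup>2)) \<le> 0"
      by (simp only: distrib_left)
    then have "(\<Sum>i<n. (u i)\<^sup>2) + (\<Sum>i<n. (z i)\<^sup>2) \<le> 0"
      using t by (simp add: mult_le_0_iff)
    moreover have "0 \<le> (\<Sum>i<n. (u i)\<^sup>2)" "0 \<le> (\<Sum>i<n. (z i)\<^sup>2)" by (auto intro: sum_nonneg)
    ultimately have "(\<Sum>i<n. (u i)\<^sup>2) = 0" "(\<Sum>i<n. (z i)\<^sup>2) = 0" by linarith+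
    then have "u i = 0" "z i = 0" if "i < n" for i
      using that by (auto simp: sum_nonneg_eq_0_iff)
    then have "w i = 0" if "i < n" for i using that by (auto simp: z_def)
    then have "v = 0\<^sub>v n" using v by (auto simp: w_def)
    with v show False by simp
  qed
  have cont: "continuous_on {0..1} f"
    unfolding f_def perm_det_def
  proof (intro continuous_intros)
    fix \<sigma> :: "nat \<Rightarrow> nat" and i
    show "continuous_on {0..1} (\<lambda>x. A x i (\<sigma> i))"
      by (cases "i \<in> X") (auto simp: A_def Kt_def intro!: continuous_intros)
  qed
  have "f 1 \<ge> 0"
  proof (rule ccontr)
    \<comment> \<open>A negative \<open>f 1\<close> forces a zero of \<open>f\<close> strictly
      before 1, where \<open>nz\<close> forbids it.\<close>
    assume "\<not> f 1 \<ge> 0"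
    then obtain t where t: "0 \<le> t" "t \<le> 1" "f t = 0"
      using IVT2'[of f 1 0 0] f0 cont by auto
    with nz[of t] \<open>\<not> f 1 \<ge> 0\<close> show False by (cases "t = 1") auto
  qed
  moreover have "f 1 = perm_det {..<n} (\<lambda>i j. if i \<in> X then K i j else of_bool (i = j) - K i j)"
    by (simp add: f_def A_def[abs_def] Kt_def cong: if_cong)
  ultimately show ?thesis by simp
qed

text \<open>The integer \<open>i\<close> stands for the point \<open>i / 2\<close>; the factor \<open>1 / 2\<close> is the density per lattice
  site.\<close>

definition lattice_kernel :: "int \<Rightarrow> int \<Rightarrow> real" where
  "lattice_kernel i j = sine_kernel (of_int (i - j) / 2) / 2"

section \<open>The lattice kernel as a quadratic form between 0 and 1\<close>

lemma sine_kernel_minus [simp]: "sine_kernel (- x) = sine_kernel x"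
  by (simp add: sine_kernel_def)

lemma lattice_kernel_sym: "lattice_kernel i j = lattice_kernel j i"
  using sine_kernel_minus[of "of_int (i - j) / 2"]
  by (simp add: lattice_kernel_def minus_divide_left del: sine_kernel_minus)

lemma has_integral_cos_interval:
  fixes a d :: real
  assumes "d \<noteq> 0" "a \<ge> 0"
  shows "((\<lambda>\<theta>. cos (2 * pi * \<theta> * d)) has_integral sin (2 * pi * a * d) / (pi * d)) {-a..a}"
proof -
  have "((\<lambda>\<theta>. cos (2 * pi * \<theta> * d)) has_integral
      sin (2 * pi * a * d) / (2 * pi * d) - sin (2 * pi * (-a) * d) / (2 * pi * d)) {-a..a}"
    using assms
    by (intro fundamental_theorem_of_calculus)
       (auto intro!: derivative_eq_intros simp: has_real_derivative_iff_has_vector_derivative[symmetric])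
  moreover have "sin (2 * pi * a * d) / (2 * pi * d) - sin (2 * pi * (-a) * d) / (2 * pi * d)
      = sin (2 * pi * a * d) / (pi * d)"
    using assms by (simp add: field_simps)
  ultimately show ?thesis by simp
qed

text \<open>The symbol of the kernel is the indicator of \<open>[-1/4, 1/4]\<close>, half of the
  period \<open>[-1/2, 1/2]\<close>. On the whole lattice it is thus an orthogonal projection, and
  its finite sections inherit \<open>0 \<le> K \<le> 1\<close>.\<close>

lemma lattice_kernel_has_integral:
  "((\<lambda>\<theta>. cos (2 * pi * \<theta> * of_int (i - j))) has_integral lattice_kernel i j) {-(1/4)..1/4}"
proof (cases "i = j")
  case True
  then show ?thesis
    using has_integral_const_real[of "1::real" "-(1/4)" "1/4"] by (simp add: lattice_kernel_def sine_kernel_def)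
next
  case False
  then show ?thesis
    using has_integral_cos_interval[of "of_int (i - j)" "1/4"]
    by (simp add: lattice_kernel_def sine_kernel_def)
qed

lemma of_bool_has_integral_cos:
  fixes i j :: int
  shows "((\<lambda>\<theta>. cos (2 * pi * \<theta> * of_int (i - j))) has_integral of_bool (i = j)) {-(1/2)..1/2}"
proof (cases "i = j")
  case True
  then show ?thesis
    using has_integral_const_real[of "1::real" "-(1/2)" "1/2"] by simp
next
  case False
  have "sin (2 * pi * (1/2) * of_int (i - j)) = 0"
    using sin_integer_2pi[of "of_int (i-j)/2"] by (simp add: sin_zero_iff_int2) (metis mult.commute of_int_diff)
  with False show ?thesis
    using has_integral_cos_interval[of "of_int (i - j)" "1/2"] by simp
qed

text \<open>The form of the kernel is the integral of the squared modulus \<open>q\<close> of the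
  trigonometric polynomial with coefficients \<open>v\<close> over the inner half of the period,
  while the sum of the \<open>(v i)^2\<close> is its integral over the whole period
  (Parseval).\<close>

lemma lattice_kernel_bounds:
  fixes v :: "int \<Rightarrow> real"
  assumes "finite B"
  shows "0 \<le> (\<Sum>i\<in>B. \<Sum>j\<in>B. v i * v j * lattice_kernel i j)"
    and "(\<Sum>i\<in>B. \<Sum>j\<in>B. v i * v j * lattice_kernel i j) \<le> (\<Sum>i\<in>B. (v i)\<^sup>2)"
proof -
  define q where "q \<theta> = (\<Sum>i\<in>B. \<Sum>j\<in>B. v i * v j * cos (2 * pi * \<theta> * of_int (i - j)))" for \<theta>
  have q_eq: "q \<theta> = (\<Sum>i\<in>B. v i * cos (2 * pi * \<theta> * of_int i))\<^sup>2 + (\<Sum>i\<in>B. v i * sin (2 * pi * \<theta> * of_int i))\<^sup>2" for \<theta>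
    unfolding q_def power2_eq_square sum_product sum.distrib[symmetric]
    by (intro sum.cong refl) (simp add: right_diff_distrib cos_diff algebra_simps)
  have q_nonneg: "q \<theta> \<ge> 0" for \<theta> unfolding q_eq by simp
  have 1: "(q has_integral (\<Sum>i\<in>B. \<Sum>j\<in>B. v i * v j * lattice_kernel i j)) {-(1/4)..1/4}"
    unfolding q_def
    by (intro has_integral_sum assms has_integral_mult_right lattice_kernel_has_integral)
  have 2: "(q has_integral (\<Sum>i\<in>B. \<Sum>j\<in>B. v i * v j * of_bool (i = j))) {-(1/2)..1/2}"
    unfolding q_def
    by (intro has_integral_sum assms has_integral_mult_right of_bool_has_integral_cos)
  have 3: "(\<Sum>i\<in>B. \<Sum>j\<in>B. v i * v j * of_bool (i = j)) = (\<Sum>i\<in>B. (v i)\<^sup>2)"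
    using assms by (intro sum.cong refl) (simp add: of_bool_def if_distrib power2_eq_square cong: if_cong)
  show "0 \<le> (\<Sum>i\<in>B. \<Sum>j\<in>B. v i * v j * lattice_kernel i j)"
    using has_integral_nonneg[OF 1] q_nonneg by auto
  show "(\<Sum>i\<in>B. \<Sum>j\<in>B. v i * v j * lattice_kernel i j) \<le> (\<Sum>i\<in>B. (v i)\<^sup>2)"
    using has_integral_subset_le[OF _ 1 2] q_nonneg 3 by auto
qed

text \<open>The probability that the process meets the window \<open>B\<close> exactly in \<open>X\<close>.\<close>

definition window_prob :: "int set \<Rightarrow> int set \<Rightarrow> real" where
  "window_prob B X =
     perm_det B (\<lambda>i j. if i \<in> X then lattice_kernel i j else of_bool (i = j) - lattice_kernel i j)"

lemma window_prob_nonneg: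
  assumes "finite B"
  shows "0 \<le> window_prob B X"
proof -
  obtain f where f: "bij_betw f {..<card B} B"
    using ex_bij_betw_nat_finite[OF assms] by (auto simp: atLeast0LessThan)
  then have inj: "inj_on f {..<card B}" and im: "f ` {..<card B} = B" by (auto simp: bij_betw_def)
  have s: "(\<Sum>i<card B. g (f i)) = (\<Sum>i\<in>B. g i)" for g :: "int \<Rightarrow> real"
    by (rule sum.reindex_bij_betw[OF f])
  have "window_prob B X = perm_det {..<card B} (\<lambda>i j. if i \<in> f -` X then lattice_kernel (f i) (f j)
      else of_bool (i = j) - lattice_kernel (f i) (f j))"
    unfolding window_prob_def
    by (subst perm_det_reindex[OF f]) (use inj in \<open>auto intro!: perm_det_cong simp: inj_on_eq_iff\<close>)
  moreover have "0 \<le> \<dots>"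
  proof (rule perm_det_mixed_nonneg)
    show "lattice_kernel (f i) (f j) = lattice_kernel (f j) (f i)" for i j by (rule lattice_kernel_sym)
    fix v :: "nat \<Rightarrow> real"
    define g where "g = inv_into {..<card B} f"
    have g: "g (f i) = i" if "i < card B" for i using that inj by (simp add: g_def)
    have "(\<Sum>i<card B. \<Sum>j<card B. v i * v j * lattice_kernel (f i) (f j)) =
        (\<Sum>i<card B. \<Sum>j<card B. v (g (f i)) * v (g (f j)) * lattice_kernel (f i) (f j))"
      by (intro sum.cong) (auto simp: g)
    also have "\<dots> = (\<Sum>i\<in>B. \<Sum>j\<in>B. v (g i) * v (g j) * lattice_kernel i j)"
      by (simp add: s[of "\<lambda>j. v (g _) * v (g j) * lattice_kernel _ j"]
           s[of "\<lambda>i. \<Sum>j\<in>B. v (g i) * v (g j) * lattice_kernel i j"])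
    finally have *: "(\<Sum>i<card B. \<Sum>j<card B. v i * v j * lattice_kernel (f i) (f j)) =
        (\<Sum>i\<in>B. \<Sum>j\<in>B. v (g i) * v (g j) * lattice_kernel i j)" .
    have **: "(\<Sum>i<card B. (v i)\<^sup>2) = (\<Sum>i\<in>B. (v (g i))\<^sup>2)"
      by (subst s[symmetric]) (auto simp: g)
    show "0 \<le> (\<Sum>i<card B. \<Sum>j<card B. v i * v j * lattice_kernel (f i) (f j))"
      unfolding * by (rule lattice_kernel_bounds[OF assms])
    show "(\<Sum>i<card B. \<Sum>j<card B. v i * v j * lattice_kernel (f i) (f j)) \<le> (\<Sum>i<card B. (v i)\<^sup>2)"
      unfolding * ** by (rule lattice_kernel_bounds[OF assms])
  qed
  ultimately show ?thesis by simp
qed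

text \<open>The case \<open>Y = {}\<close> gives total mass 1, so together with nonnegativity
  \<open>window_prob B\<close> is a probability on \<open>Pow B\<close>. The right side does not
  mention \<open>B\<close>: windows of all lengths share their pattern probabilities.\<close>

lemma sum_window_prob_supersets:
  assumes "finite B" "Y \<subseteq> B"
  shows "(\<Sum>X | Y \<subseteq> X \<and> X \<subseteq> B. window_prob B X) = perm_det Y lattice_kernel"
  unfolding window_prob_def by (rule sum_perm_det_supersets[OF assms])

lemma perm_det_lattice_kernel_shift:
  assumes "finite Y"
  shows "perm_det ((+) a ` Y) lattice_kernel = perm_det Y lattice_kernel"
  by (subst perm_det_reindex[of "(+) a" Y])
     (use assms in \<open>auto simp: bij_betw_def lattice_kernel_def intro!: perm_det_cong\<close>)

section \<open>A set with prescribed pattern densities\<close>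

text \<open>
  Let \<open>E i\<close> be the accumulated deviation of the \<open>i\<close>-th statistic, counted from step \<open>i\<close> on so
  that only finitely many are active. As \<open>d i k\<close> has mean zero, the mean of
  \<open>\<Sum> 2\<^sup>-\<^sup>i (E i + d i k X)\<^sup>2\<close> exceeds \<open>\<Sum> 2\<^sup>-\<^sup>i (E i)\<^sup>2\<close> by at most \<open>2 (L k)\<^sup>2\<close>, hence so does some outcome.
\<close>

lemma greedy_selection:
  fixes \<Omega> :: "nat \<Rightarrow> 'a set" and p :: "nat \<Rightarrow> 'a \<Rightarrow> real" and d :: "nat \<Rightarrow> nat \<Rightarrow> 'a \<Rightarrow> real"
  assumes fin: "\<And>k. finite (\<Omega> k)"
    and nonneg: "\<And>k X. X \<in> \<Omega> k \<Longrightarrow> 0 \<le> p k X"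
    and total: "\<And>k. (\<Sum>X\<in>\<Omega> k. p k X) = 1"
    and mean: "\<And>i k. (\<Sum>X\<in>\<Omega> k. p k X * d i k X) = 0"
    and bound: "\<And>i k X. X \<in> \<Omega> k \<Longrightarrow> \<bar>d i k X\<bar> \<le> L k"
  shows "\<exists>X. (\<forall>k. X k \<in> \<Omega> k) \<and>
    (\<forall>i K. (\<Sum>j=i..<K. d i j (X j))\<^sup>2 \<le> 2 ^ i * (2 * (\<Sum>j<K. (L j)\<^sup>2)))"
proof -
  have step: "\<exists>X\<in>\<Omega> k. (\<Sum>i\<le>k. (1/2)^i * (E i + d i k X)\<^sup>2) \<le> (\<Sum>i\<le>k. (1/2)^i * (E i)\<^sup>2) + 2 * (L k)\<^sup>2"
    for k :: nat and E :: "nat \<Rightarrow> real"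
  proof (rule ccontr)
    define g where "g X = (\<Sum>i\<le>k. (1/2)^i * (E i + d i k X)\<^sup>2)" for X
    define b where "b = (\<Sum>i\<le>k. (1/2)^i * (E i)\<^sup>2) + 2 * (L k)\<^sup>2"
    assume "\<not> ?thesis"
    then have gt: "g X > b" if "X \<in> \<Omega> k" for X using that by (force simp: g_def b_def)
    have ne: "\<Omega> k \<noteq> {}" using total[of k] by auto
    \<comment> \<open>If every outcome were bad, the smallest value of \<open>g\<close> would exceed
      \<open>b\<close>; but it is at most the mean of \<open>g\<close>.\<close>
    define m where "m = Min (g ` \<Omega> k)"
    have m: "m > b" "\<And>X. X \<in> \<Omega> k \<Longrightarrow> m \<le> g X"
      using fin ne gt by (auto simp: m_def)
    have "m = (\<Sum>X\<in>\<Omega> k. p k X * m)"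
      by (simp add: sum_distrib_right[symmetric] total)
    also have "\<dots> \<le> (\<Sum>X\<in>\<Omega> k. p k X * g X)"
      using m nonneg by (intro sum_mono mult_left_mono) auto
    also have "\<dots> \<le> (\<Sum>X\<in>\<Omega> k. p k X * (\<Sum>i\<le>k. (1/2)^i * ((E i)\<^sup>2 + 2 * E i * d i k X + (L k)\<^sup>2)))"
      unfolding g_def
    proof (intro sum_mono mult_left_mono nonneg)
      fix X i assume "X \<in> \<Omega> k"
      then have "(d i k X)\<^sup>2 \<le> (L k)\<^sup>2" using bound[of X k i] by (intro power2_le_iff_abs_le[THEN iffD2]) auto
      then show "(E i + d i k X)\<^sup>2 \<le> (E i)\<^sup>2 + 2 * E i * d i k X + (L k)\<^sup>2"
        by (simp add: power2_sum)
    qed auto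
    also have "\<dots> = (\<Sum>i\<le>k. \<Sum>X\<in>\<Omega> k. p k X * ((1/2)^i * ((E i)\<^sup>2 + 2 * E i * d i k X + (L k)\<^sup>2)))"
      unfolding sum_distrib_left by (rule sum.swap)
    also have "\<dots> = (\<Sum>i\<le>k. (1/2)^i * (((E i)\<^sup>2 + (L k)\<^sup>2) * (\<Sum>X\<in>\<Omega> k. p k X) + 2 * E i * (\<Sum>X\<in>\<Omega> k. p k X * d i k X)))"
    proof (intro sum.cong refl)
      fix i
      have "(\<Sum>X\<in>\<Omega> k. p k X * ((1/2)^i * ((E i)\<^sup>2 + 2 * E i * d i k X + (L k)\<^sup>2))) =
        (\<Sum>X\<in>\<Omega> k. (1/2)^i * ((E i)\<^sup>2 + (L k)\<^sup>2) * p k X + (1/2)^i * (2 * E i) * (p k X * d i k X))"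
        by (intro sum.cong refl) (simp add: algebra_simps)
      also have "\<dots> = (1/2)^i * (((E i)\<^sup>2 + (L k)\<^sup>2) * (\<Sum>X\<in>\<Omega> k. p k X) + 2 * E i * (\<Sum>X\<in>\<Omega> k. p k X * d i k X))"
        by (simp only: sum.distrib sum_distrib_left[symmetric]) (simp add: algebra_simps)
      finally show "(\<Sum>X\<in>\<Omega> k. p k X * ((1/2)^i * ((E i)\<^sup>2 + 2 * E i * d i k X + (L k)\<^sup>2))) = \<dots>" .
    qed
    also have "\<dots> = (\<Sum>i\<le>k. (1/2)^i * (E i)\<^sup>2) + (\<Sum>i\<le>k. (1/2)^i) * (L k)\<^sup>2"
      by (simp add: total mean distrib_left sum.distrib sum_distrib_right)
    also have "\<dots> \<le> b"
    proof -
      have "(\<Sum>i\<le>k. (1/2::real)^i) = 2 - (1/2)^k" by (induction k) auto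
      then have "(\<Sum>i\<le>k. (1/2::real)^i) \<le> 2" by simp
      then show ?thesis unfolding b_def by (intro add_left_mono mult_right_mono) auto
    qed
    finally show False using m by simp
  qed
  define P where "P k s \<longleftrightarrow> (\<forall>i\<ge>k. snd s i = 0) \<and> (\<Sum>i<k. (1/2)^i * (snd s i)\<^sup>2) \<le> 2 * (\<Sum>j<k. (L j)\<^sup>2)"
    for k :: nat and s :: "'a \<times> (nat \<Rightarrow> real)"
  define Q where "Q k s s' \<longleftrightarrow> fst s' \<in> \<Omega> k \<and> snd s' = (\<lambda>i. if i \<le> k then snd s i + d i k (fst s') else 0)"
    for k :: nat and s s' :: "'a \<times> (nat \<Rightarrow> real)"
  have "\<exists>f. \<forall>k. P k (f k) \<and> Q k (f k) (f (Suc k))"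
  proof (rule dependent_nat_choice)
    show "\<exists>s. P 0 s" by (rule exI[of _ "(undefined, \<lambda>_. 0)"]) (simp add: P_def)
  next
    fix s k assume P: "P k s"
    obtain X where X: "X \<in> \<Omega> k"
      "(\<Sum>i\<le>k. (1/2)^i * (snd s i + d i k X)\<^sup>2) \<le> (\<Sum>i\<le>k. (1/2)^i * (snd s i)\<^sup>2) + 2 * (L k)\<^sup>2"
      using step by blast
    \<comment> \<open>Statistic \<open>k\<close> enters here with deviation 0, so it adds nothing to
      the old potential.\<close>
    have "(\<Sum>i\<le>k. (1/2)^i * (snd s i)\<^sup>2) = (\<Sum>i<k. (1/2)^i * (snd s i)\<^sup>2)"
      using P by (simp add: P_def lessThan_Suc_atMost[symmetric])
    then have "P (Suc k) (X, \<lambda>i. if i \<le> k then snd s i + d i k X else 0)"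
      using P X by (simp add: P_def lessThan_Suc_atMost) (simp add: lessThan_Suc_atMost[symmetric])
    moreover have "Q k s (X, \<lambda>i. if i \<le> k then snd s i + d i k X else 0)"
      using X by (simp add: Q_def cong: if_cong)
    ultimately show "\<exists>s'. P (Suc k) s' \<and> Q k s s'" by blast
  qed
  then obtain f where f: "\<And>k. P k (f k)" "\<And>k. Q k (f k) (f (Suc k))" by blast
  define X where "X k = fst (f (Suc k))" for k
  have E: "snd (f K) i = (\<Sum>j=i..<K. d i j (X j))" for i K
  proof (induction K)
    case 0 then show ?case using f(1)[of 0] by (simp add: P_def)
  next
    case (Suc K) then show ?case using f(2)[of K] by (simp add: Q_def X_def)
  qed
  have "(\<Sum>j=i..<K. d i j (X j))\<^sup>2 \<le> 2 ^ i * (2 * (\<Sum>j<K. (L j)\<^sup>2))" for i K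
  proof (cases "i < K")
    case True
    \<comment> \<open>A single term of the weighted potential is kept; undoing its weight costs the
      factor \<open>2 ^ i\<close>.\<close>
    have "(1/2)^i * (snd (f K) i)\<^sup>2 \<le> (\<Sum>i<K. (1/2)^i * (snd (f K) i)\<^sup>2)"
      using True by (intro member_le_sum) auto
    also have "\<dots> \<le> 2 * (\<Sum>j<K. (L j)\<^sup>2)" using f(1)[of K] by (simp add: P_def)
    finally show ?thesis unfolding E by (simp add: field_simps)
  next
    case False
    then show ?thesis by (simp add: sum_nonneg)
  qed
  moreover have "X k \<in> \<Omega> k" for k using f(2)[of k] by (simp add: Q_def X_def)
  ultimately show ?thesis by blast
qed

text \<open>\<open>Y\<close> is the only subset of the window \<open>Y\<close> that contains
  \<open>Y\<close>, so the minor is one of the probabilities belonging to that window.\<close>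

lemma perm_det_lattice_kernel_bounds:
  assumes "finite Y"
  shows "0 \<le> perm_det Y lattice_kernel" "perm_det Y lattice_kernel \<le> 1"
proof -
  have "{X. Y \<subseteq> X \<and> X \<subseteq> Y} = {Y}" by auto
  then have eq: "perm_det Y lattice_kernel = window_prob Y Y"
    using sum_window_prob_supersets[of Y Y] assms by simp
  show "0 \<le> perm_det Y lattice_kernel"
    using eq window_prob_nonneg assms by simp
  have "window_prob Y Y \<le> (\<Sum>X | {} \<subseteq> X \<and> X \<subseteq> Y. window_prob Y X)"
    using assms by (intro member_le_sum window_prob_nonneg) auto
  also have "\<dots> = 1" using sum_window_prob_supersets[of Y "{}"] assms by simp
  finally show "perm_det Y lattice_kernel \<le> 1" using eq by simp
qed

text \<open>For each \<open>y\<close>, the sites \<open>a\<close> with \<open>a + y\<close> outside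
  lie within distance \<open>\<bar>y\<bar>\<close> of one end. The bound does not depend on the
  length of the interval, so a long window loses a negligible share of its translates.\<close>

lemma card_translates_leaving_interval:
  fixes Y :: "int set"
  assumes "finite Y"
  shows "card {a \<in> {l..<u}. \<not> (+) a ` Y \<subseteq> {l..<u}} \<le> (\<Sum>y\<in>Y. nat \<bar>y\<bar>)"
proof -
  have "{a \<in> {l..<u}. \<not> (+) a ` Y \<subseteq> {l..<u}} \<subseteq> (\<Union>y\<in>Y. {a \<in> {l..<u}. a + y \<notin> {l..<u}})" by auto
  then have "card {a \<in> {l..<u}. \<not> (+) a ` Y \<subseteq> {l..<u}} \<le> card (\<Union>y\<in>Y. {a \<in> {l..<u}. a + y \<notin> {l..<u}})"
    using assms by (intro card_mono) (auto intro: finite_subset[of _ "{l..<u}"])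
  also have "\<dots> \<le> (\<Sum>y\<in>Y. card {a \<in> {l..<u}. a + y \<notin> {l..<u}})"
    by (rule card_UN_le[OF assms])
  also have "\<dots> \<le> (\<Sum>y\<in>Y. nat \<bar>y\<bar>)"
  proof (rule sum_mono)
    fix y
    show "card {a \<in> {l..<u}. a + y \<notin> {l..<u}} \<le> nat \<bar>y\<bar>"
    proof (cases "y \<ge> 0")
      case True
      then have "card {a \<in> {l..<u}. a + y \<notin> {l..<u}} \<le> card {u - y..<u}" by (intro card_mono) auto
      with True show ?thesis by simp
    next
      case False
      then have "card {a \<in> {l..<u}. a + y \<notin> {l..<u}} \<le> card {l..<l - y}" by (intro card_mono) auto
      with False show ?thesis by simp
    qed
  qed
  finally show ?thesis .
qed

text \<open>The windows lie between consecutive squares, so the first \<open>K\<close> of them fill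
  \<open>[0, K^2)\<close>. Pattern counts are off by a bounded amount per window because of its
  ends, and by order \<open>K^(3/2)\<close> in total because of the deviations left by
  \<open>greedy_selection\<close>; both are small against \<open>K^2\<close>. The negative integers
  are put into \<open>A\<close> so that it can be enumerated increasingly by all of
  \<open>\<int>\<close>.\<close>

theorem exists_set_with_pattern_densities:
  "\<exists>A :: int set. {..<0} \<subseteq> A \<and>
     (\<forall>Y. finite Y \<longrightarrow>
       (\<lambda>N. real (card {a \<in> {0..<int N}. (+) a ` Y \<subseteq> A}) / real N) \<longlonglongrightarrow> perm_det Y lattice_kernel)"
proof -
  define ys :: "nat \<Rightarrow> int set" where "ys = from_nat_into (Collect finite)"
  have ys: "finite (ys i)" for i
    using from_nat_into[of "Collect finite :: int set set" i] by (auto simp: ys_def)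
  have ys_surj: "\<exists>i. ys i = Y" if "finite Y" for Y
    unfolding ys_def using that from_nat_into_surj[of "Collect finite :: int set set" Y]
    by (auto simp: countable_Collect_finite)
  define B :: "nat \<Rightarrow> int set" where "B k = {(int k)\<^sup>2..<(int k + 1)\<^sup>2}" for k
  define L :: "nat \<Rightarrow> real" where "L k = 2 * real k + 1" for k
  have finB: "finite (B k)" for k by (simp add: B_def)
  have cardB: "real (card (B k)) = L k" for k
    by (simp add: B_def L_def power2_sum)
  define \<rho> :: "int set \<Rightarrow> real" where "\<rho> Y = perm_det Y lattice_kernel" for Y
  define cnt where "cnt Y k X = real (card {a \<in> B k. (+) a ` Y \<subseteq> X})" for Y k X
  \<comment> \<open>The centring uses the number of translates that fit into the window rather than
    its length, which makes the mean exactly 0.\<close>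
  define d where "d i k X = cnt (ys i) k X - cnt (ys i) k (B k) * \<rho> (ys i)" for i k X
  have cnt_bounds: "0 \<le> cnt Y k X" "cnt Y k X \<le> L k" for Y k X
    unfolding cnt_def cardB[symmetric] using finB by (auto intro!: card_mono)
  have \<rho>_bounds: "0 \<le> \<rho> Y" "\<rho> Y \<le> 1" if "finite Y" for Y
    using perm_det_lattice_kernel_bounds[OF that] by (auto simp: \<rho>_def)
  have "\<exists>X. (\<forall>k. X k \<in> Pow (B k)) \<and>
    (\<forall>i K. (\<Sum>j=i..<K. d i j (X j))\<^sup>2 \<le> 2 ^ i * (2 * (\<Sum>j<K. (L j)\<^sup>2)))"
  proof (rule greedy_selection[where p = "\<lambda>k. window_prob (B k)"])
    fix k
    show "finite (Pow (B k))" using finB by simp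
    show "0 \<le> window_prob (B k) X" for X by (rule window_prob_nonneg[OF finB])
    show total: "(\<Sum>X\<in>Pow (B k). window_prob (B k) X) = 1"
      using sum_window_prob_supersets[OF finB, of "{}" k] by (simp add: Pow_def)
    fix i
    show "\<bar>d i k X\<bar> \<le> L k" for X
    proof -
      have "0 \<le> cnt (ys i) k (B k) * \<rho> (ys i)" "cnt (ys i) k (B k) * \<rho> (ys i) \<le> L k * 1"
        using cnt_bounds[of "ys i" k "B k"] \<rho>_bounds[OF ys, of i]
        by (auto intro: mult_nonneg_nonneg mult_mono simp del: mult_1_right)
      then show ?thesis using cnt_bounds[of "ys i" k X] unfolding d_def by linarith
    qed
    have "(\<Sum>X\<in>Pow (B k). window_prob (B k) X * cnt (ys i) k X) =
       (\<Sum>X\<in>Pow (B k). \<Sum>a\<in>B k. if (+) a ` ys i \<subseteq> X then window_prob (B k) X else 0)"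
    proof (intro sum.cong refl)
      fix X
      have "cnt (ys i) k X = (\<Sum>a\<in>B k. if (+) a ` ys i \<subseteq> X then 1 else 0)"
        unfolding cnt_def using finB[of k] by (simp add: sum.If_cases Int_def)
      then show "window_prob (B k) X * cnt (ys i) k X = (\<Sum>a\<in>B k. if (+) a ` ys i \<subseteq> X then window_prob (B k) X else 0)"
        by (simp add: sum_distrib_left if_distrib cong: if_cong)
    qed
    also have "\<dots> = (\<Sum>a\<in>B k. \<Sum>X\<in>Pow (B k). if (+) a ` ys i \<subseteq> X then window_prob (B k) X else 0)"
      by (rule sum.swap)
    \<comment> \<open>A translate inside the window occurs with probability
      \<open>\<rho> (ys i)\<close>; one that sticks out is contained in no outcome.\<close>
    also have "\<dots> = (\<Sum>a\<in>B k. if (+) a ` ys i \<subseteq> B k then \<rho> (ys i) else 0)"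
    proof (intro sum.cong refl)
      fix a
      have "(\<Sum>X\<in>Pow (B k). if (+) a ` ys i \<subseteq> X then window_prob (B k) X else 0) =
         (\<Sum>X | (+) a ` ys i \<subseteq> X \<and> X \<subseteq> B k. window_prob (B k) X)"
        using finB[of k] by (subst sum.inter_filter[symmetric]) (auto intro!: sum.cong)
      also have "\<dots> = (if (+) a ` ys i \<subseteq> B k then \<rho> (ys i) else 0)"
      proof (cases "(+) a ` ys i \<subseteq> B k")
        case True
        then show ?thesis
          using sum_window_prob_supersets[OF finB True] by (simp add: perm_det_lattice_kernel_shift[OF ys] \<rho>_def)
      next
        case False
        then have "{X. (+) a ` ys i \<subseteq> X \<and> X \<subseteq> B k} = {}" by blast
        with False show ?thesis by (simp only: sum.empty if_False)
      qed
      finally show "(\<Sum>X\<in>Pow (B k). if (+) a ` ys i \<subseteq> X then window_prob (B k) X else 0) =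
         (if (+) a ` ys i \<subseteq> B k then \<rho> (ys i) else 0)" .
    qed
    also have "\<dots> = cnt (ys i) k (B k) * \<rho> (ys i)"
      unfolding cnt_def using finB[of k] by (simp add: sum.If_cases Int_def)
    finally show "(\<Sum>X\<in>Pow (B k). window_prob (B k) X * d i k X) = 0"
      unfolding d_def right_diff_distrib sum_subtractf sum_distrib_right[symmetric] total by simp
  qed
  then obtain X where X: "\<And>k. X k \<subseteq> B k"
    and err: "\<And>i K. (\<Sum>j=i..<K. d i j (X j))\<^sup>2 \<le> 2 ^ i * (2 * (\<Sum>j<K. (L j)\<^sup>2))"
    by auto
  define A where "A = {..<0} \<union> (\<Union>k. X k)"
  have B_disj: "k = l" if "a \<in> B k" "a \<in> B l" for a k l
  proof (rule ccontr)
    assume "k \<noteq> l"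
    then consider "k + 1 \<le> l" | "l + 1 \<le> k" by linarith
    then show False
    proof cases
      case 1
      then have "(int k + 1)\<^sup>2 \<le> (int l)\<^sup>2" by (intro power_mono) auto
      with that show False by (auto simp: B_def)
    next
      case 2
      then have "(int l + 1)\<^sup>2 \<le> (int k)\<^sup>2" by (intro power_mono) auto
      with that show False by (auto simp: B_def)
    qed
  qed
  have AB: "A \<inter> B k = X k" for k
  proof -
    have nonneg: "B k \<subseteq> {0..}" by (auto simp: B_def intro: order_trans[OF zero_le_power2])
    have "a \<in> X k" if "a \<in> A" "a \<in> B k" for a
    proof -
      from that nonneg obtain l where l: "a \<in> X l" by (auto simp: A_def)
      with X have "a \<in> B l" by blast
      with that l B_disj show ?thesis by blast
    qed
    then show ?thesis using X by (auto simp: A_def)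
  qed
  have "(\<lambda>N. real (card {a \<in> {0..<int N}. (+) a ` Y \<subseteq> A}) / real N) \<longlonglongrightarrow> perm_det Y lattice_kernel"
    if finY: "finite Y" for Y
  proof -
    obtain i where i: "ys i = Y" using ys_surj finY by blast
    define C where "C = real (\<Sum>y\<in>Y. nat \<bar>y\<bar>)"
    have C0: "C \<ge> 0" by (simp add: C_def)
    define S where "S N = real (card {a \<in> {0..<N}. (+) a ` Y \<subseteq> A})" for N :: int
    define s where "s k = cnt Y k A" for k
    \<comment> \<open>Two errors occur, each at most \<open>bad\<close>: patterns of
      \<open>A\<close> that start in the window but leave it, and the gap between its length and the
      number of fitting translates. They enter with opposite signs, so \<open>C\<close> suffices
      without a factor 2.\<close>
    have block: "\<bar>s k - \<rho> Y * L k - d i k (X k)\<bar> \<le> C" for k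
    proof -
      define bad where "bad = real (card {a \<in> B k. \<not> (+) a ` Y \<subseteq> B k})"
      have bad: "bad \<le> C" "0 \<le> bad"
        unfolding bad_def C_def B_def of_nat_le_iff
        by (rule card_translates_leaving_interval[OF finY]) simp
      have "L k = cnt Y k (B k) + bad"
      proof -
        have "card (B k) = card ({a \<in> B k. (+) a ` Y \<subseteq> B k} \<union> {a \<in> B k. \<not> (+) a ` Y \<subseteq> B k})"
          by (rule arg_cong[where f=card]) auto
        also have "\<dots> = card {a \<in> B k. (+) a ` Y \<subseteq> B k} + card {a \<in> B k. \<not> (+) a ` Y \<subseteq> B k}"
          using finB by (intro card_Un_disjoint) auto
        finally show ?thesis unfolding cardB[symmetric] cnt_def bad_def by simp
      qed
      moreover have "cnt Y k (X k) \<le> s k"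
        unfolding cnt_def s_def using finB AB[of k] by (auto intro!: card_mono)
      moreover have "s k \<le> cnt Y k (X k) + bad"
      proof -
        have "card {a \<in> B k. (+) a ` Y \<subseteq> A} \<le> card ({a \<in> B k. (+) a ` Y \<subseteq> X k} \<union> {a \<in> B k. \<not> (+) a ` Y \<subseteq> B k})"
          using finB by (intro card_mono) (auto simp: AB[of k, symmetric])
        also have "\<dots> \<le> card {a \<in> B k. (+) a ` Y \<subseteq> X k} + card {a \<in> B k. \<not> (+) a ` Y \<subseteq> B k}"
          by (rule card_Un_le)
        finally show ?thesis unfolding cnt_def s_def bad_def by (simp flip: of_nat_add)
      qed
      moreover have "0 \<le> \<rho> Y * bad" "\<rho> Y * bad \<le> bad"
        using \<rho>_bounds[OF finY] bad by (auto simp: mult_left_le_one_le)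
      ultimately show ?thesis using bad unfolding d_def i by (simp add: algebra_simps abs_le_iff)
    qed
    have S_sum: "S ((int K)\<^sup>2) = (\<Sum>k<K. s k)" for K
    proof (induction K)
      case 0 then show ?case by (simp add: S_def)
    next
      case (Suc K)
      have "{a \<in> {0..<(int (Suc K))\<^sup>2}. (+) a ` Y \<subseteq> A} =
        {a \<in> {0..<(int K)\<^sup>2}. (+) a ` Y \<subseteq> A} \<union> {a \<in> B K. (+) a ` Y \<subseteq> A}"
        by (auto simp: B_def add.commute power2_sum) (smt (verit) zero_le_power2)
      moreover have "card \<dots> = card {a \<in> {0..<(int K)\<^sup>2}. (+) a ` Y \<subseteq> A} + card {a \<in> B K. (+) a ` Y \<subseteq> A}"
        using finB by (intro card_Un_disjoint finite_subset[of "Collect _" "{0..<(int K)\<^sup>2}"] finite_subset[of "Collect _" "B K"]) (auto simp: B_def)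
      ultimately show ?case using Suc by (simp add: S_def s_def cnt_def)
    qed
    \<comment> \<open>The greedy bound on the \<open>i\<close>-th deviation counts from step
      \<open>i\<close> on; the earlier steps contribute a constant.\<close>
    define C1 where "C1 = (\<Sum>k<i. \<bar>d i k (X k)\<bar>)"
    have sq: "\<bar>S ((int K)\<^sup>2) - \<rho> Y * (real K)\<^sup>2\<bar> \<le> C * real K + C1 + sqrt (2 ^ i * 8 * real K ^ 3)" for K
    proof -
      have L_sum: "(\<Sum>k<K. L k) = (real K)\<^sup>2"
        by (induction K) (auto simp: L_def power2_eq_square algebra_simps)
      have "\<bar>(\<Sum>k<K. s k) - \<rho> Y * (\<Sum>k<K. L k) - (\<Sum>k<K. d i k (X k))\<bar>
          = \<bar>\<Sum>k<K. s k - \<rho> Y * L k - d i k (X k)\<bar>"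
        by (simp add: sum_subtractf sum_distrib_left)
      also have "\<dots> \<le> (\<Sum>k<K. C)" by (intro order_trans[OF sum_abs] sum_mono block)
      finally have 1: "\<bar>S ((int K)\<^sup>2) - \<rho> Y * (real K)\<^sup>2 - (\<Sum>k<K. d i k (X k))\<bar> \<le> C * real K"
        unfolding S_sum L_sum by (simp add: mult.commute)
      \<comment> \<open>\<open>L k = 2 k + 1\<close> is at most \<open>2 K\<close> for
        \<open>k < K\<close>, which makes the accumulated deviation of order
        \<open>K^(3/2)\<close>.\<close>
      have "(\<Sum>k<K. (L k)\<^sup>2) \<le> (\<Sum>k<K. (2 * real K)\<^sup>2)"
        by (intro sum_mono power_mono) (auto simp: L_def)
      then have "(\<Sum>k=i..<K. d i k (X k))\<^sup>2 \<le> 2 ^ i * (2 * (\<Sum>k<K. (2 * real K)\<^sup>2))"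
        by (intro order_trans[OF err] mult_left_mono) auto
      also have "\<dots> = 2 ^ i * 8 * real K ^ 3" by (simp add: power2_eq_square power3_eq_cube)
      finally have 2: "\<bar>\<Sum>k=i..<K. d i k (X k)\<bar> \<le> sqrt (2 ^ i * 8 * real K ^ 3)"
        by (metis real_sqrt_le_mono real_sqrt_abs)
      have "(\<Sum>k<K. d i k (X k)) = (\<Sum>k<min i K. d i k (X k)) + (\<Sum>k=i..<K. d i k (X k))"
        by (cases "i \<le> K") (auto simp: min_def atLeast0LessThan[symmetric] sum.atLeastLessThan_concat)
      moreover have "\<bar>\<Sum>k<min i K. d i k (X k)\<bar> \<le> C1"
        unfolding C1_def by (intro order_trans[OF sum_abs] sum_mono2) auto
      ultimately show ?thesis using 1 2 by linarith
    qed
    \<comment> \<open>The part \<open>2 * x + 1\<close> pays for the incomplete window between the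
      largest square \<open>K^2\<close> not above \<open>N\<close> and \<open>N\<close> itself. As
      \<open>h\<close> increases on \<open>x \<ge> 0\<close>, \<open>K\<close> may be replaced by
      \<open>sqrt N\<close>.\<close>
    define h where "h x = C * x + C1 + sqrt (2 ^ i * 8 * x ^ 3) + 2 * x + 1" for x :: real
    have bound: "\<bar>S (int N) / real N - \<rho> Y\<bar> \<le> h (sqrt (real N)) / real N" if "N > 0" for N
    proof -
      define K where "K = nat \<lfloor>sqrt (real N)\<rfloor>"
      have K: "real K \<le> sqrt (real N)" "sqrt (real N) < real K + 1"
        by (simp_all add: K_def of_nat_nat)
      have K1: "(real K)\<^sup>2 \<le> real N"
        using power_mono[OF K(1), of 2] by simp
      have "(sqrt (real N))\<^sup>2 < (real K + 1)\<^sup>2" using K(2) by (intro power_strict_mono) auto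
      then have K2: "real N < (real K + 1)\<^sup>2" by simp
      have K1': "(int K)\<^sup>2 \<le> int N" using K1 by (metis of_nat_le_iff of_nat_power)
      have "S ((int K)\<^sup>2) \<le> S (int N)"
        unfolding S_def of_nat_le_iff using order_less_le_trans[OF _ K1']
        by (intro card_mono finite_subset[of "Collect _" "{0..<int N}"]) auto
      moreover have "S (int N) \<le> S ((int K)\<^sup>2) + (real N - (real K)\<^sup>2)"
      proof -
        have "card {a \<in> {0..<int N}. (+) a ` Y \<subseteq> A} \<le> card ({a \<in> {0..<(int K)\<^sup>2}. (+) a ` Y \<subseteq> A} \<union> {(int K)\<^sup>2..<int N})"
          by (intro card_mono finite_UnI finite_subset[of "Collect _" "{0..<(int K)\<^sup>2}"]) auto
        also have "\<dots> \<le> card {a \<in> {0..<(int K)\<^sup>2}. (+) a ` Y \<subseteq> A} + card {(int K)\<^sup>2..<int N}"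
          by (rule card_Un_le)
        finally have "S (int N) \<le> S ((int K)\<^sup>2) + real (card {(int K)\<^sup>2..<int N})"
          unfolding S_def by linarith
        then show ?thesis using K1' by (simp add: of_nat_nat)
      qed
      moreover have "0 \<le> \<rho> Y * (real N - (real K)\<^sup>2)" "\<rho> Y * (real N - (real K)\<^sup>2) \<le> real N - (real K)\<^sup>2"
        using \<rho>_bounds[OF finY] K1 by (auto simp: mult_left_le_one_le)
      moreover have "real N - (real K)\<^sup>2 \<le> 2 * real K + 1"
        using K2 by (simp add: power2_eq_square algebra_simps)
      ultimately have "\<bar>S (int N) - \<rho> Y * real N\<bar> \<le> h (real K)"
        using sq[of K] unfolding h_def right_diff_distrib abs_le_iff by linarith
      also have "\<dots> \<le> h (sqrt (real N))"
        unfolding h_def using K C0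
        by (intro add_mono mult_left_mono real_sqrt_le_mono power_mono) auto
      finally show ?thesis using that
        by (simp add: field_simps abs_le_iff)
    qed
    have "(\<lambda>N. h (sqrt (real N)) / real N) \<longlonglongrightarrow> 0"
      unfolding h_def using C0 by real_asymp
    then have "(\<lambda>N. S (int N) / real N - \<rho> Y) \<longlonglongrightarrow> 0"
      by (rule Lim_null_comparison[rotated])
         (use bound in \<open>auto intro!: eventually_at_top_linorderI[of 1]\<close>)
    then show ?thesis unfolding S_def \<rho>_def by (rule LIM_zero_cancel)
  qed
  moreover have "{..<0} \<subseteq> A" by (simp add: A_def)
  ultimately show ?thesis by blast
qed

section \<open>Sums over \<open>\<int>\<^sup>n\<close> and integrals over \<open>\<real>\<^sup>n\<close>\<close>

text \<open>Fubini for a countable index set, taken from the theorem on series along an enumeration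
  of \<open>I\<close>. A finite \<open>I\<close> has no bijection with \<open>nat\<close> and is
  treated apart.\<close>

lemma integral_infsum:
  fixes f :: "'i \<Rightarrow> 'a \<Rightarrow> 'b :: {banach, second_countable_topology}"
  assumes "countable I"
    and int: "\<And>i. i \<in> I \<Longrightarrow> integrable M (f i)"
    and sum_int: "(\<lambda>i. LINT x|M. norm (f i x)) summable_on I"
    and sum_pt: "\<And>x. x \<in> space M \<Longrightarrow> (\<lambda>i. norm (f i x)) summable_on I"
  shows "integrable M (\<lambda>x. \<Sum>\<^sub>\<infinity>i\<in>I. f i x)"
    and "(LINT x|M. (\<Sum>\<^sub>\<infinity>i\<in>I. f i x)) = (\<Sum>\<^sub>\<infinity>i\<in>I. LINT x|M. f i x)"
proof -
  have "integrable M (\<lambda>x. \<Sum>\<^sub>\<infinity>i\<in>I. f i x) \<and>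
    (LINT x|M. (\<Sum>\<^sub>\<infinity>i\<in>I. f i x)) = (\<Sum>\<^sub>\<infinity>i\<in>I. LINT x|M. f i x)"
  proof (cases "finite I")
    case True
    then show ?thesis using int by (auto intro!: Bochner_Integration.integral_sum)
  next
    case False
    define e where "e = from_nat_into I"
    have e: "bij_betw e UNIV I"
      unfolding e_def using bij_betw_from_nat_into[OF \<open>countable I\<close> False] .
    then have eI: "e k \<in> I" for k by (auto simp: bij_betw_def)
    have re: "(\<Sum>\<^sub>\<infinity>i\<in>I. h i) = (\<Sum>k. h (e k))" if "(\<lambda>i. norm (h i)) summable_on I" for h :: "'i \<Rightarrow> 'b"
    proof -
      have "(\<lambda>k. norm (h (e k))) summable_on UNIV"
        using that summable_on_reindex_bij_betw[OF e, of "\<lambda>i. norm (h i)"] by simp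
      then have "summable (\<lambda>k. norm (h (e k)))"
        by (subst (asm) summable_on_UNIV_nonneg_real_iff) auto
      then have "(\<Sum>\<^sub>\<infinity>k. h (e k)) = (\<Sum>k. h (e k))"
        by (intro infsumI norm_summable_imp_has_sum) (auto intro: summable_sums summable_norm_cancel)
      then show ?thesis using infsum_reindex_bij_betw[OF e, of h] by simp
    qed
    have summ: "summable (\<lambda>k. LINT x|M. norm (f (e k) x))"
      using sum_int summable_on_reindex_bij_betw[OF e, of "\<lambda>i. LINT x|M. norm (f i x)"]
      by (subst summable_on_UNIV_nonneg_real_iff[symmetric]) auto
    have summ_pt: "summable (\<lambda>k. norm (f (e k) x))" if "x \<in> space M" for x
      using sum_pt[OF that] summable_on_reindex_bij_betw[OF e, of "\<lambda>i. norm (f i x)"]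
      by (subst summable_on_UNIV_nonneg_real_iff[symmetric]) auto
    have eq: "(\<Sum>\<^sub>\<infinity>i\<in>I. f i x) = (\<Sum>k. f (e k) x)" if "x \<in> space M" for x
      by (rule re) (rule sum_pt[OF that])
    have "integrable M (\<lambda>x. \<Sum>k. f (e k) x)"
      using int eI summ summ_pt by (intro integrable_suminf) auto
    then have 1: "integrable M (\<lambda>x. \<Sum>\<^sub>\<infinity>i\<in>I. f i x)"
      using eq by (simp cong: Bochner_Integration.integrable_cong)
    have "(LINT x|M. (\<Sum>\<^sub>\<infinity>i\<in>I. f i x)) = (LINT x|M. (\<Sum>k. f (e k) x))"
      using eq by (intro Bochner_Integration.integral_cong) auto
    also have "\<dots> = (\<Sum>k. LINT x|M. f (e k) x)"
      using int eI summ summ_pt by (intro integral_suminf) auto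
    also have "\<dots> = (\<Sum>\<^sub>\<infinity>i\<in>I. LINT x|M. f i x)"
    proof (rule re[symmetric])
      show "(\<lambda>i. norm (LINT x|M. f i x)) summable_on I"
        by (rule summable_on_comparison_test[OF sum_int]) (auto intro: integral_norm_bound)
    qed
    finally show ?thesis using 1 by blast
  qed
  then show "integrable M (\<lambda>x. \<Sum>\<^sub>\<infinity>i\<in>I. f i x)"
    "(LINT x|M. (\<Sum>\<^sub>\<infinity>i\<in>I. f i x)) = (\<Sum>\<^sub>\<infinity>i\<in>I. LINT x|M. f i x)" by auto
qed

text \<open>Tannery's theorem: on the set \<open>Y\<close> of points where the bound holds, the
  partial sums converge uniformly (Weierstrass), so the two limits may be interchanged.\<close>

lemma tendsto_infsum_dominated:
  fixes f :: "'i \<Rightarrow> 'a \<Rightarrow> 'b :: banach"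
  assumes lim: "\<And>i. i \<in> I \<Longrightarrow> (f i \<longlongrightarrow> l i) F"
    and bound: "\<forall>\<^sub>F x in F. \<forall>i\<in>I. norm (f i x) \<le> M i"
    and M: "M summable_on I" and F: "F \<noteq> bot"
  shows "((\<lambda>x. \<Sum>\<^sub>\<infinity>i\<in>I. f i x) \<longlongrightarrow> (\<Sum>\<^sub>\<infinity>i\<in>I. l i)) F"
proof -
  define Y where "Y = {x. \<forall>i\<in>I. norm (f i x) \<le> M i}"
  have ul: "uniform_limit Y (\<lambda>X y. \<Sum>x\<in>X. f x y) (\<lambda>y. \<Sum>\<^sub>\<infinity>x\<in>I. f x y) (finite_subsets_at_top I)"
    by (rule Weierstrass_m_test_general[OF _ M]) (auto simp: Y_def)
  have bl: "norm (l i) \<le> M i" if "i \<in> I" for i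
    using tendsto_norm[OF lim[OF that]]
    by (rule tendsto_upperbound[OF _ _ F]) (use bound in eventually_elim, use that in auto)
  have "(\<lambda>i. norm (l i)) summable_on I"
    by (rule summable_on_comparison_test[OF M]) (use bl in auto)
  then have "l summable_on I" by (rule abs_summable_summable)
  then have suml: "((\<lambda>X. \<Sum>i\<in>X. l i) \<longlongrightarrow> (\<Sum>\<^sub>\<infinity>i\<in>I. l i)) (finite_subsets_at_top I)"
    using has_sum_infsum has_sum_def by blast
  show ?thesis
  proof (rule swap_uniform_limit'[OF _ suml ul])
    show "\<forall>\<^sub>F X in finite_subsets_at_top I. ((\<lambda>x. \<Sum>i\<in>X. f i x) \<longlongrightarrow> (\<Sum>i\<in>X. l i)) F"
      by (rule eventually_finite_subsets_at_top_weakI) (auto intro!: tendsto_sum lim)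
  qed (use bound F in \<open>auto simp: Y_def\<close>)
qed

section \<open>Summation over the integer lattice\<close>

definition Zn :: "nat \<Rightarrow> (nat \<Rightarrow> int) set" where
  "Zn n = {..<n} \<rightarrow>\<^sub>E UNIV"

lemma countable_Zn: "countable (Zn n)"
  unfolding Zn_def by (intro countable_PiE) auto

lemma summable_on_int_inverse_square: "(\<lambda>k :: int. 1 / (1 + (real_of_int k)\<^sup>2)) summable_on UNIV"
proof -
  let ?f = "\<lambda>k :: int. 1 / (1 + (real_of_int k)\<^sup>2)"
  have "summable (\<lambda>n :: nat. 1 / (1 + (real n)\<^sup>2))"
  proof (rule summable_comparison_test)
    show "summable (\<lambda>n. inverse ((real n)\<^sup>2))" by (rule inverse_power_summable) auto
    show "\<exists>N. \<forall>n\<ge>N. norm (1 / (1 + (real n)\<^sup>2)) \<le> inverse ((real n)\<^sup>2)"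
      by (rule exI[of _ 1]) (auto simp: inverse_eq_divide intro!: divide_left_mono mult_pos_pos add_pos_nonneg)
  qed
  then have nat: "(\<lambda>n :: nat. 1 / (1 + (real n)\<^sup>2)) summable_on UNIV"
    by (subst summable_on_UNIV_nonneg_real_iff) auto
  have 1: "?f summable_on range int"
    using nat summable_on_reindex[of int UNIV ?f] by (simp add: o_def)
  have 2: "?f summable_on range (\<lambda>n. - int n)"
    using nat summable_on_reindex[of "\<lambda>n. - int n" UNIV ?f] by (simp add: o_def inj_on_def)
  have "(UNIV :: int set) = range int \<union> range (\<lambda>n. - int n)"
  proof -
    have "k \<in> range int \<union> range (\<lambda>n. - int n)" for k
      by (cases k rule: int_cases2) auto
    then show ?thesis by blast
  qed
  then show ?thesis using summable_on_union[OF 1 2] by simp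
qed

text \<open>A product weight on a product index set reduces to the one-dimensional series. The 8 is
  the loss incurred in \<open>weight_lattice_shift\<close>.\<close>

lemma summable_on_Zn_weight:
  "(\<lambda>k. c * (\<Prod>i<n. 8 / (1 + (real_of_int (k i))\<^sup>2))) summable_on Zn n"
proof -
  have "(\<lambda>k :: int. 8 * (1 / (1 + (real_of_int k)\<^sup>2))) summable_on UNIV"
    by (intro summable_on_cmult_right summable_on_int_inverse_square)
  then have "Infinite_Set_Sum.abs_summable_on (\<lambda>k :: int. 8 / (1 + (real_of_int k)\<^sup>2)) UNIV"
    by (subst abs_summable_equivalent[symmetric]) (simp add: abs_of_nonneg)
  then have "Infinite_Set_Sum.abs_summable_on (\<lambda>k. \<Prod>i<n. 8 / (1 + (real_of_int (k i))\<^sup>2)) (Zn n)"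
    unfolding Zn_def by (intro abs_summable_on_prod_PiE) auto
  then have "(\<lambda>k. \<Prod>i<n. 8 / (1 + (real_of_int (k i))\<^sup>2)) summable_on Zn n"
    by (subst (asm) abs_summable_equivalent[symmetric]) (rule abs_summable_summable)
  then show ?thesis by (rule summable_on_cmult_right)
qed

section \<open>Lebesgue measure on \<open>Rn n\<close>\<close>

lemma space_lborel_Rn [simp]: "space (lborel_Rn n) = Rn n"
  by (simp add: lborel_Rn_def Rn_def space_PiM)

lemma component_borel_measurable_Rn: "(\<lambda>x. x i) \<in> borel_measurable (lborel_Rn n)"
proof (cases "i < n")
  case True
  have "(\<lambda>x. x i) \<in> measurable (lborel_Rn n) lborel"
    unfolding lborel_Rn_def by (rule measurable_component_singleton) (use True in simp)
  then show ?thesis by (simp only: measurable_lborel1)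
next
  case False
  then have "x i = undefined" if "x \<in> space (lborel_Rn n)" for x
    using that PiE_arb[of x "{..<n}" "\<lambda>_. UNIV" i] by (simp add: Rn_def)
  then show ?thesis
    by (subst measurable_cong[where g = "\<lambda>_. undefined"]) simp_all
qed

text \<open>\<open>restrict\<close> is a continuous retraction of
  \<open>nat \<Rightarrow> real\<close> onto \<open>Rn n\<close>. Composition with it turns
  \<open>f\<close> into a continuous, hence Borel, function on the full space, into which the
  inclusion of \<open>Rn n\<close> is measurable coordinate by coordinate.\<close>

lemma borel_measurable_continuous_Rn:
  fixes f :: "(nat \<Rightarrow> real) \<Rightarrow> 'b :: topological_space"
  assumes "continuous_on (Rn n) f"
  shows "f \<in> borel_measurable (lborel_Rn n)"
proof -
  have "continuous_on UNIV (\<lambda>z :: nat \<Rightarrow> real. restrict z {..<n})"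
  proof (intro continuous_on_coordinatewise_then_product)
    show "continuous_on UNIV (\<lambda>z :: nat \<Rightarrow> real. restrict z {..<n} i)" for i
      by (cases "i < n") auto
  qed
  then have "continuous_on UNIV (\<lambda>z. f (restrict z {..<n}))"
    by (rule continuous_on_compose2[OF assms]) (simp add: Rn_def image_subset_iff del: restrict_apply)
  then have "(\<lambda>z. f (restrict z {..<n})) \<in> borel_measurable borel"
    by (rule borel_measurable_continuous_onI)
  moreover have "(\<lambda>x. x) \<in> borel_measurable (lborel_Rn n)"
    by (rule measurable_coordinatewise_then_product) (rule component_borel_measurable_Rn)
  ultimately have "(\<lambda>x. f (restrict x {..<n})) \<in> borel_measurable (lborel_Rn n)"
    by (rule measurable_compose[rotated])
  then show ?thesis
    by (subst measurable_cong[where g = "\<lambda>x. f (restrict x {..<n})"]) (auto simp: Rn_def PiE_restrict)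
qed

lemma measurable_into_lborel_Rn:
  assumes "\<And>i. i < n \<Longrightarrow> (\<lambda>x. f x i) \<in> borel_measurable M"
  shows "(\<lambda>x. \<lambda>i\<in>{..<n}. f x i) \<in> measurable M (lborel_Rn n)"
  unfolding lborel_Rn_def
proof (rule measurable_restrict)
  fix i assume "i \<in> {..<n}"
  then have "(\<lambda>x. f x i) \<in> borel_measurable M" by (intro assms) simp
  then show "(\<lambda>x. f x i) \<in> measurable M lborel" by (simp only: measurable_lborel1)
qed

lemma sigma_finite_lborel_Rn: "sigma_finite_measure (lborel_Rn n)"
proof -
  interpret product_sigma_finite "\<lambda>i :: nat. lborel :: real measure" by standard
  show ?thesis unfolding lborel_Rn_def by (rule sigma_finite) simp
qed

text \<open>A product measure is determined by its values on boxes, and there the claim splits into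
  translation invariance on each axis.\<close>

lemma distr_lborel_Rn_translate:
  "distr (lborel_Rn n) (lborel_Rn n) (\<lambda>x. \<lambda>i\<in>{..<n}. x i + c i) = lborel_Rn n"
proof -
  interpret product_sigma_finite "\<lambda>i :: nat. lborel :: real measure" by standard
  have m: "(\<lambda>x. \<lambda>i\<in>{..<n}. x i + c i) \<in> measurable (lborel_Rn n) (lborel_Rn n)"
    by (intro measurable_into_lborel_Rn borel_measurable_add component_borel_measurable_Rn borel_measurable_const)
  have "distr (lborel_Rn n) (lborel_Rn n) (\<lambda>x. \<lambda>i\<in>{..<n}. x i + c i) = PiM {..<n} (\<lambda>_. lborel)"
  proof (rule PiM_eqI)
    fix A :: "nat \<Rightarrow> real set" assume A: "\<And>i. i \<in> {..<n} \<Longrightarrow> A i \<in> sets lborel"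
    then have PA: "Pi\<^sub>E {..<n} A \<in> sets (lborel_Rn n)"
      unfolding lborel_Rn_def by (intro sets_PiM_I_finite) auto
    have mt: "(\<lambda>x. x + c i) \<in> measurable lborel lborel" for i by simp
    have A': "(\<lambda>x. x + c i) -` A i \<in> sets lborel" if "i \<in> {..<n}" for i
      using measurable_sets[OF mt A[OF that]] by simp
    have "emeasure (distr (lborel_Rn n) (lborel_Rn n) (\<lambda>x. \<lambda>i\<in>{..<n}. x i + c i)) (Pi\<^sub>E {..<n} A) =
       emeasure (lborel_Rn n) ((\<lambda>x. \<lambda>i\<in>{..<n}. x i + c i) -` Pi\<^sub>E {..<n} A \<inter> space (lborel_Rn n))"
      by (rule emeasure_distr[OF m PA])
    also have "(\<lambda>x. \<lambda>i\<in>{..<n}. x i + c i) -` Pi\<^sub>E {..<n} A \<inter> space (lborel_Rn n) =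
        Pi\<^sub>E {..<n} (\<lambda>i. (\<lambda>x. x + c i) -` A i)"
      by (auto simp: Rn_def PiE_iff)
    also have "emeasure (lborel_Rn n) \<dots> = (\<Prod>i<n. emeasure lborel ((\<lambda>x. x + c i) -` A i))"
      unfolding lborel_Rn_def using A' by (intro emeasure_PiM) auto
    also have "\<dots> = (\<Prod>i<n. emeasure lborel (A i))"
    proof (intro prod.cong refl)
      fix i assume i: "i \<in> {..<n}"
      have "emeasure lborel (A i) = emeasure (distr lborel borel ((+) (c i))) (A i)"
        by (simp add: lborel_distr_plus)
      also have "\<dots> = emeasure lborel ((\<lambda>x. x + c i) -` A i)"
        using A[OF i] by (subst emeasure_distr) (auto simp: vimage_def add.commute[of _ "c i"])
      finally show "emeasure lborel ((\<lambda>x. x + c i) -` A i) = emeasure lborel (A i)" by simp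
    qed
    finally show "emeasure (distr (lborel_Rn n) (lborel_Rn n) (\<lambda>x. \<lambda>i\<in>{..<n}. x i + c i)) (Pi\<^sub>E {..<n} A) =
       (\<Prod>i\<in>{..<n}. emeasure lborel (A i))" .
  qed (auto simp: lborel_Rn_def)
  then show ?thesis by (simp add: lborel_Rn_def)
qed

lemma integral_lborel_Rn_translate:
  fixes f :: "(nat \<Rightarrow> real) \<Rightarrow> 'b :: {banach, second_countable_topology}"
  assumes "f \<in> borel_measurable (lborel_Rn n)"
  shows "(LINT x|lborel_Rn n. f (\<lambda>i\<in>{..<n}. x i + c i)) = (LINT x|lborel_Rn n. f x)"
proof -
  have m: "(\<lambda>x. \<lambda>i\<in>{..<n}. x i + c i) \<in> measurable (lborel_Rn n) (lborel_Rn n)"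
    by (intro measurable_into_lborel_Rn borel_measurable_add component_borel_measurable_Rn borel_measurable_const)
  show ?thesis
    using integral_distr[OF m assms] by (simp add: distr_lborel_Rn_translate)
qed

lemma integrable_lborel_Rn_translate:
  fixes f :: "(nat \<Rightarrow> real) \<Rightarrow> 'b :: {banach, second_countable_topology}"
  assumes "integrable (lborel_Rn n) f"
  shows "integrable (lborel_Rn n) (\<lambda>x. f (\<lambda>i\<in>{..<n}. x i + c i))"
proof -
  have m: "(\<lambda>x. \<lambda>i\<in>{..<n}. x i + c i) \<in> measurable (lborel_Rn n) (lborel_Rn n)"
    by (intro measurable_into_lborel_Rn borel_measurable_add component_borel_measurable_Rn borel_measurable_const)
  show ?thesis
    using integrable_distr[OF m, of f] assms by (simp add: distr_lborel_Rn_translate)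
qed

text \<open>The class in which the analysis takes place. Unlike the Schwartz property it passes to
  products with bounded continuous functions and to diagonal averages without a look at derivatives,
  and its product bound makes integrals over \<open>Rn n\<close> and lattice sums factorise.\<close>

definition dominated_Rn :: "nat \<Rightarrow> real \<Rightarrow> ((nat \<Rightarrow> real) \<Rightarrow> complex) \<Rightarrow> bool" where
  "dominated_Rn n C f \<longleftrightarrow> continuous_on (Rn n) f \<and>
     (\<forall>x\<in>Rn n. cmod (f x) \<le> C * (\<Prod>i<n. 1 / (1 + (x i)\<^sup>2)))"

lemma dominated_Rn_nonneg: "dominated_Rn n C f \<Longrightarrow> 0 \<le> C"
proof -
  assume "dominated_Rn n C f"
  then have "cmod (f (\<lambda>i\<in>{..<n}. 0)) \<le> C * (\<Prod>i<n. 1 / (1 + ((\<lambda>i\<in>{..<n}. 0) i)\<^sup>2))"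
    unfolding dominated_Rn_def by (elim conjE bspec) (simp add: Rn_def)
  also have "\<dots> = C" by simp
  finally show ?thesis using norm_ge_zero order_trans by blast
qed

lemma integrable_inverse_1_plus_square_lborel: "integrable lborel (\<lambda>x :: real. 1 / (1 + x\<^sup>2))"
  using integrable_inverse_1_plus_square by (simp add: set_integrable_def inverse_eq_divide)

lemma integrable_Rn_weight: "integrable (lborel_Rn n) (\<lambda>x. \<Prod>i<n. 1 / (1 + (x i)\<^sup>2))"
proof -
  interpret product_sigma_finite "\<lambda>i :: nat. lborel :: real measure" by standard
  show ?thesis unfolding lborel_Rn_def
    by (rule product_integrable_prod) (auto intro: integrable_inverse_1_plus_square_lborel)
qed

lemma dominated_Rn_integrable:
  assumes "dominated_Rn n C f"
  shows "integrable (lborel_Rn n) f"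
proof (rule Bochner_Integration.integrable_bound)
  show "integrable (lborel_Rn n) (\<lambda>x. C * (\<Prod>i<n. 1 / (1 + (x i)\<^sup>2)))"
    by (intro integrable_mult_right integrable_Rn_weight)
  show "f \<in> borel_measurable (lborel_Rn n)"
    using assms by (intro borel_measurable_continuous_Rn) (simp add: dominated_Rn_def)
  show "AE x in lborel_Rn n. norm (f x) \<le> norm (C * (\<Prod>i<n. 1 / (1 + (x i)\<^sup>2)))"
    using assms by (intro AE_I2) (auto simp: dominated_Rn_def intro: order_trans[OF _ abs_ge_self])
qed

text \<open>With \<open>a = k / 2\<close>,
  \<open>8 (u + a)^2 = 4 (a + 2 u)^2 + 4 a^2 - 8 u^2\<close>, and \<open>8 u^2 \<le> 2\<close>
  leaves room for the constant terms.\<close>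

lemma weight_lattice_shift:
  fixes u :: real and k :: int
  assumes "\<bar>u\<bar> \<le> 1 / 2"
  shows "1 / (1 + (u + of_int k / 2)\<^sup>2) \<le> 8 / (1 + (of_int k)\<^sup>2)"
proof -
  define a where "a = (of_int k :: real) / 2"
  have "u\<^sup>2 \<le> (1/2)\<^sup>2" using assms by (intro power2_le_iff_abs_le[THEN iffD2]) auto
  moreover have "0 \<le> (a + 2 * u)\<^sup>2" by simp
  moreover have frac: "1 / X \<le> 8 / Y" if "Y \<le> 8 * X" "0 < X" "0 < Y" for X Y :: real
    using that by (simp add: field_simps)
  ultimately have "1 + 4 * a\<^sup>2 \<le> 8 * (1 + (u + a)\<^sup>2)"
    by (simp add: power2_eq_square algebra_simps)
  then have "1 / (1 + (u + a)\<^sup>2) \<le> 8 / (1 + 4 * a\<^sup>2)"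
    using frac by (simp add: add_pos_nonneg)
  then show ?thesis by (simp add: a_def power_divide)
qed

lemma dominated_Rn_lattice_shift:
  assumes "dominated_Rn n C f" "\<And>i. i < n \<Longrightarrow> \<bar>u i\<bar> \<le> 1 / 2"
  shows "cmod (f (\<lambda>i\<in>{..<n}. u i + of_int (k i) / 2)) \<le> C * (\<Prod>i<n. 8 / (1 + (of_int (k i))\<^sup>2))"
proof -
  have "cmod (f (\<lambda>i\<in>{..<n}. u i + of_int (k i) / 2)) \<le>
     C * (\<Prod>i<n. 1 / (1 + ((\<lambda>i\<in>{..<n}. u i + of_int (k i) / 2) i)\<^sup>2))"
    using assms(1) unfolding dominated_Rn_def by (elim conjE bspec) (simp add: Rn_def)
  also have "\<dots> \<le> C * (\<Prod>i<n. 8 / (1 + (of_int (k i))\<^sup>2))"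
  proof (intro mult_left_mono prod_mono dominated_Rn_nonneg[OF assms(1)] conjI)
    fix i assume "i \<in> {..<n}"
    then show "1 / (1 + ((\<lambda>i\<in>{..<n}. u i + of_int (k i) / 2) i)\<^sup>2) \<le> 8 / (1 + (of_int (k i))\<^sup>2)"
      using weight_lattice_shift[OF assms(2)[of i], of "k i"] by simp
  qed simp
  finally show ?thesis .
qed

section \<open>Poisson summation\<close>

text \<open>The points \<open>2 m\<close> form the lattice dual to the half-integers, so these are
  the characters invariant under the shifts by \<open>k / 2\<close>.\<close>

definition lattice_char :: "nat \<Rightarrow> (nat \<Rightarrow> int) \<Rightarrow> (nat \<Rightarrow> real) \<Rightarrow> complex" where
  "lattice_char n m x = exp (- 2 * of_real pi * \<i> * of_real (\<Sum>i<n. x i * (2 * of_int (m i))))"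

lemma fourier_Rn_lattice:
  "fourier_Rn n f (\<lambda>i. 2 * of_int (m i)) = (LINT x|lborel_Rn n. f x * lattice_char n m x)"
  by (simp add: fourier_Rn_def lattice_char_def)

lemma norm_lattice_char [simp]: "cmod (lattice_char n m x) = 1"
  unfolding lattice_char_def norm_exp_eq_Re by simp

lemma lattice_char_continuous [continuous_intros]: "continuous_on S (lattice_char n m)"
  unfolding lattice_char_def
  by (intro continuous_intros continuous_on_subset[OF continuous_on_product_coordinates]) auto

lemma lattice_char_mult:
  "lattice_char n m x * lattice_char n m' x = lattice_char n (\<lambda>i. m i + m' i) x"
  unfolding lattice_char_def exp_add[symmetric]
  by (rule arg_cong[where f=exp]) (simp add: algebra_simps sum.distrib)

lemma lattice_char_periodic:
  "lattice_char n m (\<lambda>i\<in>{..<n}. u i + of_int (k i) / 2) = lattice_char n m u"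
proof -
  have "(\<Sum>i<n. (\<lambda>i\<in>{..<n}. u i + of_int (k i) / 2) i * (2 * real_of_int (m i))) =
     (\<Sum>i<n. u i * (2 * of_int (m i))) + of_int (\<Sum>i<n. k i * m i)"
    by (simp add: sum.distrib[symmetric] algebra_simps)
  then have "lattice_char n m (\<lambda>i\<in>{..<n}. u i + of_int (k i) / 2) =
    lattice_char n m u * exp ((2 * of_int (- (\<Sum>i<n. k i * m i)) * of_real pi) * \<i>)"
    unfolding lattice_char_def exp_add[symmetric]
    by (intro arg_cong[where f=exp]) (simp add: algebra_simps)
  moreover have "exp ((2 * of_int (- (\<Sum>i<n. k i * m i)) * of_real pi) * \<i>) = (1 :: complex)"
    using exp_integer_2pi[OF Ints_of_int[of "- (\<Sum>i<n. k i * m i)"]] by simp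
  ultimately show ?thesis by (simp only: mult_1_right)
qed

lemma lattice_char_prod:
  "lattice_char n m x = (\<Prod>i<n. exp (\<i> * of_real (- (4 * pi * of_int (m i)) * x i)))"
  unfolding lattice_char_def
  by (subst exp_sum[symmetric]) (auto simp: sum_distrib_left sum_negf[symmetric] mult_ac intro!: arg_cong[where f=exp] sum.cong)

lemma dominated_Rn_mult:
  assumes "dominated_Rn n C f" "continuous_on (Rn n) p" "\<And>x. x \<in> Rn n \<Longrightarrow> cmod (p x) \<le> B"
  shows "dominated_Rn n (C * B) (\<lambda>x. f x * p x)"
proof -
  have "cmod (f x * p x) \<le> C * B * (\<Prod>i<n. 1 / (1 + (x i)\<^sup>2))" if "x \<in> Rn n" for x
  proof -
    have "cmod (f x * p x) \<le> (C * (\<Prod>i<n. 1 / (1 + (x i)\<^sup>2))) * B"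
      unfolding norm_mult using assms that
      by (intro mult_mono) (auto simp: dominated_Rn_def intro: order_trans[OF norm_ge_zero])
    then show ?thesis by (simp only: mult_ac)
  qed
  then show ?thesis using assms(1,2)
    by (auto simp: dominated_Rn_def intro!: continuous_intros)
qed

text \<open>A fundamental domain for the shifts by \<open>k / 2\<close>: half-open so that its
  translates are disjoint, and centred so that 0, where the powers of \<open>bump\<close>
  concentrate, is an interior point.\<close>

definition cell :: "nat \<Rightarrow> (nat \<Rightarrow> real) set" where
  "cell n = {..<n} \<rightarrow>\<^sub>E {- (1 / 4)..<1 / 4}"

lemma cell_subset_Rn: "cell n \<subseteq> Rn n"
  by (auto simp: cell_def Rn_def PiE_def)

lemma box_sets_Rn:
  assumes "\<And>i. i < n \<Longrightarrow> A i \<in> sets borel"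
  shows "Pi\<^sub>E {..<n} A \<in> sets (lborel_Rn n)"
  unfolding lborel_Rn_def using assms by (intro sets_PiM_I_finite) auto

lemma emeasure_box_Rn:
  assumes "\<And>i. i < n \<Longrightarrow> A i \<in> sets borel"
  shows "emeasure (lborel_Rn n) (Pi\<^sub>E {..<n} A) = (\<Prod>i<n. emeasure lborel (A i))"
proof -
  interpret product_sigma_finite "\<lambda>i :: nat. lborel :: real measure" by standard
  show ?thesis unfolding lborel_Rn_def using assms by (intro emeasure_PiM) auto
qed

lemma cell_sets: "cell n \<in> sets (lborel_Rn n)"
  unfolding cell_def by (rule box_sets_Rn) simp

lemma emeasure_cell: "emeasure (lborel_Rn n) (cell n) = ennreal ((1 / 2) ^ n)"
proof -
  have *: "emeasure lborel {- (1 / 4)..<1 / 4 :: real} = ennreal (1 / 2)"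
    by (subst emeasure_lborel_Ico) auto
  show ?thesis
    unfolding cell_def by (subst emeasure_box_Rn) (simp_all only: * prod_constant card_lessThan ennreal_power[of "1/2" n], auto)
qed

lemma measure_cell: "measure (lborel_Rn n) (cell n) = (1 / 2) ^ n"
  by (simp add: measure_def emeasure_cell)

lemma integrable_indicator_cell: "integrable (lborel_Rn n) (indicator (cell n) :: _ \<Rightarrow> real)"
  using cell_sets by (simp add: integrable_indicator_iff emeasure_cell Int_absorb2[OF cell_subset_Rn])

lemma restrict_in_Rn: "(\<lambda>i\<in>{..<n}. u i) \<in> Rn n"
  by (simp add: Rn_def)

lemma translate_measurable_Rn:
  assumes "f \<in> borel_measurable (lborel_Rn n)"
  shows "(\<lambda>x. f (\<lambda>i\<in>{..<n}. x i + c i)) \<in> borel_measurable (lborel_Rn n)"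
  by (rule measurable_compose[OF _ assms])
    (intro measurable_into_lborel_Rn borel_measurable_add component_borel_measurable_Rn borel_measurable_const)

text \<open>The translates of \<open>cell n\<close> by \<open>k / 2\<close> tile
  \<open>Rn n\<close>. The piece of \<open>h\<close> on a tile (\<open>\<phi> k\<close>) and the
  same piece moved back to the cell (\<open>\<psi> k\<close>) have equal integrals; the first kind
  adds up to \<open>h\<close>, the second to the periodization on the cell.\<close>

lemma integral_lborel_Rn_unfold:
  assumes dom: "dominated_Rn n C h"
  shows "integrable (lborel_Rn n) (\<lambda>u. indicator (cell n) u *\<^sub>R (\<Sum>\<^sub>\<infinity>k\<in>Zn n. h (\<lambda>i\<in>{..<n}. u i + of_int (k i) / 2)))"
    and "(LINT x|lborel_Rn n. h x) =
      (LINT u|lborel_Rn n. indicator (cell n) u *\<^sub>R (\<Sum>\<^sub>\<infinity>k\<in>Zn n. h (\<lambda>i\<in>{..<n}. u i + of_int (k i) / 2)))"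
proof -
  define T where "T k u = (\<lambda>i\<in>{..<n}. u i + (of_int (k i) :: real) / 2)" for k :: "nat \<Rightarrow> int" and u
  define \<psi> where "\<psi> k u = indicator (cell n) u *\<^sub>R h (T k u)" for k u
  define \<phi> where "\<phi> k x = indicator (cell n) (T (\<lambda>i. - k i) x) *\<^sub>R h x" for k x
  define M where "M k = C * (\<Prod>i<n. 8 / (1 + (real_of_int (k i))\<^sup>2))" for k
  have C0: "C \<ge> 0" using dominated_Rn_nonneg[OF dom] .
  have M: "M summable_on Zn n" unfolding M_def by (rule summable_on_Zn_weight)
  have M0: "M k \<ge> 0" for k unfolding M_def using C0 by (intro mult_nonneg_nonneg prod_nonneg) auto
  have hm: "h \<in> borel_measurable (lborel_Rn n)"
    using dom by (intro borel_measurable_continuous_Rn) (simp add: dominated_Rn_def)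
  have hi: "integrable (lborel_Rn n) h" by (rule dominated_Rn_integrable[OF dom])
  have cm: "(indicator (cell n) :: _ \<Rightarrow> real) \<in> borel_measurable (lborel_Rn n)"
    using cell_sets by simp
  have \<psi>_bound: "norm (\<psi> k u) \<le> M k * indicator (cell n) u" for k u
  proof (cases "u \<in> cell n")
    case True
    then have "\<bar>u i\<bar> \<le> 1 / 2" if "i < n" for i
      using that PiE_mem[of u "{..<n}" "\<lambda>_. {- (1 / 4)..<1 / 4}" i] by (simp add: cell_def) linarith
    with True dominated_Rn_lattice_shift[OF dom, of u k] show ?thesis by (simp add: \<psi>_def T_def M_def)
  qed (simp add: \<psi>_def)
  have \<psi>_le_M: "norm (\<psi> k u) \<le> M k" for k u
    using \<psi>_bound[of k u] M0[of k] by (cases "u \<in> cell n") auto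
  have \<psi>m: "\<psi> k \<in> borel_measurable (lborel_Rn n)" for k
    unfolding \<psi>_def T_def by (intro borel_measurable_scaleR cm translate_measurable_Rn hm)
  have \<psi>i: "integrable (lborel_Rn n) (\<psi> k)" for k
  proof (rule Bochner_Integration.integrable_bound[OF _ \<psi>m AE_I2])
    show "integrable (lborel_Rn n) (\<lambda>u. M k * indicator (cell n) u)"
      by (intro integrable_mult_right integrable_indicator_cell)
    show "norm (\<psi> k u) \<le> norm (M k * indicator (cell n) u)" for u
      using \<psi>_bound[of k u] unfolding real_norm_def by (rule order_trans[OF _ abs_ge_self])
  qed
  have \<psi>_int_sum: "(\<lambda>k. LINT u|lborel_Rn n. norm (\<psi> k u)) summable_on Zn n"
  proof (rule summable_on_comparison_test[OF M])
    fix k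
    have "(LINT u|lborel_Rn n. norm (\<psi> k u)) \<le> (LINT u|lborel_Rn n. M k * indicator (cell n) u)"
      by (intro integral_mono integrable_norm \<psi>i integrable_mult_right integrable_indicator_cell \<psi>_bound)
    also have "\<dots> = M k * (1 / 2) ^ n"
      using cell_sets by (simp add: measure_cell Int_absorb2[OF cell_subset_Rn])
    also have "\<dots> \<le> M k" using M0[of k] by (intro mult_left_le) (auto intro: power_le_one)
    finally show "(LINT u|lborel_Rn n. norm (\<psi> k u)) \<le> M k" .
  qed simp
  have \<psi>_pt: "(\<lambda>k. norm (\<psi> k u)) summable_on Zn n" for u
    by (rule summable_on_comparison_test[OF M]) (use \<psi>_le_M in auto)
  note \<psi>_sum = integral_infsum[OF countable_Zn \<psi>i \<psi>_int_sum \<psi>_pt]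
  have eq: "(\<Sum>\<^sub>\<infinity>k\<in>Zn n. \<psi> k u) = indicator (cell n) u *\<^sub>R (\<Sum>\<^sub>\<infinity>k\<in>Zn n. h (T k u))" for u
    unfolding \<psi>_def by (cases "u \<in> cell n") auto
  have T_inv: "T (\<lambda>i. - k i) (T k u) = u" if "u \<in> Rn n" for k u
    using that by (auto simp: T_def Rn_def PiE_iff extensional_def)
  have \<phi>T: "\<phi> k (T k u) = \<psi> k u" if "u \<in> Rn n" for k u
    by (simp add: \<phi>_def \<psi>_def T_inv[OF that])
  have cmT: "(\<lambda>x. indicator (cell n) (T k x) :: real) \<in> borel_measurable (lborel_Rn n)" for k
    unfolding T_def by (rule translate_measurable_Rn[OF cm])
  have \<phi>m: "\<phi> k \<in> borel_measurable (lborel_Rn n)" for k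
    unfolding \<phi>_def by (intro borel_measurable_scaleR cmT hm)
  have \<phi>i: "integrable (lborel_Rn n) (\<phi> k)" for k
    by (rule Bochner_Integration.integrable_bound[OF hi \<phi>m AE_I2]) (auto simp: \<phi>_def indicator_def)
  have \<phi>\<psi>: "(LINT x|lborel_Rn n. \<phi> k x) = (LINT u|lborel_Rn n. \<psi> k u)" for k
  proof -
    have "(LINT x|lborel_Rn n. \<phi> k x) = (LINT u|lborel_Rn n. \<phi> k (T k u))"
      unfolding T_def by (rule integral_lborel_Rn_translate[symmetric, OF \<phi>m])
    also have "\<dots> = (LINT u|lborel_Rn n. \<psi> k u)"
      by (intro Bochner_Integration.integral_cong) (auto simp: \<phi>T)
    finally show ?thesis .
  qed
  have \<phi>\<psi>n: "(LINT x|lborel_Rn n. norm (\<phi> k x)) = (LINT u|lborel_Rn n. norm (\<psi> k u))" for k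
  proof -
    have "(LINT x|lborel_Rn n. norm (\<phi> k x)) = (LINT u|lborel_Rn n. norm (\<phi> k (T k u)))"
      unfolding T_def by (rule integral_lborel_Rn_translate[symmetric]) (use \<phi>m in measurable)
    also have "\<dots> = (LINT u|lborel_Rn n. norm (\<psi> k u))"
      by (intro Bochner_Integration.integral_cong) (auto simp: \<phi>T)
    finally show ?thesis .
  qed
  \<comment> \<open>The index of the tile containing \<open>x\<close>: every \<open>2 * x i\<close>
    is rounded to the nearest integer, ties upwards in accordance with the half-open cell.\<close>
  define \<kappa> where "\<kappa> x = (\<lambda>i\<in>{..<n}. \<lfloor>2 * x i + 1 / 2\<rfloor>)" for x :: "nat \<Rightarrow> real"
  have \<kappa>Z: "\<kappa> x \<in> Zn n" for x by (simp add: \<kappa>_def Zn_def)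
  have in_cell: "T (\<lambda>i. - k i) x \<in> cell n \<longleftrightarrow> k = \<kappa> x" if "k \<in> Zn n" for k x
  proof -
    have "T (\<lambda>i. - k i) x \<in> cell n \<longleftrightarrow> (\<forall>i<n. - (1/4) \<le> x i - of_int (k i) / 2 \<and> x i - of_int (k i) / 2 < 1/4)"
      by (auto simp: T_def cell_def PiE_iff)
    also have "\<dots> \<longleftrightarrow> (\<forall>i<n. k i = \<lfloor>2 * x i + 1 / 2\<rfloor>)"
    proof -
      have "- (1/4) \<le> y - of_int l / 2 \<and> y - of_int l / 2 < 1/4 \<longleftrightarrow> l = \<lfloor>2 * y + 1 / 2\<rfloor>" for y :: real and l :: int
        by (simp add: eq_commute[of l] floor_eq_iff) linarith
      then show ?thesis by simp
    qed
    also have "\<dots> \<longleftrightarrow> k = \<kappa> x"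
      using that by (auto simp: \<kappa>_def Zn_def PiE_iff extensional_def fun_eq_iff)
    finally show ?thesis .
  qed
  have \<phi>0: "\<phi> k x = (if k = \<kappa> x then h x else 0)" if "k \<in> Zn n" for k x
    using in_cell[OF that, of x] by (auto simp: \<phi>_def)
  have \<phi>_pt: "(\<lambda>k. norm (\<phi> k x)) summable_on Zn n" for x
  proof (rule finite_nonzero_values_imp_summable_on)
    have "{k \<in> Zn n. norm (\<phi> k x) \<noteq> 0} \<subseteq> {\<kappa> x}" using \<phi>0 by (auto split: if_splits)
    then show "finite {k \<in> Zn n. norm (\<phi> k x) \<noteq> 0}" by (rule finite_subset) simp
  qed
  have \<phi>_int_sum: "(\<lambda>k. LINT x|lborel_Rn n. norm (\<phi> k x)) summable_on Zn n"
    unfolding \<phi>\<psi>n by (rule \<psi>_int_sum)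
  note \<phi>_sum = integral_infsum(2)[OF countable_Zn \<phi>i \<phi>_int_sum \<phi>_pt]
  have h_eq: "(\<Sum>\<^sub>\<infinity>k\<in>Zn n. \<phi> k x) = h x" for x
  proof -
    have "(\<Sum>\<^sub>\<infinity>k\<in>Zn n. \<phi> k x) = (\<Sum>\<^sub>\<infinity>k\<in>{\<kappa> x}. \<phi> k x)"
      by (rule infsum_cong_neutral) (use \<kappa>Z \<phi>0 in auto)
    also have "\<dots> = h x" using \<phi>0[OF \<kappa>Z, of x x] by simp
    finally show ?thesis .
  qed
  show "integrable (lborel_Rn n) (\<lambda>u. indicator (cell n) u *\<^sub>R (\<Sum>\<^sub>\<infinity>k\<in>Zn n. h (\<lambda>i\<in>{..<n}. u i + of_int (k i) / 2)))"
    using \<psi>_sum(1) unfolding eq T_def .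
  show "(LINT x|lborel_Rn n. h x) =
      (LINT u|lborel_Rn n. indicator (cell n) u *\<^sub>R (\<Sum>\<^sub>\<infinity>k\<in>Zn n. h (\<lambda>i\<in>{..<n}. u i + of_int (k i) / 2)))"
    using \<phi>_sum \<psi>_sum(2) unfolding h_eq \<phi>\<psi> eq T_def by simp
qed

lemma integral_exp_interval:
  fixes a l r :: real
  assumes "a \<noteq> 0" "l \<le> r"
  shows "(LINT y|lborel. indicator {l..r} y *\<^sub>R exp (\<i> * of_real (a * y))) =
    (exp (\<i> * of_real (a * r)) - exp (\<i> * of_real (a * l))) / (\<i> * of_real a)"
proof -
  have "(LINT y|lborel. indicator {l..r} y *\<^sub>R exp (\<i> * of_real (a * y))) =
    exp (\<i> * of_real (a * r)) / (\<i> * of_real a) - exp (\<i> * of_real (a * l)) / (\<i> * of_real a)"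
  proof (rule integral_FTC_Icc)
    fix x
    show "((\<lambda>y. exp (\<i> * of_real (a * y)) / (\<i> * of_real a)) has_vector_derivative
       exp (\<i> * of_real (a * x))) (at x within {l..r})"
    proof -
      have "((\<lambda>z. exp (\<i> * (of_real a * z)) / (\<i> * of_real a)) has_field_derivative
         exp (\<i> * (of_real a * of_real x))) (at (of_real x))"
        using assms by (auto intro!: derivative_eq_intros simp: mult_ac)
      from has_vector_derivative_real_field[OF this] show ?thesis by simp
    qed
  qed (use assms in \<open>auto intro!: continuous_intros\<close>)
  then show ?thesis by (simp add: diff_divide_distrib)
qed

lemma integrable_exp_interval:
  fixes a l r :: real
  shows "integrable lborel (\<lambda>y. indicator {l..r} y *\<^sub>R exp (\<i> * of_real (a * y)))"
  by (rule borel_integrable_compact) (auto intro!: continuous_intros)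

text \<open>Orthogonality of characters: the integral is a product over the coordinates, and a
  factor with \<open>m i \<noteq> 0\<close> runs over whole periods. Half-open and closed intervals
  differ by a null set, so the exponential integral over a closed interval applies.\<close>

lemma integral_cell_lattice_char:
  "(LINT u|lborel_Rn n. indicator (cell n) u *\<^sub>R lattice_char n m u) =
     (if \<exists>i<n. m i \<noteq> 0 then 0 else (1 / 2) ^ n)"
proof -
  interpret product_sigma_finite "\<lambda>i :: nat. lborel :: real measure" by standard
  define f where "f i y = indicator {- (1/4)..<1/4} y *\<^sub>R exp (\<i> * of_real (- (4 * pi * of_int (m i)) * y))" for i y
  define g where "g i y = indicator {- (1/4)..1/4} y *\<^sub>R exp (\<i> * of_real (- (4 * pi * of_int (m i)) * y))" for i y
  have ae: "AE y in lborel. f i y = g i y" for i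
    using AE_lborel_singleton[of "1/4 :: real"]
    by eventually_elim (auto simp: f_def g_def indicator_def)
  have fm: "f i \<in> borel_measurable lborel" for i
    unfolding f_def by (auto intro!: borel_measurable_continuous_onI continuous_intros)
  have gi: "integrable lborel (g i)" for i
    unfolding g_def by (rule integrable_exp_interval)
  have fi: "integrable lborel (f i)" for i
    using gi[of i] ae[of i] fm[of i] by (subst integrable_cong_AE[where g = "g i"]) (auto simp: g_def)
  have f_int: "(LINT y|lborel. f i y) = (if m i = 0 then 1 / 2 else 0)" for i
  proof -
    have "(LINT y|lborel. f i y) = (LINT y|lborel. g i y)"
      using gi[of i] ae[of i] fm[of i] by (intro integral_cong_AE) auto
    also have "\<dots> = (if m i = 0 then 1 / 2 else 0)"
    proof (cases "m i = 0")
      case True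
      then show ?thesis by (simp add: g_def scaleR_conv_of_real)
    next
      case False
      define a where "a = - (4 * pi * of_int (m i))"
      have a0: "a \<noteq> 0" using False by (simp add: a_def)
      have "exp (\<i> * of_real (a * (1/4))) = exp (\<i> * of_real (a * (-(1/4)))) * exp (of_real (2 * of_int (- m i) * pi) * \<i>)"
        unfolding exp_add[symmetric] by (rule arg_cong[where f=exp]) (simp add: a_def algebra_simps)
      also have "exp (of_real (2 * of_int (- m i) * pi) * \<i>) = 1"
        by (rule exp_integer_2pi) (rule Ints_of_int)
      finally have "exp (\<i> * of_real (a * (1/4))) - exp (\<i> * of_real (a * (-(1/4)))) = 0" by simp
      moreover have "(LINT y|lborel. g i y) =
        (exp (\<i> * of_real (a * (1/4))) - exp (\<i> * of_real (a * (-(1/4))))) / (\<i> * of_real a)"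
        unfolding g_def a_def[symmetric] by (rule integral_exp_interval[OF a0]) simp
      ultimately show ?thesis using False by simp
    qed
    finally show ?thesis .
  qed
  have "(LINT u|lborel_Rn n. indicator (cell n) u *\<^sub>R lattice_char n m u) = (LINT u|lborel_Rn n. (\<Prod>i<n. f i (u i)))"
  proof (rule Bochner_Integration.integral_cong[OF refl])
    fix u assume "u \<in> space (lborel_Rn n)"
    then have "u \<in> cell n \<longleftrightarrow> (\<forall>i<n. u i \<in> {- (1/4)..<1/4})"
      by (auto simp: cell_def Rn_def PiE_iff)
    moreover have "(\<Prod>i<n. f i (u i)) = (\<Prod>i<n. of_real (indicator {- (1/4)..<1/4} (u i))) * lattice_char n m u"
      by (simp add: f_def lattice_char_prod scaleR_conv_of_real prod.distrib)
    moreover have "(\<Prod>i<n. of_real (indicator {- (1/4)..<1/4} (u i))) = (of_bool (\<forall>i<n. u i \<in> {- (1/4)..<1/4}) :: complex)"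
      by (auto simp: indicator_def)
    ultimately show "indicator (cell n) u *\<^sub>R lattice_char n m u = (\<Prod>i<n. f i (u i))"
      by (simp add: indicator_def)
  qed
  also have "\<dots> = (\<Prod>i<n. if m i = 0 then 1 / 2 else 0)"
    unfolding lborel_Rn_def using fi by (subst product_integral_prod) (auto simp: f_int)
  also have "\<dots> = (if \<exists>i<n. m i \<noteq> 0 then 0 else (1 / 2) ^ n)"
    by (auto intro: prod_zero)
  finally show ?thesis .
qed

lemma lattice_translate_continuous:
  fixes f :: "(nat \<Rightarrow> real) \<Rightarrow> 'b :: topological_space"
  assumes "continuous_on (Rn n) f"
  shows "continuous_on S (\<lambda>u. f (\<lambda>i\<in>{..<n}. u i + c i))"
proof (rule continuous_on_compose2[OF assms])
  show "continuous_on S (\<lambda>u. \<lambda>i\<in>{..<n}. u i + c i)"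
  proof (rule continuous_on_coordinatewise_then_product)
    show "continuous_on S (\<lambda>u. (\<lambda>i\<in>{..<n}. u i + c i) i)" for i
      by (cases "i < n")
        (auto intro!: continuous_intros continuous_on_subset[OF continuous_on_product_coordinates])
  qed
  show "(\<lambda>u. \<lambda>i\<in>{..<n}. u i + c i) ` S \<subseteq> Rn n" by (auto simp: restrict_in_Rn)
qed

text \<open>A basic open set of the product topology gives a radius for each coordinate. From index
  \<open>n\<close> on all points of \<open>Rn n\<close> agree, so the minimum of finitely many radii
  works; the inserted 1 covers \<open>n = 0\<close>.\<close>

lemma continuous_on_Rn_nbhd:
  fixes f :: "(nat \<Rightarrow> real) \<Rightarrow> real"
  assumes cont: "continuous_on S f" and S: "S \<subseteq> Rn n" and z: "z \<in> S" and gt: "f z > r"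
  shows "\<exists>\<delta>>0. \<forall>u\<in>S. (\<forall>i<n. \<bar>u i - z i\<bar> < \<delta>) \<longrightarrow> f u > r"
proof -
  from cont z gt obtain U where U: "open U" "z \<in> U" "\<And>u. u \<in> S \<Longrightarrow> u \<in> U \<Longrightarrow> f u \<in> {r<..}"
    unfolding continuous_on_topological by (metis greaterThan_iff open_greaterThan)
  obtain X where X: "z \<in> (\<Pi>\<^sub>E i\<in>UNIV. X i)" "\<And>i. open (X i)" "(\<Pi>\<^sub>E i\<in>UNIV. X i) \<subseteq> U"
    using product_topology_open_contains_basis[OF U(1)[unfolded open_fun_def] U(2)] by auto
  have "\<exists>e>0. \<forall>y. \<bar>y - z i\<bar> < e \<longrightarrow> y \<in> X i" for i
  proof -
    have "z i \<in> X i" using X(1) by auto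
    then show ?thesis using X(2)[of i] unfolding open_dist dist_real_def by blast
  qed
  then obtain e where e: "\<And>i. e i > 0" "\<And>i y. \<bar>y - z i\<bar> < e i \<Longrightarrow> y \<in> X i" by metis
  define \<delta> where "\<delta> = Min (insert 1 (e ` {..<n}))"
  have \<delta>: "\<delta> > 0" "\<And>i. i < n \<Longrightarrow> \<delta> \<le> e i" using e by (auto simp: \<delta>_def)
  have "f u > r" if u: "u \<in> S" "\<forall>i<n. \<bar>u i - z i\<bar> < \<delta>" for u
  proof -
    have "u i \<in> X i" for i
    proof (cases "i < n")
      case True
      then have "\<bar>u i - z i\<bar> < e i" using u(2) \<delta>(2)[of i] by force
      then show ?thesis by (rule e(2))
    next
      case False
      then have "u i = undefined" "z i = undefined"
        using PiE_arb[of u "{..<n}" "\<lambda>_. UNIV" i] PiE_arb[of z "{..<n}" "\<lambda>_. UNIV" i] u S z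
        by (auto simp: Rn_def)
      then show ?thesis using X(1) by (metis PiE_mem UNIV_I)
    qed
    then have "u \<in> U" using X(3) by auto
    then show ?thesis using U(3)[OF u(1)] by simp
  qed
  with \<delta>(1) show ?thesis by blast
qed

text \<open>This is \<open>cos^2 (2 pi y)\<close>. It has period \<open>1 / 2\<close>, attains its
  maximum 1 exactly at the multiples of \<open>1 / 2\<close>, and being a combination of the
  frequencies -2, 0 and 2 it stays, in all its products over coordinates, within the span of the
  characters.\<close>

definition bump :: "real \<Rightarrow> real" where
  "bump y = (1 + cos (4 * pi * y)) / 2"

lemma bump_bounds: "0 \<le> bump y" "bump y \<le> 1"
  by (simp_all add: bump_def) (smt (verit) cos_ge_minus_one)

lemma bump_antimono:
  assumes "\<bar>x\<bar> \<le> \<bar>y\<bar>" "\<bar>y\<bar> \<le> 1 / 4"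
  shows "bump y \<le> bump x"
proof -
  have "4 * pi * \<bar>x\<bar> \<le> 4 * pi * \<bar>y\<bar>" "4 * pi * \<bar>y\<bar> \<le> 4 * pi * (1 / 4)"
    by (intro mult_left_mono assms; simp)+
  then have "cos (4 * pi * \<bar>y\<bar>) \<le> cos (4 * pi * \<bar>x\<bar>)"
    by (intro cos_monotone_0_pi_le) auto
  moreover have "cos (4 * pi * \<bar>z\<bar>) = cos (4 * pi * z)" for z
    using cos_abs_real[of "4 * pi * z"] by (simp add: abs_mult)
  ultimately show ?thesis by (simp add: bump_def)
qed

lemma bump_less_1:
  assumes "0 < y" "y \<le> 1 / 4"
  shows "bump y < 1"
proof -
  have "4 * pi * y \<le> 4 * pi * (1 / 4)" by (intro mult_left_mono assms) simp
  then have "cos (4 * pi * y) < cos 0" using assms by (intro cos_monotone_0_pi) auto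
  then show ?thesis by (simp add: bump_def)
qed

lemma bump_lattice_char:
  assumes "j < n"
  shows "of_real (bump (u j)) = 1 / 2 + lattice_char n (\<lambda>i. of_bool (i = j)) u / 4
    + lattice_char n (\<lambda>i. - of_bool (i = j)) u / 4"
proof -
  have 1: "(\<Sum>i<n. u i * (2 * real_of_int (of_bool (i = j)))) = 2 * u j"
    using assms by (simp add: of_bool_def if_distrib cong: if_cong)
  have 2: "(\<Sum>i<n. u i * (2 * real_of_int (- of_bool (i = j)))) = - (2 * u j)"
    using assms 1 by (simp add: sum_negf)
  have "of_real (cos (4 * pi * u j)) = (exp (\<i> * of_real (4 * pi * u j)) + exp (- \<i> * of_real (4 * pi * u j))) / (2 :: complex)"
    unfolding cos_of_real[symmetric] cos_exp_eq by simp
  moreover have "lattice_char n (\<lambda>i. of_bool (i = j)) u = exp (- \<i> * of_real (4 * pi * u j))"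
    unfolding lattice_char_def 1 by (rule arg_cong[where f=exp]) simp
  moreover have "lattice_char n (\<lambda>i. - of_bool (i = j)) u = exp (\<i> * of_real (4 * pi * u j))"
    unfolding lattice_char_def 2 by (rule arg_cong[where f=exp]) simp
  moreover have "of_real ((1 + x) / 2) = 1 / 2 + e / 4 + f / 4" if "of_real x = (f + e) / 2"
    for x :: real and e f :: complex
    using that by (simp add: add_divide_distrib)
  ultimately show ?thesis unfolding bump_def by metis
qed

text \<open>
  All nonconstant Fourier coefficients of the periodization \<open>G\<close> of \<open>f\<close> vanish, so \<open>G - c\<close> is
  orthogonal to every trigonometric polynomial, in particular to the powers of the product of
  \<open>bump\<close> over the coordinates. These concentrate at the origin, which forces \<open>G 0 = c\<close>.
\<close>

theorem poisson_summation_vanishing: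
  assumes dom: "dominated_Rn n C f"
    and van: "\<And>m. \<exists>i<n. m i \<noteq> 0 \<Longrightarrow> fourier_Rn n f (\<lambda>i. 2 * of_int (m i)) = 0"
  shows "(\<Sum>\<^sub>\<infinity>k\<in>Zn n. f (\<lambda>i\<in>{..<n}. of_int (k i) / 2)) = 2 ^ n * (LINT x|lborel_Rn n. f x)"
proof -
  define G where "G u = (\<Sum>\<^sub>\<infinity>k\<in>Zn n. f (\<lambda>i\<in>{..<n}. u i + of_int (k i) / 2))" for u
  define c where "c = 2 ^ n * (LINT x|lborel_Rn n. f x)"
  define W where "W u = indicator (cell n) u *\<^sub>R (G u - c)" for u
  have fcont: "continuous_on (Rn n) f" using dom by (simp add: dominated_Rn_def)
  have intG: "integrable (lborel_Rn n) (\<lambda>u. indicator (cell n) u *\<^sub>R G u)"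
    unfolding G_def by (rule integral_lborel_Rn_unfold(1)[OF dom])
  have intc: "integrable (lborel_Rn n) (\<lambda>u. indicator (cell n) u *\<^sub>R c)"
    by (intro integrable_scaleR_left integrable_indicator_cell)
  have intW: "integrable (lborel_Rn n) W"
    unfolding W_def scaleR_diff_right by (rule Bochner_Integration.integrable_diff[OF intG intc])
  have int_mult: "integrable (lborel_Rn n) (\<lambda>u. W u * p u)"
    if "continuous_on (Rn n) p" "\<And>u. u \<in> Rn n \<Longrightarrow> cmod (p u) \<le> 1" for p
  proof (rule Bochner_Integration.integrable_bound[OF intW])
    show "(\<lambda>u. W u * p u) \<in> borel_measurable (lborel_Rn n)"
      using intW borel_measurable_continuous_Rn[OF that(1)] by auto
    show "AE u in lborel_Rn n. norm (W u * p u) \<le> norm (W u)"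
      using that(2) by (intro AE_I2) (auto simp: norm_mult intro!: mult_left_le)
  qed
  \<comment> \<open>For \<open>m \<noteq> 0\<close> the contributions of \<open>G\<close> and of
    \<open>c\<close> both vanish; for \<open>m = 0\<close> they cancel, because \<open>c\<close> is
    the mean of \<open>G\<close> over a cell of volume \<open>2^-n\<close>.\<close>
  have base: "(LINT u|lborel_Rn n. W u * lattice_char n m u) = 0" for m
  proof -
    have dom': "dominated_Rn n (C * 1) (\<lambda>x. f x * lattice_char n m x)"
      by (intro dominated_Rn_mult dom continuous_intros) simp
    have "(LINT x|lborel_Rn n. f x * lattice_char n m x) =
      (LINT u|lborel_Rn n. indicator (cell n) u *\<^sub>R (G u * lattice_char n m u))"
      unfolding integral_lborel_Rn_unfold(2)[OF dom'] G_def lattice_char_periodic infsum_cmult_left' ..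
    moreover have "(LINT u|lborel_Rn n. W u * lattice_char n m u) =
       (LINT u|lborel_Rn n. indicator (cell n) u *\<^sub>R (G u * lattice_char n m u)) -
       c * (LINT u|lborel_Rn n. indicator (cell n) u *\<^sub>R lattice_char n m u)"
    proof -
      have i1: "integrable (lborel_Rn n) (\<lambda>u. indicator (cell n) u *\<^sub>R (G u * lattice_char n m u))"
        using integral_lborel_Rn_unfold(1)[OF dom'] unfolding lattice_char_periodic infsum_cmult_left' G_def .
      have i2: "integrable (lborel_Rn n) (\<lambda>u. indicator (cell n) u *\<^sub>R lattice_char n m u)"
        by (rule Bochner_Integration.integrable_bound[OF integrable_indicator_cell])
          (use cell_sets borel_measurable_continuous_Rn[OF lattice_char_continuous] in \<open>auto simp: indicator_def\<close>)
      have "(\<lambda>u. W u * lattice_char n m u) = (\<lambda>u. indicator (cell n) u *\<^sub>R (G u * lattice_char n m u) -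
          c * (indicator (cell n) u *\<^sub>R lattice_char n m u))"
        by (auto simp: W_def algebra_simps)
      then show ?thesis
        by (simp only: Bochner_Integration.integral_diff[OF i1 integrable_mult_right[OF i2]] integral_mult_right_zero)
    qed
    ultimately have eq: "(LINT u|lborel_Rn n. W u * lattice_char n m u) =
      (LINT x|lborel_Rn n. f x * lattice_char n m x) - c * (if \<exists>i<n. m i \<noteq> 0 then 0 else (1 / 2) ^ n)"
      by (simp only: integral_cell_lattice_char)
    show ?thesis
    proof (cases "\<exists>i<n. m i \<noteq> 0")
      case True
      then show ?thesis using van[OF True] eq by (simp add: fourier_Rn_lattice)
    next
      case False
      then have "lattice_char n m x = 1" for x by (simp add: lattice_char_def)
      then show ?thesis using eq unfolding if_not_P[OF False] by (simp add: c_def power_one_over)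
    qed
  qed
  \<comment> \<open>Powers of the product of bumps are coded as lists of coordinates with
    repetitions, so that an induction can multiply by one \<open>bump\<close>, that is by three
    characters, at a time.\<close>
  define wt where "wt js u = (\<Prod>j\<leftarrow>js. bump (u j))" for js :: "nat list" and u :: "nat \<Rightarrow> real"
  have wt_bounds: "0 \<le> wt js u \<and> wt js u \<le> 1" for js u
    unfolding wt_def by (induction js) (auto simp: bump_bounds intro!: mult_le_one)
  have wt_cont: "continuous_on S (wt js)" for S js
    unfolding wt_def
    by (induction js) (auto simp: bump_def intro!: continuous_intros continuous_on_subset[OF continuous_on_product_coordinates])
  have trig: "(LINT u|lborel_Rn n. W u * (lattice_char n m u * of_real (wt js u))) = 0" if "set js \<subseteq> {..<n}" for m js
    using that
  proof (induction js arbitrary: m)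
    case Nil
    then show ?case using base by (simp add: wt_def)
  next
    case (Cons j js)
    then have j: "j < n" by simp
    let ?p = "\<lambda>m u. lattice_char n m u * of_real (wt js u)"
    let ?m1 = "\<lambda>i. m i + of_bool (i = j)" and ?m2 = "\<lambda>i. m i + - of_bool (i = j)"
    have i: "integrable (lborel_Rn n) (\<lambda>u. W u * ?p m' u)" for m'
      using wt_bounds by (intro int_mult continuous_intros wt_cont continuous_on_of_real) (auto simp: norm_mult abs_of_nonneg)
    have "W u * (lattice_char n m u * of_real (wt (j # js) u)) =
      1 / 2 * (W u * ?p m u) + 1 / 4 * (W u * ?p ?m1 u) + 1 / 4 * (W u * ?p ?m2 u)" for u
    proof -
      have "W u * (lattice_char n m u * of_real (wt (j # js) u)) =
         W u * of_real (wt js u) * (lattice_char n m u * of_real (bump (u j)))"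
        by (simp add: wt_def)
      also have "lattice_char n m u * of_real (bump (u j)) =
         1 / 2 * lattice_char n m u + 1 / 4 * lattice_char n ?m1 u + 1 / 4 * lattice_char n ?m2 u"
        unfolding bump_lattice_char[OF j] lattice_char_mult[symmetric] by (simp add: algebra_simps)
      finally show ?thesis by (simp add: algebra_simps)
    qed
    then have "(LINT u|lborel_Rn n. W u * (lattice_char n m u * of_real (wt (j # js) u))) =
      1 / 2 * (LINT u|lborel_Rn n. W u * ?p m u) + 1 / 4 * (LINT u|lborel_Rn n. W u * ?p ?m1 u)
        + 1 / 4 * (LINT u|lborel_Rn n. W u * ?p ?m2 u)"
      using i by simp
    also have "\<dots> = 0" using Cons by simp
    finally show ?case .
  qed
  define w where "w u = (\<Prod>i<n. bump (u i))" for u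
  have w_pow: "w u ^ N = wt (concat (replicate N [0..<n])) u" for u N
  proof (induction N)
    case 0 then show ?case by (simp add: wt_def)
  next
    case (Suc N)
    have "w u = wt [0..<n] u"
      unfolding w_def wt_def by (simp add: prod.list_conv_set_nth prod.distinct_set_conv_list[symmetric] atLeast0LessThan)
    with Suc show ?case by (simp add: wt_def)
  qed
  have Wpow: "(LINT u|lborel_Rn n. W u * of_real (w u ^ N)) = 0" for N
  proof -
    have "lattice_char n (\<lambda>_. 0) u = 1" for u by (simp add: lattice_char_def)
    then show ?thesis using trig[of "concat (replicate N [0..<n])" "\<lambda>_. 0"]
      unfolding w_pow by (simp add: set_replicate_conv_if subset_iff)
  qed
  have Wpow_int: "integrable (lborel_Rn n) (\<lambda>u. W u * of_real (w u ^ N))" for N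
    unfolding w_pow using wt_bounds
    by (intro int_mult continuous_on_of_real wt_cont) (auto simp: abs_of_nonneg)
  define M where "M k = C * (\<Prod>i<n. 8 / (1 + (real_of_int (k i))\<^sup>2))" for k
  have M: "M summable_on Zn n" unfolding M_def by (rule summable_on_Zn_weight)
  define Q where "Q = {u \<in> Rn n. \<forall>i<n. \<bar>u i\<bar> \<le> 1 / 4}"
  have cellQ: "cell n \<subseteq> Q"
  proof
    fix u assume u: "u \<in> cell n"
    have "\<bar>u i\<bar> \<le> 1 / 4" if "i < n" for i
      using that PiE_mem[of u "{..<n}" "\<lambda>_. {- (1 / 4)..<1 / 4}" i] u by (simp add: cell_def) linarith
    with u cell_subset_Rn[of n] show "u \<in> Q" by (auto simp: Q_def)
  qed
  have Mbound: "norm (f (\<lambda>i\<in>{..<n}. u i + of_int (k i) / 2)) \<le> M k" if "u \<in> Q" for k u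
    unfolding M_def by (rule dominated_Rn_lattice_shift[OF dom]) (use that in \<open>force simp: Q_def\<close>)
  have Gcont: "continuous_on Q G"
  proof (rule uniform_limit_theorem)
    show "uniform_limit Q (\<lambda>X u. \<Sum>k\<in>X. f (\<lambda>i\<in>{..<n}. u i + of_int (k i) / 2)) G (finite_subsets_at_top (Zn n))"
      unfolding G_def by (rule Weierstrass_m_test_general[OF Mbound M])
    show "\<forall>\<^sub>F X in finite_subsets_at_top (Zn n). continuous_on Q (\<lambda>u. \<Sum>k\<in>X. f (\<lambda>i\<in>{..<n}. u i + of_int (k i) / 2))"
      by (intro always_eventually allI continuous_on_sum lattice_translate_continuous fcont)
  qed simp
  have Gbound: "norm (G u) \<le> infsum M (Zn n)" if "u \<in> Q" for u
  proof -
    have s: "(\<lambda>k. norm (f (\<lambda>i\<in>{..<n}. u i + of_int (k i) / 2))) summable_on Zn n"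
      by (rule summable_on_comparison_test[OF M]) (use Mbound[OF that] in auto)
    have "norm (G u) \<le> (\<Sum>\<^sub>\<infinity>k\<in>Zn n. norm (f (\<lambda>i\<in>{..<n}. u i + of_int (k i) / 2)))"
      unfolding G_def by (rule norm_infsum_bound[OF s])
    also have "\<dots> \<le> infsum M (Zn n)"
      by (rule infsum_mono[OF s M]) (rule Mbound[OF that])
    finally show ?thesis .
  qed
  define z :: "nat \<Rightarrow> real" where "z = (\<lambda>i\<in>{..<n}. 0)"
  have z: "z \<in> cell n" by (auto simp: z_def cell_def)
  have "G z = c"
  proof (rule ccontr)
    assume "G z \<noteq> c"
    \<comment> \<open>The factor \<open>a\<close> turns the value of \<open>G - c\<close> at
      \<open>z\<close> into a positive real number, its squared modulus, so that real parts can be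
      compared.\<close>
    define a where "a = cnj (G z - c)"
    define R where "R u = Re (a * (G u - c))" for u
    define r where "r = R z"
    have r: "r > 0"
    proof -
      have "r = (cmod (G z - c))\<^sup>2"
        unfolding r_def R_def a_def cmod_power2 by (simp add: power2_eq_square algebra_simps)
      then show ?thesis using \<open>G z \<noteq> c\<close> by simp
    qed
    define Bd where "Bd = cmod a * (infsum M (Zn n) + cmod c)"
    have Rb: "\<bar>R u\<bar> \<le> Bd" if "u \<in> Q" for u
    proof -
      have "\<bar>R u\<bar> \<le> cmod (a * (G u - c))" unfolding R_def by (rule abs_Re_le_cmod)
      also have "\<dots> = cmod a * cmod (G u - c)" by (rule norm_mult)
      also have "\<dots> \<le> Bd" unfolding Bd_def
        using Gbound[OF that] by (intro mult_left_mono order_trans[OF norm_triangle_ineq4]) auto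
      finally show ?thesis .
    qed
    have Bd0: "Bd \<ge> 0" using Rb[of z] z cellQ by force
    have contR: "continuous_on Q R" unfolding R_def by (intro continuous_intros Gcont)
    obtain \<delta>0 where \<delta>0: "\<delta>0 > 0" "\<And>u. u \<in> Q \<Longrightarrow> \<forall>i<n. \<bar>u i - z i\<bar> < \<delta>0 \<Longrightarrow> R u > r / 2"
    proof -
      have "z \<in> Q" "Q \<subseteq> Rn n" using z cellQ by (auto simp: Q_def)
      moreover have "R z > r / 2" using r by (simp add: r_def)
      ultimately have "\<exists>\<delta>>0. \<forall>u\<in>Q. (\<forall>i<n. \<bar>u i - z i\<bar> < \<delta>) \<longrightarrow> R u > r / 2"
        by (intro continuous_on_Rn_nbhd[OF contR])
      then show ?thesis using that by blast
    qed
    define \<delta> where "\<delta> = min \<delta>0 (1 / 8)"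
    have \<delta>: "0 < \<delta>" "\<delta> \<le> 1 / 8" using \<delta>0 by (auto simp: \<delta>_def)
    have R_near: "R u > r / 2" if "u \<in> Q" "\<And>i. i < n \<Longrightarrow> \<bar>u i\<bar> < \<delta>" for u
      using \<delta>0(2)[OF that(1)] that(2) by (auto simp: z_def \<delta>_def)
    define \<eta> where "\<eta> = bump \<delta>"
    have \<eta>: "0 \<le> \<eta>" "\<eta> < 1" using bump_bounds bump_less_1[of \<delta>] \<delta> by (auto simp: \<eta>_def)
    \<comment> \<open>Within \<open>Q\<close> and outside the cube of radius \<open>\<delta>\<close>
      the weight \<open>w\<close> is at most \<open>\<eta>\<close>. Any \<open>\<theta>\<close>
      strictly between \<open>\<eta>\<close> and 1 serves: on a smaller cube, of radius
      \<open>\<delta>'\<close>, the weight is at least \<open>\<theta>\<close>.\<close>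
    define \<theta> where "\<theta> = (1 + \<eta>) / 2"
    have \<theta>: "\<eta> < \<theta>" "\<theta> < 1" "0 < \<theta>" using \<eta> by (auto simp: \<theta>_def)
    obtain \<delta>' where \<delta>': "0 < \<delta>'" "\<delta>' < \<delta>" "bump \<delta>' ^ n > \<theta>"
    proof -
      have "((\<lambda>y. bump y ^ n) \<longlongrightarrow> bump 0 ^ n) (at_right 0)"
        unfolding bump_def by (intro tendsto_intros) simp
      then have "\<forall>\<^sub>F y in at_right 0. bump y ^ n > \<theta>"
        by (rule order_tendstoD) (use \<theta> in \<open>simp add: bump_def\<close>)
      moreover have "\<forall>\<^sub>F y in at_right 0. 0 < y \<and> y < \<delta>"
        using \<delta>(1) eventually_at_right_field by blast
      ultimately have "\<forall>\<^sub>F y in at_right 0. bump y ^ n > \<theta> \<and> 0 < y \<and> y < \<delta>"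
        by eventually_elim auto
      then show ?thesis using that eventually_happens'[OF trivial_limit_at_right_real] by blast
    qed
    define V where "V = {..<n} \<rightarrow>\<^sub>E {-\<delta>'<..<\<delta>'}"
    have V_sets: "V \<in> sets (lborel_Rn n)" unfolding V_def by (rule box_sets_Rn) simp
    have V_cell: "V \<subseteq> cell n" unfolding V_def cell_def using \<delta>' \<delta> by (intro PiE_mono) auto
    have V_meas: "measure (lborel_Rn n) V = (2 * \<delta>') ^ n"
      unfolding V_def measure_def using \<delta>'
      by (subst emeasure_box_Rn) (auto simp: ennreal_power)
    have V_int: "integrable (lborel_Rn n) (indicator V :: _ \<Rightarrow> real)"
      by (rule Bochner_Integration.integrable_bound[OF integrable_indicator_cell])
        (use V_sets V_cell in \<open>auto simp: indicator_def\<close>)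
    have w_bounds: "0 \<le> w u" "w u \<le> 1" for u
      unfolding w_def using bump_bounds by (auto intro!: prod_nonneg prod_le_1)
    \<comment> \<open>On \<open>V\<close> the integrand is at least
      \<open>r / 2 * \<theta> ^ N\<close>, between the two cubes it is nonnegative, and farther out
      it loses at most \<open>Bd * \<eta> ^ N\<close>. As the integral is 0 for every
      \<open>N\<close> and \<open>\<eta> < \<theta>\<close>, a large \<open>N\<close> gives a
      contradiction.\<close>
    have ineq: "r / 2 * \<theta> ^ N * indicator V u - Bd * \<eta> ^ N * indicator (cell n) u
        \<le> Re (a * (W u * of_real (w u ^ N)))" for u N
    proof (cases "u \<in> cell n")
      case False
      then have "u \<notin> V" using V_cell by blast
      with False show ?thesis by (simp add: W_def)
    next
      case True
      then have uQ: "u \<in> Q" using cellQ by blast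
      have eq: "Re (a * (W u * of_real (w u ^ N))) = R u * w u ^ N"
        using True by (simp add: W_def R_def mult.assoc[symmetric] del: of_real_power)
      show ?thesis
      proof (cases "\<forall>i<n. \<bar>u i\<bar> < \<delta>")
        case near: True
        then have Ru: "R u > r / 2" using R_near[OF uQ] by blast
        have w0: "0 \<le> w u ^ N" using w_bounds by simp
        have "r / 2 * \<theta> ^ N * indicator V u \<le> R u * w u ^ N"
        proof (cases "u \<in> V")
          case uV: True
          have "\<theta> \<le> bump \<delta>' ^ n" using \<delta>' by simp
          also have "\<dots> = (\<Prod>i<n. bump \<delta>')" by simp
          also have "\<dots> \<le> w u" unfolding w_def
          proof (intro prod_mono conjI bump_bounds bump_antimono)
            fix i assume "i \<in> {..<n}"
            then have "u i \<in> {-\<delta>'<..<\<delta>'}" using uV PiE_mem unfolding V_def by fast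
            then show "\<bar>u i\<bar> \<le> \<bar>\<delta>'\<bar>" by auto
            show "\<bar>\<delta>'\<bar> \<le> 1 / 4" using \<delta>' \<delta> by auto
          qed
          finally have "\<theta> ^ N \<le> w u ^ N" using \<theta> by (intro power_mono) auto
          then have "r / 2 * \<theta> ^ N \<le> R u * w u ^ N" using Ru r \<theta> by (intro mult_mono) auto
          then show ?thesis using uV by simp
        next
          case False
          then show ?thesis using Ru r w0 by (auto intro!: mult_nonneg_nonneg)
        qed
        moreover have "0 \<le> Bd * \<eta> ^ N * indicator (cell n) u" using Bd0 \<eta> by simp
        ultimately show ?thesis unfolding eq by linarith
      next
        case False
        then obtain i where i: "i < n" "\<bar>u i\<bar> \<ge> \<delta>" by force
        have "w u = bump (u i) * (\<Prod>j\<in>{..<n} - {i}. bump (u j))"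
          unfolding w_def using i by (subst prod.remove[of _ i]) auto
        also have "\<dots> \<le> bump (u i) * 1"
          by (intro mult_left_mono prod_le_1 bump_bounds conjI)
        also have "\<dots> \<le> \<eta>" unfolding \<eta>_def mult_1_right
          using i \<delta> uQ by (intro bump_antimono) (auto simp: Q_def)
        finally have wN: "w u ^ N \<le> \<eta> ^ N" using w_bounds by (intro power_mono) auto
        have "- (R u * w u ^ N) \<le> Bd * \<eta> ^ N"
        proof -
          have "- (R u * w u ^ N) = (- R u) * w u ^ N" by simp
          also have "\<dots> \<le> Bd * w u ^ N" using Rb[OF uQ] w_bounds by (intro mult_right_mono) auto
          also have "\<dots> \<le> Bd * \<eta> ^ N" using wN Bd0 by (intro mult_left_mono)
          finally show ?thesis .
        qed
        moreover have "u \<notin> V"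
        proof
          assume "u \<in> V"
          then have "u i \<in> {-\<delta>'<..<\<delta>'}" using i PiE_mem unfolding V_def by fast
          then show False using i \<delta>' by auto
        qed
        ultimately show ?thesis unfolding eq using True by simp
      qed
    qed
    have key: "r / 2 * \<theta> ^ N * (2 * \<delta>') ^ n \<le> Bd * \<eta> ^ N * (1 / 2) ^ n" for N
    proof -
      have "r / 2 * \<theta> ^ N * (2 * \<delta>') ^ n - Bd * \<eta> ^ N * (1 / 2) ^ n =
        (LINT u|lborel_Rn n. r / 2 * \<theta> ^ N * indicator V u - Bd * \<eta> ^ N * indicator (cell n) u)"
        using V_int integrable_indicator_cell[of n] V_cell cell_subset_Rn[of n]
        by (subst Bochner_Integration.integral_diff) (auto simp: V_meas measure_cell Int_absorb2)
      also have "\<dots> \<le> (LINT u|lborel_Rn n. Re (a * (W u * of_real (w u ^ N))))"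
        using V_int integrable_indicator_cell[of n]
        by (intro integral_mono ineq Bochner_Integration.integrable_diff integrable_mult_right integrable_Re Wpow_int)
      also have "\<dots> = Re (a * (LINT u|lborel_Rn n. W u * of_real (w u ^ N)))"
        by (subst integral_Re) (intro integrable_mult_right Wpow_int, simp)
      also have "\<dots> = 0" by (simp only: Wpow) simp
      finally show ?thesis by simp
    qed
    have "r / 2 * (2 * \<delta>') ^ n \<le> Bd * (1 / 2) ^ n * (\<eta> / \<theta>) ^ N" for N
      using key[of N] \<theta> by (simp add: power_divide field_simps)
    moreover have "(\<lambda>N. Bd * (1 / 2) ^ n * (\<eta> / \<theta>) ^ N) \<longlonglongrightarrow> Bd * (1 / 2) ^ n * 0"
      using \<eta> \<theta> by (intro tendsto_intros LIMSEQ_power_zero) auto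
    ultimately have "r / 2 * (2 * \<delta>') ^ n \<le> Bd * (1 / 2) ^ n * 0"
      by (intro LIMSEQ_le_const) auto
    moreover have "r / 2 * (2 * \<delta>') ^ n > 0" using r \<delta>' by simp
    ultimately show False by simp
  qed
  moreover have "G z = (\<Sum>\<^sub>\<infinity>k\<in>Zn n. f (\<lambda>i\<in>{..<n}. of_int (k i) / 2))"
    unfolding G_def z_def by (intro infsum_cong arg_cong[where f=f]) (auto simp: restrict_def)
  ultimately show ?thesis by (simp add: c_def)
qed

section \<open>Averages along the lattice\<close>

lemma floor_cell_measurable:
  fixes w :: "int \<Rightarrow> real" and \<gamma> :: "real \<Rightarrow> complex"
  assumes "continuous_on UNIV \<gamma>"
  shows "(\<lambda>t. of_real (w \<lfloor>2 * t\<rfloor>) * \<gamma> (t - of_int \<lfloor>2 * t\<rfloor> / 2)) \<in> borel_measurable borel"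
proof -
  have fl: "(\<lambda>t :: real. \<lfloor>2 * t\<rfloor>) \<in> measurable borel (count_space UNIV)" by measurable
  have 1: "(\<lambda>t :: real. of_real (w \<lfloor>2 * t\<rfloor>) :: complex) \<in> borel_measurable borel"
    by (rule measurable_compose[OF fl]) simp
  have "(\<lambda>t :: real. t - of_int \<lfloor>2 * t\<rfloor> / 2) \<in> borel_measurable borel" by measurable
  then have "(\<lambda>t. \<gamma> (t - of_int \<lfloor>2 * t\<rfloor> / 2)) \<in> borel_measurable borel"
    by (rule measurable_compose[OF _ borel_measurable_continuous_onI[OF assms]])
  with 1 show ?thesis by (rule borel_measurable_times)
qed

text \<open>On \<open>[a / 2, (a + 1) / 2)\<close> the integrand is \<open>w a\<close> times a
  translate of one fixed profile, so the integral from 0 to \<open>N / 2\<close> is a partial sum of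
  \<open>w\<close> times the integral of \<open>\<gamma>\<close>. The factor 2 counts the cells per
  unit of length.\<close>

lemma cell_average_tendsto:
  fixes w :: "int \<Rightarrow> real" and \<gamma> :: "real \<Rightarrow> complex"
  assumes w: "\<And>a. \<bar>w a\<bar> \<le> 1" and \<gamma>: "continuous_on UNIV \<gamma>"
    and dens: "(\<lambda>N. (\<Sum>a<N. w (int a)) / real N) \<longlonglongrightarrow> \<rho>"
  shows "((\<lambda>T. of_real (1 / T) * (LBINT t:{T..2 * T}. of_real (w \<lfloor>2 * t\<rfloor>) * \<gamma> (t - of_int \<lfloor>2 * t\<rfloor> / 2)))
     \<longlongrightarrow> 2 * of_real \<rho> * (LBINT s:{0..1/2}. \<gamma> s)) at_top"
proof -
  define p where "p t = of_real (w \<lfloor>2 * t\<rfloor>) * \<gamma> (t - of_int \<lfloor>2 * t\<rfloor> / 2)" for t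
  have "compact (\<gamma> ` {0..1/2})"
    by (intro compact_continuous_image continuous_on_subset[OF \<gamma>]) auto
  then obtain B where B: "\<And>s. s \<in> {0..1/2} \<Longrightarrow> cmod (\<gamma> s) \<le> B"
    using compact_imp_bounded bounded_iff by (metis imageI)
  have B0: "B \<ge> 0" using B[of 0] by (auto intro: order_trans[OF norm_ge_zero])
  have pB: "cmod (p t) \<le> B" for t
  proof -
    have "cmod (p t) \<le> 1 * B"
      unfolding p_def norm_mult using w B[of "t - of_int \<lfloor>2 * t\<rfloor> / 2"] B0
      by (intro mult_mono) (auto, linarith+)
    then show ?thesis by simp
  qed
  have \<gamma>m: "\<gamma> \<in> borel_measurable borel" by (rule borel_measurable_continuous_onI[OF \<gamma>])
  have pm: "p \<in> borel_measurable borel"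
    unfolding p_def by (rule floor_cell_measurable[OF \<gamma>])
  have ind_i: "integrable lborel (indicator {l..<r} :: real \<Rightarrow> real)" for l r :: real
    by (cases "l \<le> r") (auto simp: integrable_indicator_iff)
  have pi: "integrable lborel (\<lambda>t. indicator {l..<r} t *\<^sub>R p t)" for l r :: real
  proof (rule Bochner_Integration.integrable_bound)
    show "integrable lborel (\<lambda>t. B * indicator {l..<r} t)"
      by (intro integrable_mult_right ind_i)
    show "(\<lambda>t. indicator {l..<r} t *\<^sub>R p t) \<in> borel_measurable lborel" using pm by simp
    show "AE t in lborel. norm (indicator {l..<r} t *\<^sub>R p t) \<le> norm (B * indicator {l..<r} t)"
      using pB B0 by (intro AE_I2) (auto simp: indicator_def)
  qed
  define J where "J l r = (LINT t|lborel. indicator {l..<r} t *\<^sub>R p t)" for l r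
  have J_add: "J l r = J l m + J m r" if "l \<le> m" "m \<le> r" for l m r
  proof -
    have "(\<lambda>t. indicator {l..<r} t *\<^sub>R p t) = (\<lambda>t. indicator {l..<m} t *\<^sub>R p t + indicator {m..<r} t *\<^sub>R p t)"
      using that by (auto simp: indicator_def)
    then show ?thesis unfolding J_def using pi by simp
  qed
  have J_bound: "cmod (J l r) \<le> B * (r - l)" if "l \<le> r" for l r
  proof -
    have "cmod (J l r) \<le> (LINT t|lborel. norm (indicator {l..<r} t *\<^sub>R p t))"
      unfolding J_def by (rule integral_norm_bound)
    also have "\<dots> \<le> (LINT t|lborel. B * indicator {l..<r} t)"
      using pB B0 by (intro integral_mono integrable_norm pi integrable_mult_right ind_i) (auto simp: indicator_def)
    also have "\<dots> = B * (r - l)" using that by simp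
    finally show ?thesis .
  qed
  define \<Gamma> where "\<Gamma> = (LBINT s:{0..1/2}. \<gamma> s)"
  have \<Gamma>: "\<Gamma> = (LINT s|lborel. indicator {0..<1/2} s *\<^sub>R \<gamma> s)"
    unfolding \<Gamma>_def set_lebesgue_integral_def
  proof (rule integral_cong_AE)
    show "AE s in lborel. indicator {0..1/2} s *\<^sub>R \<gamma> s = indicator {0..<1/2} s *\<^sub>R \<gamma> s"
      using AE_lborel_singleton[of "1/2 :: real"] by eventually_elim (auto simp: indicator_def)
  qed (use \<gamma>m in auto)
  have J_block: "J (of_int a / 2) (of_int a / 2 + 1 / 2) = of_real (w a) * \<Gamma>" for a :: int
  proof -
    have "J (of_int a / 2) (of_int a / 2 + 1 / 2) =
      (LINT s|lborel. indicator {of_int a / 2..<of_int a / 2 + 1 / 2} (of_int a / 2 + 1 * s) *\<^sub>R p (of_int a / 2 + 1 * s))"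
      unfolding J_def by (subst lborel_integral_real_affine[where c = 1 and t = "of_int a / 2"]) auto
    also have "\<dots> = (LINT s|lborel. of_real (w a) * (indicator {0..<1/2} s *\<^sub>R \<gamma> s))"
    proof (rule Bochner_Integration.integral_cong[OF refl])
      fix s :: real
      show "indicator {of_int a / 2..<of_int a / 2 + 1 / 2} (of_int a / 2 + 1 * s) *\<^sub>R p (of_int a / 2 + 1 * s) =
         of_real (w a) * (indicator {0..<1/2} s *\<^sub>R \<gamma> s)"
      proof (cases "s \<in> {0..<1/2}")
        case True
        then have "\<lfloor>2 * (of_int a / 2 + s)\<rfloor> = a" by (intro floor_unique) auto
        with True show ?thesis by (simp add: p_def)
      next
        case False
        then show ?thesis by (auto simp: indicator_def)
      qed
    qed
    finally show ?thesis unfolding \<Gamma> by (simp only: integral_mult_right_zero)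
  qed
  have J_N: "J 0 (real N / 2) = of_real (\<Sum>a<N. w (int a)) * \<Gamma>" for N
  proof (induction N)
    case 0 then show ?case by (simp add: J_def)
  next
    case (Suc N)
    have "J 0 (real (Suc N) / 2) = J 0 (real N / 2) + J (of_int (int N) / 2) (of_int (int N) / 2 + 1 / 2)"
      using J_add[of 0 "real N / 2" "real (Suc N) / 2"] by (simp add: add_divide_distrib add.commute)
    then show ?case unfolding Suc J_block by (simp add: algebra_simps)
  qed
  define U where "U x = J 0 x" for x
  define n where "n x = nat \<lfloor>2 * x\<rfloor>" for x :: real
  have U_lim: "((\<lambda>x. U x / of_real x) \<longlongrightarrow> 2 * of_real \<rho> * \<Gamma>) at_top"
  proof -
    have n_top: "filterlim n sequentially at_top"
      unfolding n_def
      by (intro filterlim_compose[OF filterlim_nat_sequentially] filterlim_compose[OF filterlim_floor_sequentially] filterlim_tendsto_pos_mult_at_top[OF tendsto_const]) (auto simp: filterlim_ident)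
    have n_ratio: "((\<lambda>x. real (n x) / x) \<longlongrightarrow> 2) at_top"
    proof -
      have "((\<lambda>x :: real. of_int \<lfloor>2 * x\<rfloor> / x) \<longlongrightarrow> 2) at_top" by real_asymp
      moreover have "\<forall>\<^sub>F x in at_top. of_int \<lfloor>2 * x\<rfloor> / x = real (n x) / x"
        using eventually_ge_at_top[of 0] by eventually_elim (simp add: n_def)
      ultimately show ?thesis by (rule Lim_transform_eventually)
    qed
    have "((\<lambda>x. of_real ((\<Sum>a<n x. w (int a)) / real (n x)) * of_real (real (n x) / x) * \<Gamma>)
       \<longlongrightarrow> of_real \<rho> * of_real 2 * \<Gamma>) at_top"
      by (intro tendsto_intros filterlim_compose[OF dens n_top] n_ratio)
    moreover have "((\<lambda>x. U x / of_real x - of_real ((\<Sum>a<n x. w (int a)) / real (n x)) * of_real (real (n x) / x) * \<Gamma>) \<longlongrightarrow> 0) at_top"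
    proof (rule Lim_null_comparison)
      show "((\<lambda>x :: real. B / x) \<longlongrightarrow> 0) at_top" by real_asymp
      show "\<forall>\<^sub>F x in at_top. norm (U x / of_real x - of_real ((\<Sum>a<n x. w (int a)) / real (n x)) * of_real (real (n x) / x) * \<Gamma>) \<le> B / x"
        using eventually_ge_at_top[of "1 :: real"]
      proof eventually_elim
        case (elim x)
        then have nx: "real (n x) = of_int \<lfloor>2 * x\<rfloor>" by (simp add: n_def)
        have le: "real (n x) / 2 \<le> x" "x - real (n x) / 2 \<le> 1" "n x > 0"
          unfolding nx using elim by (auto simp: n_def) linarith+
        have "U x = of_real (\<Sum>a<n x. w (int a)) * \<Gamma> + J (real (n x) / 2) x"
          unfolding U_def J_N[symmetric] by (rule J_add) (use le in auto)
        then have "U x / of_real x - of_real ((\<Sum>a<n x. w (int a)) / real (n x)) * of_real (real (n x) / x) * \<Gamma>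
           = J (real (n x) / 2) x / of_real x"
          using le elim by (simp add: field_simps)
        also have "norm \<dots> \<le> B / x"
        proof -
          have "cmod (J (real (n x) / 2) x) \<le> B * (x - real (n x) / 2)" by (rule J_bound) (rule le)
          also have "\<dots> \<le> B" using le B0 by (intro mult_left_le) auto
          finally show ?thesis using elim by (simp add: norm_divide divide_right_mono)
        qed
        finally show ?case .
      qed
    qed
    ultimately have "((\<lambda>x. U x / of_real x) \<longlongrightarrow> of_real \<rho> * of_real 2 * \<Gamma>) at_top"
      using tendsto_add[of _ 0 at_top] by fastforce
    then show ?thesis by (simp add: mult_ac)
  qed
  \<comment> \<open>The mean over \<open>[T, 2 T]\<close> is twice the mean over
    \<open>[0, 2 T]\<close> minus the mean over \<open>[0, T]\<close>.\<close>
  have "((\<lambda>T. 2 * (U (2 * T) / of_real (2 * T)) - U T / of_real T) \<longlongrightarrow>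
      2 * (2 * of_real \<rho> * \<Gamma>) - 2 * of_real \<rho> * \<Gamma>) at_top"
    by (intro tendsto_intros U_lim filterlim_compose[OF U_lim] filterlim_tendsto_pos_mult_at_top[OF tendsto_const])
       (auto simp: filterlim_ident)
  moreover have "\<forall>\<^sub>F T in at_top. 2 * (U (2 * T) / of_real (2 * T)) - U T / of_real T =
     of_real (1 / T) * (LBINT t:{T..2 * T}. p t)"
    using eventually_gt_at_top[of 0]
  proof eventually_elim
    case (elim T)
    have "(LBINT t:{T..2 * T}. p t) = J T (2 * T)"
      unfolding J_def set_lebesgue_integral_def
    proof (rule integral_cong_AE)
      show "AE s in lborel. indicator {T..2 * T} s *\<^sub>R p s = indicator {T..<2 * T} s *\<^sub>R p s"
        using AE_lborel_singleton[of "2 * T"] by eventually_elim (auto simp: indicator_def)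
    qed (use pm in auto)
    also have "\<dots> = U (2 * T) - U T" unfolding U_def using J_add[of 0 T "2 * T"] elim by simp
    finally show ?case using elim by (simp add: field_simps)
  qed
  ultimately have "((\<lambda>T. of_real (1 / T) * (LBINT t:{T..2 * T}. p t)) \<longlongrightarrow>
      2 * (2 * of_real \<rho> * \<Gamma>) - 2 * of_real \<rho> * \<Gamma>) at_top"
    by (rule Lim_transform_eventually)
  then show ?thesis by (simp add: p_def \<Gamma>_def mult.assoc)
qed

lemma integrable_indicator_Icc: "integrable lborel (indicator {l..r} :: real \<Rightarrow> real)"
  by (cases "l \<le> r") (auto simp: integrable_indicator_iff)

lemma distinct_tuples_subset_Zn: "distinct_tuples n \<subseteq> Zn n"
  by (auto simp: distinct_tuples_def Zn_def)

lemma diagonal_shift_continuous: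
  fixes g :: "(nat \<Rightarrow> real) \<Rightarrow> 'b :: topological_space"
  assumes "continuous_on (Rn n) g"
  shows "continuous_on UNIV (\<lambda>s. g (\<lambda>i\<in>{..<n}. x i - s))"
proof (rule continuous_on_compose2[OF assms])
  show "continuous_on UNIV (\<lambda>s. \<lambda>i\<in>{..<n}. x i - s)"
  proof (rule continuous_on_coordinatewise_then_product)
    show "continuous_on UNIV (\<lambda>s. (\<lambda>i\<in>{..<n}. x i - s) i)" for i
      by (cases "i < n") (auto intro!: continuous_intros)
  qed
qed (simp add: Rn_def image_subset_iff del: restrict_apply)

text \<open>Tuples of points of \<open>A\<close> are renamed by their offsets \<open>k\<close> from
  \<open>a = \<lfloor>2 * t\<rfloor>\<close>. Whether the offsets occur depends only on
  \<open>a\<close>, the value of \<open>g\<close> there only on \<open>t - a / 2\<close>, so each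
  \<open>k\<close> is a case of \<open>cell_average_tendsto\<close>. The bound \<open>M k\<close> is
  uniform in \<open>t\<close>, which lets the limit pass through the sum.\<close>

theorem pattern_average_tendsto:
  assumes dens: "\<And>Y. finite Y \<Longrightarrow>
      (\<lambda>N. real (card {a \<in> {0..<int N}. (+) a ` Y \<subseteq> A}) / real N) \<longlonglongrightarrow> perm_det Y lattice_kernel"
    and e: "bij_betw e (UNIV :: int set) A"
    and dom: "dominated_Rn n C g"
  shows "((\<lambda>T. of_real (1 / T) * (LBINT t:{T..2 * T}.
            (\<Sum>\<^sub>\<infinity>j\<in>distinct_tuples n. g (\<lambda>i\<in>{..<n}. of_int (e (j i)) / 2 - t))))
     \<longlongrightarrow> (\<Sum>\<^sub>\<infinity>k\<in>distinct_tuples n. 2 * of_real (perm_det (k ` {..<n}) lattice_kernel) *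
           (LBINT s:{0..1/2}. g (\<lambda>i\<in>{..<n}. of_int (k i) / 2 - s)))) at_top"
proof -
  define DT where "DT = distinct_tuples n"
  define w :: "(nat \<Rightarrow> int) \<Rightarrow> int \<Rightarrow> real" where "w k a = of_bool (\<forall>i<n. k i + a \<in> A)" for k a
  define \<gamma> where "\<gamma> k s = g (\<lambda>i\<in>{..<n}. of_int (k i) / 2 - s)" for k :: "nat \<Rightarrow> int" and s :: real
  define P where "P k t = of_real (w k \<lfloor>2 * t\<rfloor>) * \<gamma> k (t - of_int \<lfloor>2 * t\<rfloor> / 2)" for k and t :: real
  define M where "M k = C * (\<Prod>i<n. 8 / (1 + (real_of_int (k i))\<^sup>2))" for k
  have DT_Zn: "DT \<subseteq> Zn n" unfolding DT_def by (rule distinct_tuples_subset_Zn)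
  have M: "M summable_on DT"
    unfolding M_def by (rule summable_on_subset_banach[OF summable_on_Zn_weight DT_Zn])
  have countable: "countable DT" using countable_Zn DT_Zn by (rule countable_subset[rotated])
  have gcont: "continuous_on (Rn n) g" using dom by (simp add: dominated_Rn_def)
  have \<gamma>cont: "continuous_on UNIV (\<gamma> k)" for k
    unfolding \<gamma>_def by (rule diagonal_shift_continuous[OF gcont])
  have PM: "cmod (P k t) \<le> M k" for k t
  proof -
    define s where "s = t - of_int \<lfloor>2 * t\<rfloor> / 2"
    have s: "\<bar>- s\<bar> \<le> 1 / 2" unfolding s_def by linarith
    have "\<gamma> k s = g (\<lambda>i\<in>{..<n}. - s + of_int (k i) / 2)"
      unfolding \<gamma>_def by (rule arg_cong[where f=g]) auto
    moreover have "cmod (g (\<lambda>i\<in>{..<n}. - s + of_int (k i) / 2)) \<le> M k"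
      unfolding M_def by (rule dominated_Rn_lattice_shift[OF dom s])
    ultimately have "cmod (\<gamma> k s) \<le> M k" by simp
    moreover have "cmod (P k t) \<le> cmod (\<gamma> k s)"
      unfolding P_def s_def[symmetric] by (simp add: w_def)
    ultimately show ?thesis by linarith
  qed
  have M0: "M k \<ge> 0" for k using PM[of k 0] by (rule order_trans[OF norm_ge_zero])
  have Pm: "P k \<in> borel_measurable borel" for k
    unfolding P_def by (rule floor_cell_measurable[OF \<gamma>cont])
  have sum_eq: "(\<Sum>\<^sub>\<infinity>j\<in>distinct_tuples n. g (\<lambda>i\<in>{..<n}. of_int (e (j i)) / 2 - t)) = (\<Sum>\<^sub>\<infinity>k\<in>DT. P k t)" for t
  proof -
    define a where "a = \<lfloor>2 * t\<rfloor>"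
    define B where "B = {k \<in> DT. \<forall>i<n. k i + a \<in> A}"
    define F where "F j = (\<lambda>i\<in>{..<n}. e (j i) - a)" for j :: "nat \<Rightarrow> int"
    define F' where "F' k = (\<lambda>i\<in>{..<n}. inv_into UNIV e (k i + a))" for k :: "nat \<Rightarrow> int"
    have inj: "inj e" and im: "range e = A" using e by (auto simp: bij_betw_def)
    have ie: "e (inv_into UNIV e x) = x" if "x \<in> A" for x using that im by (auto intro: f_inv_into_f)
    have bij: "bij_betw F DT B"
    proof (rule bij_betw_byWitness[where f' = F'])
      show "\<forall>j\<in>DT. F' (F j) = j"
        using inj by (auto simp: DT_def distinct_tuples_def F_def F'_def PiE_iff extensional_def fun_eq_iff)
      show "\<forall>k\<in>B. F (F' k) = k"
        using ie by (auto simp: B_def DT_def distinct_tuples_def F_def F'_def PiE_iff extensional_def fun_eq_iff)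
      show "F ` DT \<subseteq> B"
        using inj im by (auto simp: B_def DT_def distinct_tuples_def F_def inj_on_def)
      show "F' ` B \<subseteq> DT"
      proof
        fix j assume "j \<in> F' ` B"
        then obtain k where k: "k \<in> B" "j = F' k" by blast
        have "inj_on j {..<n}"
        proof (rule inj_onI)
          fix x y assume xy: "x \<in> {..<n}" "y \<in> {..<n}" "j x = j y"
          then have "e (inv_into UNIV e (k x + a)) = e (inv_into UNIV e (k y + a))" by (simp add: k F'_def)
          then have "k x = k y" using k xy by (simp add: B_def ie)
          then show "x = y" using k xy by (auto simp: B_def DT_def distinct_tuples_def inj_on_def)
        qed
        then show "j \<in> DT" by (simp add: DT_def distinct_tuples_def k F'_def)
      qed
    qed
    have "(\<Sum>\<^sub>\<infinity>j\<in>DT. g (\<lambda>i\<in>{..<n}. of_int (e (j i)) / 2 - t)) = (\<Sum>\<^sub>\<infinity>j\<in>DT. \<gamma> (F j) (t - of_int a / 2))"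
      unfolding \<gamma>_def by (intro infsum_cong arg_cong[where f=g]) (auto simp: F_def diff_divide_distrib)
    also have "\<dots> = (\<Sum>\<^sub>\<infinity>k\<in>B. \<gamma> k (t - of_int a / 2))"
      by (rule infsum_reindex_bij_betw[OF bij])
    also have "\<dots> = (\<Sum>\<^sub>\<infinity>k\<in>DT. P k t)"
      by (rule infsum_cong_neutral) (auto simp: B_def P_def w_def a_def)
    finally show ?thesis by (simp add: DT_def)
  qed
  have integrable_indicator_Iccnt: "(LINT t|lborel. M k * indicator {T..2 * T} t) = M k * T" if "T \<ge> 0" for k and T :: real
    using that by simp
  have bd: "norm (indicator {T..2 * T} t *\<^sub>R P k t) \<le> M k * indicator {T..2 * T} t" for T k and t :: real
    using PM[of k t] by (auto simp: indicator_def)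
  have Pi: "integrable lborel (\<lambda>t. indicator {T..2 * T} t *\<^sub>R P k t)" for k and T :: real
  proof (rule Bochner_Integration.integrable_bound)
    show "integrable lborel (\<lambda>t. M k * indicator {T..2 * T} t)" by (intro integrable_mult_right integrable_indicator_Icc)
    show "AE t in lborel. norm (indicator {T..2 * T} t *\<^sub>R P k t) \<le> norm (M k * indicator {T..2 * T} t)"
      using bd by (intro AE_I2) (auto intro: order_trans[OF _ abs_ge_self])
  qed (use Pm in simp)
  have Pint: "(LINT t|lborel. norm (indicator {T..2 * T} t *\<^sub>R P k t)) \<le> M k * T" if "T \<ge> 0" for k and T :: real
    unfolding integrable_indicator_Iccnt[OF that, symmetric]
    by (intro integral_mono integrable_norm Pi integrable_mult_right integrable_indicator_Icc bd)
  have swap: "(LBINT t:{T..2 * T}. (\<Sum>\<^sub>\<infinity>k\<in>DT. P k t)) = (\<Sum>\<^sub>\<infinity>k\<in>DT. LBINT t:{T..2 * T}. P k t)" if "T \<ge> 0" for T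
  proof -
    have "(LBINT t:{T..2 * T}. (\<Sum>\<^sub>\<infinity>k\<in>DT. P k t)) = (LINT t|lborel. (\<Sum>\<^sub>\<infinity>k\<in>DT. indicator {T..2 * T} t *\<^sub>R P k t))"
      unfolding set_lebesgue_integral_def
    proof (rule Bochner_Integration.integral_cong[OF refl])
      fix t :: real
      show "indicator {T..2 * T} t *\<^sub>R (\<Sum>\<^sub>\<infinity>k\<in>DT. P k t) = (\<Sum>\<^sub>\<infinity>k\<in>DT. indicator {T..2 * T} t *\<^sub>R P k t)"
        by (cases "t \<in> {T..2 * T}") auto
    qed
    also have "\<dots> = (\<Sum>\<^sub>\<infinity>k\<in>DT. LINT t|lborel. indicator {T..2 * T} t *\<^sub>R P k t)"
    proof (rule integral_infsum(2)[OF countable Pi])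
      show "(\<lambda>k. LINT t|lborel. norm (indicator {T..2 * T} t *\<^sub>R P k t)) summable_on DT"
        by (rule summable_on_comparison_test[OF summable_on_cmult_left[OF M, of T]])
          (use Pint[OF that] in auto)
      show "(\<lambda>k. norm (indicator {T..2 * T} t *\<^sub>R P k t)) summable_on DT" for t
        by (rule summable_on_comparison_test[OF M]) (use PM M0 in \<open>auto simp: indicator_def\<close>)
    qed
    finally show ?thesis by (simp add: set_lebesgue_integral_def)
  qed
  have lim: "((\<lambda>T. of_real (1 / T) * (LBINT t:{T..2 * T}. P k t)) \<longlongrightarrow>
      2 * of_real (perm_det (k ` {..<n}) lattice_kernel) * (LBINT s:{0..1/2}. \<gamma> k s)) at_top" for k
    unfolding P_def
  proof (rule cell_average_tendsto[OF _ \<gamma>cont])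
    show "\<bar>w k a\<bar> \<le> 1" for a by (simp add: w_def)
    have "(\<Sum>a<N. w k (int a)) = real (card {a \<in> {0..<int N}. (+) a ` (k ` {..<n}) \<subseteq> A})" for N
    proof -
      have "(\<Sum>a<N. w k (int a)) = (\<Sum>a\<in>{0..<int N}. w k a)"
        by (rule sum.reindex_bij_witness[of _ nat int]) auto
      also have "\<dots> = real (card {a \<in> {0..<int N}. \<forall>i<n. k i + a \<in> A})"
        unfolding w_def by (subst of_bool_def[abs_def]) (simp add: sum.If_cases Int_def)
      also have "{a \<in> {0..<int N}. \<forall>i<n. k i + a \<in> A} = {a \<in> {0..<int N}. (+) a ` (k ` {..<n}) \<subseteq> A}"
        by (auto simp: add.commute)
      finally show ?thesis .
    qed
    then show "(\<lambda>N. (\<Sum>a<N. w k (int a)) / real N) \<longlonglongrightarrow> perm_det (k ` {..<n}) lattice_kernel"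
      using dens[of "k ` {..<n}"] by simp
  qed
  have "((\<lambda>T. \<Sum>\<^sub>\<infinity>k\<in>DT. of_real (1 / T) * (LBINT t:{T..2 * T}. P k t)) \<longlongrightarrow>
     (\<Sum>\<^sub>\<infinity>k\<in>DT. 2 * of_real (perm_det (k ` {..<n}) lattice_kernel) * (LBINT s:{0..1/2}. \<gamma> k s))) at_top"
  proof (rule tendsto_infsum_dominated[OF lim _ M])
    show "\<forall>\<^sub>F T in at_top. \<forall>k\<in>DT. norm (of_real (1 / T) * (LBINT t:{T..2 * T}. P k t)) \<le> M k"
      using eventually_gt_at_top[of 0]
    proof eventually_elim
      case (elim T)
      have "norm (LBINT t:{T..2 * T}. P k t) \<le> M k * T" for k
        unfolding set_lebesgue_integral_def
        by (rule order_trans[OF integral_norm_bound Pint]) (use elim in simp)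
      then show ?case using elim by (auto simp: norm_mult norm_divide field_simps)
    qed
  qed auto
  moreover have "\<forall>\<^sub>F T in at_top. (\<Sum>\<^sub>\<infinity>k\<in>DT. of_real (1 / T) * (LBINT t:{T..2 * T}. P k t)) =
    of_real (1 / T) * (LBINT t:{T..2 * T}. (\<Sum>\<^sub>\<infinity>j\<in>distinct_tuples n. g (\<lambda>i\<in>{..<n}. of_int (e (j i)) / 2 - t)))"
    using eventually_ge_at_top[of 0]
    by eventually_elim (simp only: sum_eq swap infsum_cmult_right')
  ultimately show ?thesis
    unfolding \<gamma>_def DT_def by (rule Lim_transform_eventually)
qed

section \<open>The sine kernel determinant\<close>

lemma sine_kernel_sinc: "sine_kernel x = sinc (pi * x)"
  by (simp add: sine_kernel_def)

lemma sine_kernel_continuous [continuous_intros]: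
  "continuous_on S f \<Longrightarrow> continuous_on S (\<lambda>x. sine_kernel (f x))"
  unfolding sine_kernel_sinc by (intro continuous_intros)

lemma abs_sine_kernel_le: "\<bar>sine_kernel x\<bar> \<le> 1"
  using abs_sin_x_le_abs_x[of "pi * x"] by (auto simp: sine_kernel_def abs_mult divide_le_eq_1)

lemma sine_kernel_fourier:
  "of_real (sine_kernel x) = (LINT y|lborel. indicator {- (1/2)..1/2} y *\<^sub>R exp (\<i> * of_real (2 * pi * x * y)))"
proof (cases "x = 0")
  case True
  then show ?thesis by (simp add: sine_kernel_def scaleR_conv_of_real)
next
  case False
  have "(LINT y|lborel. indicator {- (1/2)..1/2} y *\<^sub>R exp (\<i> * of_real (2 * pi * x * y))) =
     (exp (\<i> * of_real (2 * pi * x * (1/2))) - exp (\<i> * of_real (2 * pi * x * - (1/2)))) / (\<i> * of_real (2 * pi * x))"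
    by (rule integral_exp_interval) (use False in auto)
  also have "\<dots> = (exp (\<i> * of_real (pi * x)) - exp (- (\<i> * of_real (pi * x)))) / (2 * \<i>) / of_real (pi * x)"
    by (simp add: field_simps)
  also have "(exp (\<i> * of_real (pi * x)) - exp (- (\<i> * of_real (pi * x)))) / (2 * \<i>) = sin (of_real (pi * x))"
    unfolding sin_exp_eq by simp
  also have "\<dots> / of_real (pi * x) = of_real (sine_kernel x)"
    using False by (simp add: sine_kernel_def sin_of_real[symmetric] del: of_real_mult) 
  finally show ?thesis ..
qed

definition sine_det :: "nat \<Rightarrow> (nat \<Rightarrow> real) \<Rightarrow> real" where
  "sine_det n x = perm_det {..<n} (\<lambda>i j. sine_kernel (x i - x j))"

lemma sine_det_continuous: "continuous_on S (sine_det n)"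
  unfolding sine_det_def perm_det_def
  by (intro continuous_intros continuous_on_subset[OF continuous_on_product_coordinates]) auto

lemma abs_sine_det_le: "\<bar>sine_det n x\<bar> \<le> fact n"
proof -
  have "\<bar>sine_det n x\<bar> \<le> (\<Sum>\<sigma> | \<sigma> permutes {..<n}. \<bar>of_int (sign \<sigma>) * (\<Prod>i<n. sine_kernel (x i - x (\<sigma> i)))\<bar>)"
    unfolding sine_det_def perm_det_def by (rule sum_abs)
  also have "\<dots> \<le> (\<Sum>\<sigma> | \<sigma> permutes {..<n}. 1)"
  proof (rule sum_mono)
    fix \<sigma> :: "nat \<Rightarrow> nat"
    have "\<bar>of_int (sign \<sigma>) :: real\<bar> = 1" by (metis abs_sign of_int_1 of_int_abs)
    moreover have "(\<Prod>i<n. \<bar>sine_kernel (x i - x (\<sigma> i))\<bar>) \<le> 1"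
      by (intro prod_le_1) (auto simp: abs_sine_kernel_le)
    ultimately show "\<bar>of_int (sign \<sigma>) * (\<Prod>i<n. sine_kernel (x i - x (\<sigma> i)))\<bar> \<le> 1"
      by (simp add: abs_mult abs_prod)
  qed
  also have "\<dots> = fact n" by (simp add: card_permutations[of "{..<n}" n])
  finally show ?thesis .
qed

lemma sine_det_shift: "sine_det n (\<lambda>i\<in>{..<n}. x i + s) = sine_det n x"
  unfolding sine_det_def by (rule perm_det_cong) simp

text \<open>Injectivity of \<open>k\<close> lets the minor be indexed by the set of sites, and each
  of the \<open>n\<close> rows contributes a 2 against the density \<open>1 / 2\<close> in
  \<open>lattice_kernel\<close>.\<close>

lemma sine_det_lattice:
  assumes "k \<in> distinct_tuples n"
  shows "sine_det n (\<lambda>i\<in>{..<n}. of_int (k i) / 2) = 2 ^ n * perm_det (k ` {..<n}) lattice_kernel"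
proof -
  have bij: "bij_betw k {..<n} (k ` {..<n})"
    using assms by (simp add: bij_betw_def distinct_tuples_def)
  have "perm_det (k ` {..<n}) lattice_kernel = perm_det {..<n} (\<lambda>i j. lattice_kernel (k i) (k j))"
    by (rule perm_det_reindex[OF bij]) simp
  moreover have "sine_det n (\<lambda>i\<in>{..<n}. of_int (k i) / 2) = perm_det {..<n} (\<lambda>i j. 2 * lattice_kernel (k i) (k j))"
    unfolding sine_det_def by (rule perm_det_cong) (simp add: lattice_kernel_def diff_divide_distrib)
  moreover have "perm_det {..<n} (\<lambda>i j. 2 * lattice_kernel (k i) (k j)) = 2 ^ n * perm_det {..<n} (\<lambda>i j. lattice_kernel (k i) (k j))"
    unfolding perm_det_def sum_distrib_left by (intro sum.cong refl) (simp add: prod.distrib)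
  ultimately show ?thesis by simp
qed

text \<open>This admits tuples with repetitions into the sum over distinct ones, which thereby
  becomes a sum over the full lattice, as Poisson summation requires.\<close>

lemma sine_det_coincident:
  assumes "i < n" "j < n" "i \<noteq> j" "x i = x j"
  shows "sine_det n x = 0"
  unfolding sine_det_def det_mat_eq_perm_det[symmetric]
  by (rule det_identical_rows[of _ n i j]) (use assms in \<open>auto simp: row_def\<close>)

text \<open>In the term of \<open>\<sigma>\<close>, with \<open>y i\<close> the spectral variable of
  the factor in row \<open>i\<close>, the frequency is shifted by
  \<open>y i - y (inv \<sigma> i)\<close>. These entries sum to 0, since \<open>\<sigma>\<close>
  only permutes the \<open>y i\<close>, and have modulus at most 1. The integrals may be
  interchanged because every \<open>y i\<close> is confined to a bounded interval.\<close>

lemma fourier_sine_det_vanishes: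
  assumes dom: "dominated_Rn n C g"
    and van: "\<And>\<xi>. \<xi> \<in> Rn n \<Longrightarrow> (\<Sum>i<n. \<xi> i) = 0 \<Longrightarrow> (\<Sum>i<n. \<bar>\<xi> i\<bar>) \<ge> 2 \<Longrightarrow> fourier_Rn n g \<xi> = 0"
    and m0: "(\<Sum>i<n. m i) = 0" and mne: "\<exists>i<n. m i \<noteq> 0"
  shows "(LINT x|lborel_Rn n. g x * of_real (sine_det n x) * lattice_char n m x) = 0"
proof -
  let ?M = "lborel_Rn n"
  interpret product_sigma_finite "\<lambda>i :: nat. lborel :: real measure" by standard
  interpret M: sigma_finite_measure ?M by (rule sigma_finite_lborel_Rn)
  interpret P: pair_sigma_finite ?M ?M ..
  have gi: "integrable ?M g" by (rule dominated_Rn_integrable[OF dom])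
  have gm: "g \<in> borel_measurable ?M" using gi by simp
  have cm: "lattice_char n m \<in> borel_measurable ?M"
    by (rule borel_measurable_continuous_Rn[OF lattice_char_continuous])
  have term0: "integrable ?M (\<lambda>x. g x * of_real (\<Prod>i<n. sine_kernel (x i - x (\<sigma> i))) * lattice_char n m x) \<and>
     (LINT x|?M. g x * of_real (\<Prod>i<n. sine_kernel (x i - x (\<sigma> i))) * lattice_char n m x) = 0"
    if \<sigma>: "\<sigma> permutes {..<n}" for \<sigma>
  proof
    define f where "f a y = indicator {- (1/2)..1/2} y *\<^sub>R exp (\<i> * of_real (2 * pi * a * y))" for a y :: real
    have fi: "integrable lborel (f a)" for a unfolding f_def by (rule integrable_exp_interval)
    have f_int: "(LINT y|lborel. f a y) = of_real (sine_kernel a)" for a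
      unfolding f_def by (rule sine_kernel_fourier[symmetric])
    define \<Phi> where "\<Phi> x y = g x * lattice_char n m x * (\<Prod>i<n. f (x i - x (\<sigma> i)) (y i))" for x y
    have prod_int: "integrable ?M (\<lambda>y. \<Prod>i<n. f (a i) (y i))" for a
      unfolding lborel_Rn_def by (rule product_integrable_prod) (auto intro: fi)
    have inner_y: "(LINT y|?M. \<Phi> x y) = g x * of_real (\<Prod>i<n. sine_kernel (x i - x (\<sigma> i))) * lattice_char n m x" for x
    proof -
      have "(LINT y|?M. (\<Prod>i<n. f (x i - x (\<sigma> i)) (y i))) = (\<Prod>i<n. of_real (sine_kernel (x i - x (\<sigma> i))))"
        unfolding lborel_Rn_def by (subst product_integral_prod) (auto simp: fi f_int)
      then show ?thesis unfolding \<Phi>_def by simp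
    qed
    have norm_f: "norm (f a y) = indicator {- (1/2)..1/2} y" for a y
      by (simp add: f_def norm_exp_eq_Re)
    define K where "K = (LINT y|?M. (\<Prod>i<n. indicator {- (1/2)..1/2 :: real} (y i) :: real))"
    have norm_\<Phi>: "norm (\<Phi> x y) = norm (g x) * (\<Prod>i<n. indicator {- (1/2)..1/2 :: real} (y i))" for x y
      by (simp add: \<Phi>_def norm_mult prod_norm[symmetric] norm_f)
    have comp1: "(\<lambda>p. fst p i) \<in> borel_measurable (?M \<Otimes>\<^sub>M ?M)" for i
      by (rule measurable_compose[OF measurable_fst component_borel_measurable_Rn])
    have comp2: "(\<lambda>p. snd p i) \<in> borel_measurable (?M \<Otimes>\<^sub>M ?M)" for i
      by (rule measurable_compose[OF measurable_snd component_borel_measurable_Rn])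
    have f_meas: "(\<lambda>p. f (fst p i - fst p j) (snd p i)) \<in> borel_measurable (?M \<Otimes>\<^sub>M ?M)" for i j
    proof -
      have "(\<lambda>p. indicator {- (1/2)..1/2} (snd p i) :: real) \<in> borel_measurable (?M \<Otimes>\<^sub>M ?M)"
        by (rule measurable_compose[OF comp2]) simp
      moreover have "(\<lambda>p. 2 * pi * (fst p i - fst p j) * snd p i) \<in> borel_measurable (?M \<Otimes>\<^sub>M ?M)"
        by (intro borel_measurable_times borel_measurable_diff borel_measurable_const comp1 comp2)
      then have "(\<lambda>p. exp (\<i> * of_real (2 * pi * (fst p i - fst p j) * snd p i))) \<in> borel_measurable (?M \<Otimes>\<^sub>M ?M)"
        by (rule measurable_compose) (auto intro!: borel_measurable_continuous_onI continuous_intros)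
      ultimately show ?thesis unfolding f_def by (rule borel_measurable_scaleR)
    qed
    have \<Phi>m: "(\<lambda>p. \<Phi> (fst p) (snd p)) \<in> borel_measurable (?M \<Otimes>\<^sub>M ?M)"
      unfolding \<Phi>_def
      by (intro borel_measurable_times borel_measurable_prod f_meas
          measurable_compose[OF measurable_fst gm] measurable_compose[OF measurable_fst cm])
    have \<Phi>i: "integrable (?M \<Otimes>\<^sub>M ?M) (case_prod \<Phi>)"
    proof (rule P.Fubini_integrable)
      show "case_prod \<Phi> \<in> borel_measurable (?M \<Otimes>\<^sub>M ?M)" using \<Phi>m by (simp add: case_prod_unfold)
      show "integrable ?M (\<lambda>x. LINT y|?M. norm (case_prod \<Phi> (x, y)))"
        unfolding prod.case norm_\<Phi> using gi by simp
      show "AE x in ?M. integrable ?M (\<lambda>y. case_prod \<Phi> (x, y))"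
        unfolding prod.case \<Phi>_def by (intro AE_I2 integrable_mult_right prod_int)
    qed
    show "integrable ?M (\<lambda>x. g x * of_real (\<Prod>i<n. sine_kernel (x i - x (\<sigma> i))) * lattice_char n m x)"
      using P.integrable_fst[OF \<Phi>i] by (simp only: inner_y)
    have "(LINT x|?M. g x * of_real (\<Prod>i<n. sine_kernel (x i - x (\<sigma> i))) * lattice_char n m x) =
       (LINT x|?M. LINT y|?M. \<Phi> x y)" by (simp only: inner_y)
    also have "\<dots> = (LINT y|?M. LINT x|?M. \<Phi> x y)"
      by (rule P.Fubini_integral[OF \<Phi>i, symmetric])
    also have "\<dots> = (LINT y|?M. 0)"
    proof (rule Bochner_Integration.integral_cong[OF refl])
      fix y
      show "(LINT x|?M. \<Phi> x y) = 0"
      proof (cases "\<forall>i<n. y i \<in> {- (1/2)..1/2}")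
        case False
        then obtain i where "i < n" "y i \<notin> {- (1/2)..1/2}" by blast
        then have "(\<Prod>i<n. f (x i - x (\<sigma> i)) (y i)) = 0" for x
          by (intro prod_zero) (auto simp: f_def intro!: bexI[of _ i])
        then have "\<Phi> x y = 0" for x by (simp add: \<Phi>_def)
        then show ?thesis by simp
      next
        case True
        define \<xi> where "\<xi> = (\<lambda>i\<in>{..<n}. 2 * of_int (m i) - (y i - y (inv_into UNIV \<sigma> i)))"
        have \<sigma>': "inv_into UNIV \<sigma> permutes {..<n}" using \<sigma> by (rule permutes_inv)
        \<comment> \<open>This moves the permutation from \<open>x\<close> to \<open>y\<close>, so
          that each \<open>x i\<close> appears in the exponent with a single coefficient.\<close>
        have re: "(\<Sum>i<n. h (\<sigma> i) i) = (\<Sum>i<n. h i (inv_into UNIV \<sigma> i))" for h :: "nat \<Rightarrow> nat \<Rightarrow> real"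
        proof -
          have "(\<Sum>i<n. h i (inv_into UNIV \<sigma> i)) = (\<Sum>i<n. h (\<sigma> i) (inv_into UNIV \<sigma> (\<sigma> i)))"
            by (rule sum.permute[OF \<sigma>, unfolded o_def])
          then show ?thesis using permutes_inverses(2)[OF \<sigma>] by simp
        qed
        have "\<Phi> x y = g x * exp (- 2 * of_real pi * \<i> * of_real (\<Sum>i<n. x i * \<xi> i))" for x
        proof -
          have "(\<Prod>i<n. f (x i - x (\<sigma> i)) (y i)) = (\<Prod>i<n. exp (\<i> * of_real (2 * pi * (x i - x (\<sigma> i)) * y i)))"
            using True by (intro prod.cong) (auto simp: f_def)
          also have "\<dots> = exp (\<i> * of_real (2 * pi * (\<Sum>i<n. (x i - x (\<sigma> i)) * y i)))"
            by (subst exp_sum[symmetric]) (auto simp: sum_distrib_left mult.assoc)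
          also have "(\<Sum>i<n. (x i - x (\<sigma> i)) * y i) = (\<Sum>i<n. x i * (y i - y (inv_into UNIV \<sigma> i)))"
            using re[of "\<lambda>a b. x a * y b"] by (simp add: algebra_simps sum_subtractf)
          finally have "\<Phi> x y = g x * (lattice_char n m x * exp (\<i> * of_real (2 * pi * (\<Sum>i<n. x i * (y i - y (inv_into UNIV \<sigma> i))))))"
            by (simp add: \<Phi>_def)
          also have "lattice_char n m x * exp (\<i> * of_real (2 * pi * (\<Sum>i<n. x i * (y i - y (inv_into UNIV \<sigma> i))))) =
             exp (- 2 * of_real pi * \<i> * of_real (\<Sum>i<n. x i * \<xi> i))"
          proof -
            have "(\<Sum>i<n. x i * \<xi> i) = (\<Sum>i<n. x i * (2 * of_int (m i))) - (\<Sum>i<n. x i * (y i - y (inv_into UNIV \<sigma> i)))"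
              by (simp add: \<xi>_def right_diff_distrib sum_subtractf)
            moreover have "- 2 * of_real pi * \<i> * of_real a + \<i> * of_real (2 * pi * b) =
               - 2 * of_real pi * \<i> * of_real (a - b)" for a b :: real
              by (simp add: algebra_simps)
            ultimately show ?thesis unfolding lattice_char_def exp_add[symmetric] by (simp only:)
          qed
          finally show ?thesis .
        qed
        then have "(LINT x|?M. \<Phi> x y) = fourier_Rn n g \<xi>"
          by (simp add: fourier_Rn_def)
        also have "\<dots> = 0"
        proof (rule van)
          show "\<xi> \<in> Rn n" by (simp add: \<xi>_def Rn_def)
          have "(\<Sum>i<n. y (inv_into UNIV \<sigma> i)) = (\<Sum>i<n. y i)"
            using sum.permute[OF \<sigma>', of y] by (simp add: o_def)
          moreover have "(\<Sum>i<n. real_of_int (m i)) = 0" using m0 by (simp flip: of_int_sum)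
          ultimately show "(\<Sum>i<n. \<xi> i) = 0"
            by (simp add: \<xi>_def sum_subtractf sum_distrib_left[symmetric])
          have a: "\<bar>y i - y (inv_into UNIV \<sigma> i)\<bar> \<le> 1" if "i < n" for i
          proof -
            have "inv_into UNIV \<sigma> i < n" using permutes_in_image[OF \<sigma>', of i] that by simp
            then have "y i \<in> {- (1/2)..1/2}" "y (inv_into UNIV \<sigma> i) \<in> {- (1/2)..1/2}" using True that by auto
            then show ?thesis by auto
          qed
          obtain i where i: "i < n" "m i > 0"
          proof -
            have "\<exists>i<n. m i > 0"
            proof (rule ccontr)
              assume "\<not> ?thesis"
              then have "\<forall>i\<in>{..<n}. 0 \<le> - m i" by force
              moreover have "(\<Sum>i<n. - m i) = 0" using m0 by (simp add: sum_negf)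
              ultimately show False using mne by (subst (asm) sum_nonneg_eq_0_iff) auto
            qed
            then show ?thesis using that by blast
          qed
          obtain j where j: "j < n" "m j < 0"
          proof -
            have "\<exists>i<n. m i < 0"
            proof (rule ccontr)
              assume "\<not> ?thesis"
              then have "\<forall>i\<in>{..<n}. 0 \<le> m i" by force
              then show False using mne m0 by (subst (asm) sum_nonneg_eq_0_iff) auto
            qed
            then show ?thesis using that by blast
          qed
          \<comment> \<open>\<open>2 * m i\<close> is at least 2 and the shift takes away at most 1;
            symmetrically for \<open>j\<close>. These two coordinates alone give norm 2.\<close>
          have "real_of_int (m i) \<ge> 1" "real_of_int (m j) \<le> - 1" using i j by auto
          then have "\<xi> i \<ge> 1" "\<xi> j \<le> - 1" using a[of i] a[of j] i j by (auto simp: \<xi>_def)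
          then have "2 \<le> (\<Sum>l\<in>{i, j}. \<bar>\<xi> l\<bar>)" using i j by (cases "i = j") auto
          also have "\<dots> \<le> (\<Sum>l<n. \<bar>\<xi> l\<bar>)" using i j by (intro sum_mono2) auto
          finally show "(\<Sum>i<n. \<bar>\<xi> i\<bar>) \<ge> 2" .
        qed
        finally show ?thesis .
      qed
    qed
    finally show "(LINT x|?M. g x * of_real (\<Prod>i<n. sine_kernel (x i - x (\<sigma> i))) * lattice_char n m x) = 0" by simp
  qed
  have eq: "g x * of_real (sine_det n x) * lattice_char n m x = (\<Sum>\<sigma> | \<sigma> permutes {..<n}.
      of_int (sign \<sigma>) * (g x * of_real (\<Prod>i<n. sine_kernel (x i - x (\<sigma> i))) * lattice_char n m x))" for x
    unfolding sine_det_def perm_det_def of_real_sum sum_distrib_left sum_distrib_right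
    by (intro sum.cong) (auto simp: mult_ac)
  show ?thesis
    unfolding eq using term0
    by (subst Bochner_Integration.integral_sum) (auto intro!: integrable_mult_right sum.neutral simp del: of_real_prod)
qed

text \<open>Averaging over the diagonal removes the frequencies \<open>2 m\<close> with \<open>\<Sum> m\<^sub>i \<noteq> 0\<close>.\<close>

definition diag_average :: "nat \<Rightarrow> ((nat \<Rightarrow> real) \<Rightarrow> complex) \<Rightarrow> (nat \<Rightarrow> real) \<Rightarrow> complex" where
  "diag_average n F x = (LBINT s:{0..1/2}. F (\<lambda>i\<in>{..<n}. x i - s))"

text \<open>\<open>2 (x - s)^2 = (x - 2 s)^2 + x^2 - 2 s^2\<close>, and
  \<open>2 s^2 \<le> 1 / 2\<close>.\<close>

lemma weight_diagonal_shift: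
  fixes x s :: real
  assumes "\<bar>s\<bar> \<le> 1 / 2"
  shows "1 / (1 + (x - s)\<^sup>2) \<le> 2 * (1 / (1 + x\<^sup>2))"
proof -
  have "s\<^sup>2 \<le> (1/2)\<^sup>2" using assms by (intro power2_le_iff_abs_le[THEN iffD2]) auto
  moreover have "0 \<le> (x - 2 * s)\<^sup>2" by simp
  ultimately have "1 + x\<^sup>2 \<le> 2 * (1 + (x - s)\<^sup>2)"
    by (simp add: power2_eq_square algebra_simps)
  moreover have "1 / X \<le> 2 * (1 / Y)" if "Y \<le> 2 * X" "0 < X" "0 < Y" for X Y :: real
    using that by (simp add: field_simps)
  ultimately show ?thesis by (simp add: add_pos_nonneg)
qed

lemma diag_average_dominated:
  assumes dom: "dominated_Rn n C F"
  shows "dominated_Rn n (C * 2 ^ n) (diag_average n F)"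
proof -
  have Fcont: "continuous_on (Rn n) F" using dom by (simp add: dominated_Rn_def)
  have C0: "C \<ge> 0" by (rule dominated_Rn_nonneg[OF dom])
  have scont: "continuous_on S (\<lambda>s. F (\<lambda>i\<in>{..<n}. x i - s))" for S x
    by (rule continuous_on_subset[OF diagonal_shift_continuous[OF Fcont]]) simp
  have si: "set_integrable lborel {0..1/2} (\<lambda>s. F (\<lambda>i\<in>{..<n}. x i - s))" for x
    unfolding set_integrable_def by (rule borel_integrable_compact) (auto intro: scont)
  have eq: "diag_average n F x = integral (cbox 0 (1/2)) (\<lambda>s. F (\<lambda>i\<in>{..<n}. x i - s))" for x
    unfolding diag_average_def using set_borel_integral_eq_integral(2)[OF si] by simp
  have "continuous_on (Rn n) (\<lambda>x. integral (cbox 0 (1/2)) (\<lambda>s. F (\<lambda>i\<in>{..<n}. x i - s)))"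
  proof (rule integral_continuous_on_param)
    have "continuous_on (Rn n \<times> cbox 0 (1/2)) (\<lambda>p. F (\<lambda>i\<in>{..<n}. fst p i - snd p))"
    proof (rule continuous_on_compose2[OF Fcont])
      show "continuous_on (Rn n \<times> cbox 0 (1/2)) (\<lambda>p. \<lambda>i\<in>{..<n}. fst p i - snd p)"
      proof (rule continuous_on_coordinatewise_then_product)
        fix i
        have "continuous_on (Rn n \<times> cbox 0 (1/2)) (\<lambda>p :: (nat \<Rightarrow> real) \<times> real. fst p i)"
          by (rule continuous_on_compose2[OF continuous_on_product_coordinates continuous_on_fst[OF continuous_on_id]]) simp
        then show "continuous_on (Rn n \<times> cbox 0 (1/2)) (\<lambda>p. (\<lambda>i\<in>{..<n}. fst p i - snd p) i)"
          by (cases "i < n") (auto intro!: continuous_intros)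
      qed
    qed (simp add: Rn_def image_subset_iff del: restrict_apply)
    then show "continuous_on (Rn n \<times> cbox 0 (1/2)) (\<lambda>(x, s). F (\<lambda>i\<in>{..<n}. x i - s))"
      by (simp add: case_prod_unfold)
  qed
  then have cont: "continuous_on (Rn n) (diag_average n F)" unfolding eq[abs_def] .
  have "cmod (diag_average n F x) \<le> C * 2 ^ n * (\<Prod>i<n. 1 / (1 + (x i)\<^sup>2))" for x
  proof -
    define w where "w = C * 2 ^ n * (\<Prod>i<n. 1 / (1 + (x i)\<^sup>2))"
    have w0: "w \<ge> 0" unfolding w_def using C0 by (intro mult_nonneg_nonneg prod_nonneg) auto
    have bd: "cmod (F (\<lambda>i\<in>{..<n}. x i - s)) \<le> w" if "s \<in> {0..1/2}" for s
    proof -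
      have "cmod (F (\<lambda>i\<in>{..<n}. x i - s)) \<le> C * (\<Prod>i<n. 1 / (1 + ((\<lambda>i\<in>{..<n}. x i - s) i)\<^sup>2))"
        using dom unfolding dominated_Rn_def by (elim conjE bspec) (simp add: Rn_def)
      also have "\<dots> \<le> C * (\<Prod>i<n. 2 * (1 / (1 + (x i)\<^sup>2)))"
        using C0 that by (intro mult_left_mono prod_mono conjI) (auto intro!: weight_diagonal_shift simp del: times_divide_eq_right)
      also have "\<dots> = w" unfolding w_def prod.distrib by simp
      finally show ?thesis .
    qed
    have "cmod (diag_average n F x) \<le> (LINT s|lborel. norm (indicator {0..1/2} s *\<^sub>R F (\<lambda>i\<in>{..<n}. x i - s)))"
      unfolding diag_average_def set_lebesgue_integral_def by (rule integral_norm_bound)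
    also have "\<dots> \<le> (LINT s|lborel. w * indicator {0..1/2 :: real} s)"
      using bd si[of x] unfolding set_integrable_def
      by (intro integral_mono integrable_norm integrable_mult_right integrable_indicator_Icc) (auto simp: indicator_def)
    also have "\<dots> = w * (1 / 2)" by simp
    also have "\<dots> \<le> w" using w0 by simp
    finally show ?thesis unfolding w_def .
  qed
  with cont show ?thesis by (simp add: dominated_Rn_def)
qed

text \<open>Moving the shift by \<open>s\<close> from \<open>F\<close> to the character multiplies
  the latter by an exponential in \<open>s\<close> whose frequency is -2 times the sum of the
  \<open>m i\<close>, and Fubini splits the coefficient. The first factor is an integral over whole
  periods when that sum is nonzero, and \<open>1 / 2\<close> when it is zero.\<close>

lemma diag_average_fourier:
  assumes dom: "dominated_Rn n C F"
  shows "(LINT x|lborel_Rn n. diag_average n F x * lattice_char n m x) =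
    (LBINT s:{0..1/2}. exp (\<i> * of_real (- (4 * pi * of_int (\<Sum>i<n. m i)) * s))) *
    (LINT x|lborel_Rn n. F x * lattice_char n m x)"
proof -
  let ?M = "lborel_Rn n"
  interpret M: sigma_finite_measure ?M by (rule sigma_finite_lborel_Rn)
  interpret P: pair_sigma_finite "lborel :: real measure" ?M ..
  have Fi: "integrable ?M F" by (rule dominated_Rn_integrable[OF dom])
  then have Fm: "F \<in> borel_measurable ?M" by simp
  have cm: "lattice_char n m \<in> borel_measurable ?M"
    by (rule borel_measurable_continuous_Rn[OF lattice_char_continuous])
  define \<Psi> where "\<Psi> s x = indicator {0..1/2 :: real} s *\<^sub>R (F (\<lambda>i\<in>{..<n}. x i - s) * lattice_char n m x)" for s x
  have sh: "(\<lambda>i\<in>{..<n}. x i - s) = (\<lambda>i\<in>{..<n}. x i + - s)" for x :: "nat \<Rightarrow> real" and s by auto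
  have Fsi: "integrable ?M (\<lambda>x. F (\<lambda>i\<in>{..<n}. x i - s))" for s
    unfolding sh by (rule integrable_lborel_Rn_translate[OF Fi])
  have Fci: "integrable ?M (\<lambda>x. F (\<lambda>i\<in>{..<n}. x i - s) * lattice_char n m x)" for s
    by (rule Bochner_Integration.integrable_bound[OF Fsi[of s]])
      (use Fsi[of s] cm in \<open>auto simp: norm_mult\<close>)
  have \<Psi>m: "(\<lambda>p. \<Psi> (fst p) (snd p)) \<in> borel_measurable (lborel \<Otimes>\<^sub>M ?M)"
  proof -
    have "(\<lambda>p. \<lambda>i\<in>{..<n}. snd p i - fst p) \<in> measurable (lborel \<Otimes>\<^sub>M ?M) ?M"
    proof (rule measurable_into_lborel_Rn)
      have "(\<lambda>p. fst p) \<in> measurable (lborel \<Otimes>\<^sub>M ?M) (lborel :: real measure)" by (rule measurable_fst)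
      then have "(\<lambda>p. fst p) \<in> borel_measurable ((lborel :: real measure) \<Otimes>\<^sub>M ?M)" by (simp only: measurable_lborel1)
      then show "(\<lambda>p. snd p i - fst p) \<in> borel_measurable (lborel \<Otimes>\<^sub>M ?M)" for i
        by (intro borel_measurable_diff measurable_compose[OF measurable_snd component_borel_measurable_Rn])
    qed
    from measurable_compose[OF this Fm]
    have "(\<lambda>p. F (\<lambda>i\<in>{..<n}. snd p i - fst p)) \<in> borel_measurable (lborel \<Otimes>\<^sub>M ?M)" .
    moreover have "(\<lambda>p. indicator {0..1/2 :: real} (fst p) :: real) \<in> borel_measurable (lborel \<Otimes>\<^sub>M ?M)"
      by (rule measurable_compose[OF measurable_fst]) simp
    ultimately show ?thesis unfolding \<Psi>_def
      by (intro borel_measurable_scaleR borel_measurable_times measurable_compose[OF measurable_snd cm])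
  qed
  have n\<Psi>: "(LINT x|?M. norm (\<Psi> s x)) = indicator {0..1/2} s * (LINT x|?M. norm (F x))" for s
  proof -
    have "(LINT x|?M. norm (\<Psi> s x)) = indicator {0..1/2} s * (LINT x|?M. norm (F (\<lambda>i\<in>{..<n}. x i - s)))"
      by (simp add: \<Psi>_def norm_mult)
    also have "(LINT x|?M. norm (F (\<lambda>i\<in>{..<n}. x i - s))) = (LINT x|?M. norm (F x))"
      unfolding sh by (rule integral_lborel_Rn_translate) (use Fm in simp)
    finally show ?thesis .
  qed
  have \<Psi>i: "integrable (lborel \<Otimes>\<^sub>M ?M) (case_prod \<Psi>)"
  proof (rule P.Fubini_integrable)
    show "case_prod \<Psi> \<in> borel_measurable (lborel \<Otimes>\<^sub>M ?M)" using \<Psi>m by (simp add: case_prod_unfold)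
    show "integrable lborel (\<lambda>s. LINT x|?M. norm (case_prod \<Psi> (s, x)))"
      unfolding prod.case n\<Psi> by (intro integrable_mult_left integrable_indicator_Icc)
    show "AE s in lborel. integrable ?M (\<lambda>x. case_prod \<Psi> (s, x))"
      unfolding prod.case \<Psi>_def by (intro AE_I2 integrable_scaleR_right Fci)
  qed
  have inner_s: "(LINT s|lborel. \<Psi> s x) = diag_average n F x * lattice_char n m x" for x
  proof -
    have "(\<lambda>s. \<Psi> s x) = (\<lambda>s. (indicator {0..1/2} s *\<^sub>R F (\<lambda>i\<in>{..<n}. x i - s)) * lattice_char n m x)"
      by (simp add: \<Psi>_def)
    then show ?thesis
      unfolding diag_average_def set_lebesgue_integral_def by (simp only: integral_mult_left_zero)
  qed
  have inner_x: "(LINT x|?M. \<Psi> s x) = (indicator {0..1/2} s *\<^sub>R exp (\<i> * of_real (- (4 * pi * of_int (\<Sum>i<n. m i)) * s))) *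
      (LINT x|?M. F x * lattice_char n m x)" for s
  proof -
    have char_shift: "lattice_char n m (\<lambda>i\<in>{..<n}. x i + s) =
      exp (\<i> * of_real (- (4 * pi * of_int (\<Sum>i<n. m i)) * s)) * lattice_char n m x" for x
    proof -
      have "(\<Sum>i<n. (\<lambda>i\<in>{..<n}. x i + s) i * (2 * of_int (m i))) =
        (\<Sum>i<n. x i * (2 * of_int (m i))) + 2 * s * of_int (\<Sum>i<n. m i)"
        by (simp add: algebra_simps sum.distrib sum_distrib_left sum_distrib_right)
      moreover have "- 2 * of_real pi * \<i> * of_real (a + 2 * s * b) =
         \<i> * of_real (- (4 * pi * b) * s) + - 2 * of_real pi * \<i> * of_real a" for a b :: real
        by (simp add: algebra_simps)
      ultimately show ?thesis unfolding lattice_char_def exp_add[symmetric] by (simp only:)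
    qed
    have "(LINT x|?M. F (\<lambda>i\<in>{..<n}. x i - s) * lattice_char n m x) =
       (LINT x|?M. F (\<lambda>i\<in>{..<n}. (\<lambda>i\<in>{..<n}. x i + s) i - s) * lattice_char n m (\<lambda>i\<in>{..<n}. x i + s))"
      by (rule integral_lborel_Rn_translate[symmetric]) (use Fci[of s] in simp)
    also have "\<dots> = (LINT x|?M. exp (\<i> * of_real (- (4 * pi * of_int (\<Sum>i<n. m i)) * s)) * (F x * lattice_char n m x))"
    proof (rule Bochner_Integration.integral_cong[OF refl])
      fix x assume "x \<in> space ?M"
      then have "(\<lambda>i\<in>{..<n}. (\<lambda>i\<in>{..<n}. x i + s) i - s) = x"
        by (auto simp: Rn_def PiE_iff extensional_def)
      then show "F (\<lambda>i\<in>{..<n}. (\<lambda>i\<in>{..<n}. x i + s) i - s) * lattice_char n m (\<lambda>i\<in>{..<n}. x i + s) =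
         exp (\<i> * of_real (- (4 * pi * of_int (\<Sum>i<n. m i)) * s)) * (F x * lattice_char n m x)"
        unfolding char_shift by (simp only: mult_ac)
    qed
    also have "\<dots> = exp (\<i> * of_real (- (4 * pi * of_int (\<Sum>i<n. m i)) * s)) * (LINT x|?M. F x * lattice_char n m x)"
      by (rule integral_mult_right_zero)
    finally have *: "(LINT x|?M. F (\<lambda>i\<in>{..<n}. x i - s) * lattice_char n m x) = \<dots>" .
    show ?thesis unfolding \<Psi>_def integral_scaleR_right * by simp
  qed
  have "(LINT x|?M. diag_average n F x * lattice_char n m x) = (LINT x|?M. LINT s|lborel. \<Psi> s x)"
    by (simp only: inner_s)
  also have "\<dots> = (LINT s|lborel. LINT x|?M. \<Psi> s x)"
    by (rule P.Fubini_integral[OF \<Psi>i])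
  also have "\<dots> = (LINT s|lborel. (indicator {0..1/2} s *\<^sub>R exp (\<i> * of_real (- (4 * pi * of_int (\<Sum>i<n. m i)) * s)))) *
      (LINT x|?M. F x * lattice_char n m x)"
    unfolding inner_x by (rule integral_mult_left_zero)
  finally show ?thesis unfolding set_lebesgue_integral_def .
qed

text \<open>The determinant is invariant under diagonal shifts, so up to a constant each term is the
  diagonal average of \<open>F\<close> at a lattice point. Its nonconstant coefficients vanish: by
  averaging when the entries of \<open>m\<close> have nonzero sum, by
  \<open>fourier_sine_det_vanishes\<close> otherwise. The constants \<open>2 / 2 ^ n\<close>
  (density and rescaled determinant), \<open>2 ^ n\<close> (Poisson summation) and
  \<open>1 / 2\<close> (length of the averaging interval) multiply to 1.\<close>

theorem lattice_sum_eq_sine_det_integral: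
  assumes dom: "dominated_Rn n C g"
    and van: "\<And>\<xi>. \<xi> \<in> Rn n \<Longrightarrow> (\<Sum>i<n. \<xi> i) = 0 \<Longrightarrow> (\<Sum>i<n. \<bar>\<xi> i\<bar>) \<ge> 2 \<Longrightarrow> fourier_Rn n g \<xi> = 0"
  shows "(\<Sum>\<^sub>\<infinity>k\<in>distinct_tuples n. 2 * of_real (perm_det (k ` {..<n}) lattice_kernel) *
      (LBINT s:{0..1/2}. g (\<lambda>i\<in>{..<n}. of_int (k i) / 2 - s))) =
    (LINT x|lborel_Rn n. g x * of_real (sine_det n x))"
proof -
  define F where "F x = g x * of_real (sine_det n x)" for x
  define f where "f = diag_average n F"
  have domF: "dominated_Rn n (C * fact n) F"
    unfolding F_def
    by (rule dominated_Rn_mult[OF dom]) (auto intro!: continuous_intros sine_det_continuous abs_sine_det_le)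
  have domf: "dominated_Rn n (C * fact n * 2 ^ n) f"
    unfolding f_def by (rule diag_average_dominated[OF domF])
  have f_van: "fourier_Rn n f (\<lambda>i. 2 * of_int (m i)) = 0" if m: "\<exists>i<n. m i \<noteq> 0" for m
  proof (cases "(\<Sum>i<n. m i) = 0")
    case True
    have "(LINT x|lborel_Rn n. F x * lattice_char n m x) = 0"
      unfolding F_def by (rule fourier_sine_det_vanishes[OF dom van True m])
    then show ?thesis
      unfolding fourier_Rn_lattice f_def diag_average_fourier[OF domF] by simp
  next
    case False
    define a where "a = - (4 * pi * of_int (\<Sum>i<n. m i))"
    have a0: "a \<noteq> 0" using False by (simp add: a_def flip: of_int_sum)
    have "exp (of_real (2 * of_int (- (\<Sum>i<n. m i)) * pi) * \<i>) = 1"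
      by (rule exp_integer_2pi) (rule Ints_of_int)
    also have "of_real (2 * of_int (- (\<Sum>i<n. m i)) * pi) * \<i> = \<i> * of_real (a * (1/2))"
      by (simp add: a_def)
    finally have "(LBINT s:{0..1/2}. exp (\<i> * of_real (a * s))) = 0"
      unfolding set_lebesgue_integral_def by (subst integral_exp_interval[OF a0]) auto
    then show ?thesis
      unfolding fourier_Rn_lattice f_def diag_average_fourier[OF domF] a_def by simp
  qed
  have int_f: "(LINT x|lborel_Rn n. f x) = 1 / 2 * (LINT x|lborel_Rn n. F x)"
    using diag_average_fourier[OF domF, of "\<lambda>_. 0"]
    by (simp add: f_def lattice_char_def set_lebesgue_integral_def scaleR_conv_of_real)
  have f_lattice: "f (\<lambda>i\<in>{..<n}. of_int (k i) / 2) = of_real (sine_det n (\<lambda>i\<in>{..<n}. of_int (k i) / 2)) *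
      (LBINT s:{0..1/2}. g (\<lambda>i\<in>{..<n}. of_int (k i) / 2 - s))" for k :: "nat \<Rightarrow> int"
  proof -
    define x where "x = (\<lambda>i\<in>{..<n}. real_of_int (k i) / 2)"
    have x: "(\<lambda>i\<in>{..<n}. x i - s) = (\<lambda>i\<in>{..<n}. of_int (k i) / 2 - s)" for s
      by (auto simp: x_def)
    have "sine_det n (\<lambda>i\<in>{..<n}. x i - s) = sine_det n x" for s
      using sine_det_shift[of n x "- s"] by simp
    then have "f x = (LBINT s:{0..1/2}. of_real (sine_det n x) * g (\<lambda>i\<in>{..<n}. x i - s))"
      by (simp add: f_def diag_average_def F_def mult.commute)
    also have "\<dots> = of_real (sine_det n x) * (LBINT s:{0..1/2}. g (\<lambda>i\<in>{..<n}. x i - s))"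
      by simp
    finally have "f x = of_real (sine_det n x) * (LBINT s:{0..1/2}. g (\<lambda>i\<in>{..<n}. of_int (k i) / 2 - s))"
      by (simp only: x)
    then show ?thesis by (simp only: x_def)
  qed
  have "(\<Sum>\<^sub>\<infinity>k\<in>distinct_tuples n. 2 * of_real (perm_det (k ` {..<n}) lattice_kernel) *
      (LBINT s:{0..1/2}. g (\<lambda>i\<in>{..<n}. of_int (k i) / 2 - s))) =
      (\<Sum>\<^sub>\<infinity>k\<in>distinct_tuples n. 2 / 2 ^ n * f (\<lambda>i\<in>{..<n}. of_int (k i) / 2))"
    by (intro infsum_cong) (simp add: f_lattice sine_det_lattice)
  also have "\<dots> = (\<Sum>\<^sub>\<infinity>k\<in>Zn n. 2 / 2 ^ n * f (\<lambda>i\<in>{..<n}. of_int (k i) / 2))"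
  proof (rule infsum_cong_neutral)
    fix k assume k: "k \<in> Zn n - distinct_tuples n"
    then obtain i j where "i < n" "j < n" "i \<noteq> j" "k i = k j"
      by (auto simp: Zn_def distinct_tuples_def inj_on_def)
    then have "sine_det n (\<lambda>i\<in>{..<n}. of_int (k i) / 2) = 0"
      by (intro sine_det_coincident[of i n j]) auto
    then show "2 / 2 ^ n * f (\<lambda>i\<in>{..<n}. of_int (k i) / 2) = 0" by (simp add: f_lattice)
  qed (use distinct_tuples_subset_Zn in auto)
  also have "\<dots> = 2 / 2 ^ n * (2 ^ n * (LINT x|lborel_Rn n. f x))"
  proof -
    have "(\<Sum>\<^sub>\<infinity>k\<in>Zn n. f (\<lambda>i\<in>{..<n}. of_int (k i) / 2)) = 2 ^ n * (LINT x|lborel_Rn n. f x)"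
      by (rule poisson_summation_vanishing[OF domf]) (rule f_van)
    then show ?thesis by (simp only: infsum_cmult_right')
  qed
  also have "\<dots> = (LINT x|lborel_Rn n. F x)" by (simp add: int_f)
  finally show ?thesis unfolding F_def .
qed

section \<open>The sequence\<close>

text \<open>The product of the \<open>1 + (x i)^2\<close> expands into the monomials with exponent 2
  on a set \<open>X\<close> of coordinates and 0 elsewhere; each is controlled by one instance of
  the decay condition for \<open>\<eta>\<close> itself, the case of the empty list of
  derivatives.\<close>

lemma schwartz_Rn_dominated:
  assumes "\<eta> \<in> schwartz_Rn n"
  shows "\<exists>C. dominated_Rn n C \<eta>"
proof -
  have "continuous_on (Rn n) \<eta> \<and> (\<forall>\<alpha> :: nat \<Rightarrow> nat. \<exists>C. \<forall>x\<in>Rn n. (\<Prod>i<n. \<bar>x i\<bar> ^ \<alpha> i) * cmod (\<eta> x) \<le> C)"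
  proof -
    have "\<forall>is \<in> lists {..<n}. let g = foldr partial_deriv is \<eta> in
       continuous_on (Rn n) g \<and>
       (\<forall>i<n. \<forall>x\<in>Rn n. (\<lambda>s. g (x(i := s))) differentiable (at (x i))) \<and>
       (\<forall>\<alpha> :: nat \<Rightarrow> nat. \<exists>C. \<forall>x\<in>Rn n. (\<Prod>i<n. \<bar>x i\<bar> ^ \<alpha> i) * cmod (g x) \<le> C)"
      using assms unfolding schwartz_Rn_def by (rule CollectD)
    from bspec[OF this lists.Nil] have "continuous_on (Rn n) \<eta> \<and>
       (\<forall>i<n. \<forall>x\<in>Rn n. (\<lambda>s. \<eta> (x(i := s))) differentiable (at (x i))) \<and>
       (\<forall>\<alpha> :: nat \<Rightarrow> nat. \<exists>C. \<forall>x\<in>Rn n. (\<Prod>i<n. \<bar>x i\<bar> ^ \<alpha> i) * cmod (\<eta> x) \<le> C)"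
      unfolding Let_def foldr.simps id_apply .
    then show ?thesis by (elim conjE) (rule conjI)
  qed
  then have cont: "continuous_on (Rn n) \<eta>"
    and dec: "\<And>\<alpha> :: nat \<Rightarrow> nat. \<exists>C. \<forall>x\<in>Rn n. (\<Prod>i<n. \<bar>x i\<bar> ^ \<alpha> i) * cmod (\<eta> x) \<le> C" by simp_all
  have "\<exists>C. \<forall>x\<in>Rn n. (\<Prod>i\<in>X. (x i)\<^sup>2) * cmod (\<eta> x) \<le> C" if "X \<subseteq> {..<n}" for X
  proof -
    have "(\<Prod>i<n. \<bar>x i\<bar> ^ (if i \<in> X then 2 else 0)) = (\<Prod>i\<in>X. (x i)\<^sup>2)" for x :: "nat \<Rightarrow> real"
      using that by (intro prod.mono_neutral_cong_right) auto
    then show ?thesis using dec[of "\<lambda>i. if i \<in> X then 2 else 0"] by simp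
  qed
  then have "\<forall>X\<in>Pow {..<n}. \<exists>C. \<forall>x\<in>Rn n. (\<Prod>i\<in>X. (x i)\<^sup>2) * cmod (\<eta> x) \<le> C" by blast
  from bchoice[OF this] obtain c
    where c: "\<And>X x. X \<in> Pow {..<n} \<Longrightarrow> x \<in> Rn n \<Longrightarrow> (\<Prod>i\<in>X. (x i)\<^sup>2) * cmod (\<eta> x) \<le> c X"
    by blast
  define C where "C = (\<Sum>X\<in>Pow {..<n}. c X)"
  have "cmod (\<eta> x) \<le> C * (\<Prod>i<n. 1 / (1 + (x i)\<^sup>2))" if x: "x \<in> Rn n" for x
  proof -
    have "(\<Prod>i<n. (x i)\<^sup>2 + 1) * cmod (\<eta> x) = (\<Sum>X\<in>Pow {..<n}. (\<Prod>i\<in>X. (x i)\<^sup>2) * cmod (\<eta> x))"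
      by (subst prod_add) (auto simp: sum_distrib_right)
    also have "\<dots> \<le> C" unfolding C_def by (intro sum_mono c x)
    finally have le: "(\<Prod>i<n. 1 + (x i)\<^sup>2) * cmod (\<eta> x) \<le> C" by (simp add: add.commute)
    have pos: "(\<Prod>i<n. 1 + (x i)\<^sup>2) > 0" by (intro prod_pos) (auto intro: add_pos_nonneg)
    have "cmod (\<eta> x) \<le> C / (\<Prod>i<n. 1 + (x i)\<^sup>2)"
      using le pos by (simp add: pos_le_divide_eq mult.commute)
    also have "\<dots> = C * (\<Prod>i<n. 1 / (1 + (x i)\<^sup>2))" by (simp add: prod_dividef)
    finally show ?thesis .
  qed
  with cont show ?thesis by (auto simp: dominated_Rn_def)
qed

lemma K_space_fourier_vanishes:
  assumes "\<eta> \<in> K_space n" "\<xi> \<in> Rn n" "(\<Sum>i<n. \<xi> i) = 0" "(\<Sum>i<n. \<bar>\<xi> i\<bar>) \<ge> 2"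
  shows "fourier_Rn n \<eta> \<xi> = 0"
proof (rule ccontr)
  assume "fourier_Rn n \<eta> \<xi> \<noteq> 0"
  then have "\<xi> \<in> support_Rn n (fourier_Rn n \<eta>)"
    unfolding support_Rn_def by (intro subsetD[OF closure_subset]) (simp add: assms(2))
  moreover have "support_Rn n (fourier_Rn n \<eta>) \<subseteq>
     {\<xi> \<in> Rn n. (\<Sum>i<n. \<xi> i) \<noteq> 0 \<or> (\<Sum>i<n. \<bar>\<xi> i\<bar>) < 2}"
    using assms(1) unfolding K_space_def by blast
  ultimately show False using assms(3,4) by auto
qed

section \<open>The one-point statistic as the case of dimension 1\<close>

lemma schwartz_R_bounds:
  assumes "\<phi> \<in> schwartz_R"
  shows "continuous_on UNIV \<phi>" and "\<exists>C. \<forall>x. \<bar>x\<bar> ^ m * cmod (\<phi> x) \<le> C"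
proof -
  have "\<forall>k. let g = ((\<lambda>h x. vector_derivative h (at x)) ^^ k) \<phi> in
     (\<forall>x. g differentiable (at x)) \<and> (\<forall>m. \<exists>C. \<forall>x. \<bar>x\<bar> ^ m * cmod (g x) \<le> C)"
    using assms unfolding schwartz_R_def by (rule CollectD)
  from spec[OF this, of 0] have *: "(\<forall>x. \<phi> differentiable (at x)) \<and> (\<forall>m. \<exists>C. \<forall>x. \<bar>x\<bar> ^ m * cmod (\<phi> x) \<le> C)"
    by (simp add: Let_def)
  then show "continuous_on UNIV \<phi>"
    by (intro continuous_at_imp_continuous_on ballI differentiable_imp_continuous_within) blast
  from * show "\<exists>C. \<forall>x. \<bar>x\<bar> ^ m * cmod (\<phi> x) \<le> C" by blast
qed

lemma schwartz_R_dominated: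
  assumes "\<phi> \<in> schwartz_R"
  shows "\<exists>C. dominated_Rn 1 C (\<lambda>x. \<phi> (x 0))"
proof -
  obtain C0 where C0: "\<And>x. \<bar>x\<bar> ^ 0 * cmod (\<phi> x) \<le> C0" using schwartz_R_bounds(2)[OF assms, of 0] by blast
  obtain C2 where C2: "\<And>x. \<bar>x\<bar> ^ 2 * cmod (\<phi> x) \<le> C2" using schwartz_R_bounds(2)[OF assms, of 2] by blast
  have bound: "cmod (\<phi> y) \<le> (C0 + C2) * (1 / (1 + y\<^sup>2))" for y
  proof -
    have "(1 + y\<^sup>2) * cmod (\<phi> y) \<le> C0 + C2" using C0[of y] C2[of y] by (simp add: algebra_simps)
    moreover have "0 < 1 + y\<^sup>2" by (simp add: add_pos_nonneg)
    ultimately show ?thesis by (simp add: pos_le_divide_eq mult.commute)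
  qed
  have cont: "continuous_on (Rn 1) (\<lambda>x. \<phi> (x 0))"
    by (rule continuous_on_compose2[OF schwartz_R_bounds(1)[OF assms]
          continuous_on_subset[OF continuous_on_product_coordinates]]) auto
  have "(\<Prod>i<1. 1 / (1 + (x i)\<^sup>2)) = 1 / (1 + (x 0)\<^sup>2)" for x :: "nat \<Rightarrow> real" by simp
  with cont bound have "dominated_Rn 1 (C0 + C2) (\<lambda>x. \<phi> (x 0))"
    unfolding dominated_Rn_def by (simp only:) blast
  then show ?thesis by blast
qed

lemma sine_det_1: "sine_det 1 x = 1"
proof -
  have "{..<1 :: nat} = {0}" by auto
  then show ?thesis by (simp add: sine_det_def perm_det_def sine_kernel_def)
qed

lemma integral_lborel_R1:
  fixes f :: "real \<Rightarrow> complex"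
  assumes "continuous_on UNIV f"
  shows "(LINT x|lborel_Rn 1. f (x 0)) = (LINT x|lborel. f x)"
proof -
  interpret product_sigma_finite "\<lambda>i :: nat. lborel :: real measure" by standard
  have "{..<1 :: nat} = {0}" by auto
  then show ?thesis unfolding lborel_Rn_def
    using product_integral_singleton[of f 0] borel_measurable_continuous_onI[OF assms] by simp
qed

text \<open>The negative integers enumerate themselves, and the infinitely many nonnegative elements
  follow in increasing order from index 0 on; at the junction -1 precedes a nonnegative
  element.\<close>

lemma exists_increasing_enumeration:
  fixes A :: "int set"
  assumes neg: "{..<0} \<subseteq> A" and inf: "infinite {m :: nat. int m \<in> A}"
  shows "\<exists>e :: int \<Rightarrow> int. bij_betw e UNIV A \<and> (\<forall>j. e j < e (j + 1))"
proof -
  define A' where "A' = {m :: nat. int m \<in> A}"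
  define en where "en = enumerate A'"
  have inf': "infinite A'" using inf by (simp add: A'_def)
  have inj_en: "inj en" unfolding en_def using inf' by (rule inj_enumerate)
  have range_en: "range en = A'" unfolding en_def using inf' by (rule range_enumerate)
  define e where "e j = (if j < 0 then j else int (en (nat j)))" for j
  have "e j < e (j + 1)" for j
  proof (cases "j < 0")
    case True
    then show ?thesis by (auto simp: e_def)
  next
    case False
    then have "nat (j + 1) = Suc (nat j)" by simp
    then show ?thesis using False enumerate_step[OF inf', of "nat j"] by (simp add: e_def en_def)
  qed
  moreover have "bij_betw e UNIV A"
    unfolding bij_betw_def
  proof
    show "inj e"
    proof (rule injI)
      fix x y assume "e x = e y"
      then show "x = y"
        using injD[OF inj_en, of "nat x" "nat y"] by (auto simp: e_def split: if_splits)
    qed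
    show "range e = A"
    proof
      show "range e \<subseteq> A" using neg range_en by (auto simp: e_def A'_def)
      show "A \<subseteq> range e"
      proof
        fix a assume a: "a \<in> A"
        show "a \<in> range e"
        proof (cases "a < 0")
          case True
          then show ?thesis by (intro range_eqI[of _ _ a]) (simp add: e_def)
        next
          case False
          then have "nat a \<in> range en" using a by (simp add: range_en A'_def)
          then obtain k where "nat a = en k" by blast
          then show ?thesis using False by (intro range_eqI[of _ _ "int k"]) (simp add: e_def)
        qed
      qed
    qed
  qed
  ultimately show ?thesis by blast
qed

theorem theorem3p1:
  "\<exists>c :: int \<Rightarrow> real.
     (\<forall>j. c (j + 1) - c j \<in> {real k / 2 | k. k \<ge> 1}) \<and>
     (\<forall>\<phi> \<in> schwartz_R.
        ((\<lambda>T :: real. of_real (1 / T) *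
            (LBINT t:{T..2 * T}. (\<Sum>\<^sub>\<infinity>j\<in>UNIV. \<phi> (c j - t))))
         \<longlongrightarrow> (LBINT x. \<phi> x)) at_top) \<and>
     (\<forall>n\<ge>2. \<forall>\<eta> \<in> K_space n.
        ((\<lambda>T :: real. of_real (1 / T) *
            (LBINT t:{T..2 * T}.
               (\<Sum>\<^sub>\<infinity>j\<in>distinct_tuples n. \<eta> (\<lambda>i\<in>{..<n}. c (j i) - t))))
         \<longlongrightarrow> (LINT x|lborel_Rn n.
                \<eta> x * of_real (Determinant.det (Matrix.mat n n (\<lambda>(i, j). sine_kernel (x i - x j))))))
        at_top)"
proof -
  obtain A :: "int set" where neg: "{..<0} \<subseteq> A"
    and dens: "\<And>Y. finite Y \<Longrightarrow>
       (\<lambda>N. real (card {a \<in> {0..<int N}. (+) a ` Y \<subseteq> A}) / real N) \<longlonglongrightarrow> perm_det Y lattice_kernel"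
    using exists_set_with_pattern_densities by blast
  \<comment> \<open>The pattern \<open>{0}\<close> has density \<open>1 / 2\<close>, whereas a
    finite set has density 0.\<close>
  have "infinite {m :: nat. int m \<in> A}"
  proof
    assume fin: "finite {m :: nat. int m \<in> A}"
    define b where "b = real (card {m :: nat. int m \<in> A})"
    have "perm_det {0} lattice_kernel = 1 / 2"
      by (simp add: perm_det_def lattice_kernel_def sine_kernel_def)
    with dens[of "{0}"] have lim: "(\<lambda>N. real (card {a \<in> {0..<int N}. a \<in> A}) / real N) \<longlonglongrightarrow> 1 / 2" by simp
    have "real (card {a \<in> {0..<int N}. a \<in> A}) / real N \<le> b / real N" for N
    proof -
      have "{a \<in> {0..<int N}. a \<in> A} \<subseteq> int ` {m. int m \<in> A}"
      proof
        fix a assume "a \<in> {a \<in> {0..<int N}. a \<in> A}"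
        then show "a \<in> int ` {m. int m \<in> A}" by (intro image_eqI[of _ _ "nat a"]) auto
      qed
      then have "card {a \<in> {0..<int N}. a \<in> A} \<le> card (int ` {m. int m \<in> A})"
        using fin by (intro card_mono) auto
      also have "\<dots> \<le> card {m. int m \<in> A}" using fin by (rule card_image_le)
      finally show ?thesis by (simp add: b_def divide_right_mono)
    qed
    moreover have "(\<lambda>N. b / real N) \<longlonglongrightarrow> 0" by real_asymp
    ultimately have "1 / 2 \<le> (0 :: real)" using lim by (intro LIMSEQ_le[OF lim]) auto
    then show False by simp
  qed
  with neg obtain e where e: "bij_betw e UNIV A" and mono: "\<And>j :: int. e j < e (j + 1)"
    using exists_increasing_enumeration by blast
  define c where "c j = real_of_int (e j) / 2" for j
  have gap: "c (j + 1) - c j \<in> {real k / 2 | k. k \<ge> 1}" for j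
  proof -
    have "c (j + 1) - c j = real (nat (e (j + 1) - e j)) / 2" "nat (e (j + 1) - e j) \<ge> 1"
      using mono[of j] by (auto simp: c_def diff_divide_distrib)
    then show ?thesis by blast
  qed
  have core: "((\<lambda>T :: real. of_real (1 / T) *
            (LBINT t:{T..2 * T}. (\<Sum>\<^sub>\<infinity>j\<in>distinct_tuples n. g (\<lambda>i\<in>{..<n}. c (j i) - t))))
         \<longlongrightarrow> (LINT x|lborel_Rn n. g x * of_real (sine_det n x))) at_top"
    if "dominated_Rn n C g"
      "\<And>\<xi>. \<xi> \<in> Rn n \<Longrightarrow> (\<Sum>i<n. \<xi> i) = 0 \<Longrightarrow> (\<Sum>i<n. \<bar>\<xi> i\<bar>) \<ge> 2 \<Longrightarrow> fourier_Rn n g \<xi> = 0"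
    for n C g
  proof -
    have "(\<Sum>\<^sub>\<infinity>k\<in>distinct_tuples n. 2 * of_real (perm_det (k ` {..<n}) lattice_kernel) *
        (LBINT s:{0..1/2}. g (\<lambda>i\<in>{..<n}. of_int (k i) / 2 - s))) =
      (LINT x|lborel_Rn n. g x * of_real (sine_det n x))"
      by (rule lattice_sum_eq_sine_det_integral[OF that(1)]) (rule that(2))
    moreover note pattern_average_tendsto[where A = A, OF _ e that(1)]
    ultimately show ?thesis unfolding c_def by (simp only: dens)
  qed
  have one: "((\<lambda>T :: real. of_real (1 / T) * (LBINT t:{T..2 * T}. (\<Sum>\<^sub>\<infinity>j\<in>UNIV. \<phi> (c j - t))))
         \<longlongrightarrow> (LBINT x. \<phi> x)) at_top" if \<phi>: "\<phi> \<in> schwartz_R" for \<phi>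
  proof -
    obtain C where dom: "dominated_Rn 1 C (\<lambda>x. \<phi> (x 0))" using schwartz_R_dominated[OF \<phi>] by blast
    have bij: "bij_betw (\<lambda>j. j 0) (distinct_tuples 1) (UNIV :: int set)"
      by (rule bij_betw_byWitness[where f' = "\<lambda>a. \<lambda>i\<in>{..<1}. a"])
        (auto simp: distinct_tuples_def PiE_iff extensional_def fun_eq_iff inj_on_def)
    have "(\<Sum>\<^sub>\<infinity>j\<in>distinct_tuples 1. \<phi> ((\<lambda>i\<in>{..<1}. c (j i) - t) 0)) = (\<Sum>\<^sub>\<infinity>j\<in>UNIV. \<phi> (c j - t))" for t
      using infsum_reindex_bij_betw[OF bij, of "\<lambda>j. \<phi> (c j - t)"] by simp
    moreover have "((\<lambda>T :: real. of_real (1 / T) *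
            (LBINT t:{T..2 * T}. (\<Sum>\<^sub>\<infinity>j\<in>distinct_tuples 1. \<phi> ((\<lambda>i\<in>{..<1}. c (j i) - t) 0))))
         \<longlongrightarrow> (LINT x|lborel_Rn 1. \<phi> (x 0) * of_real (sine_det 1 x))) at_top"
      \<comment> \<open>In dimension 1 the conditions \<open>\<Sum> \<xi>\<^sub>i = 0\<close> and
        \<open>\<Sum> \<bar>\<xi>\<^sub>i\<bar> \<ge> 2\<close> contradict each other.\<close>
      by (rule core[OF dom]) simp
    ultimately show ?thesis
      by (simp only: sine_det_1 of_real_1 mult_1_right integral_lborel_R1[OF schwartz_R_bounds(1)[OF \<phi>]])
  qed
  have many: "((\<lambda>T :: real. of_real (1 / T) *
            (LBINT t:{T..2 * T}. (\<Sum>\<^sub>\<infinity>j\<in>distinct_tuples n. \<eta> (\<lambda>i\<in>{..<n}. c (j i) - t))))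
         \<longlongrightarrow> (LINT x|lborel_Rn n.
                \<eta> x * of_real (Determinant.det (Matrix.mat n n (\<lambda>(i, j). sine_kernel (x i - x j)))))) at_top"
    if \<eta>: "\<eta> \<in> K_space n" for n \<eta>
  proof -
    obtain C where "dominated_Rn n C \<eta>" using schwartz_Rn_dominated[of \<eta> n] \<eta> unfolding K_space_def by blast
    then have "((\<lambda>T :: real. of_real (1 / T) *
            (LBINT t:{T..2 * T}. (\<Sum>\<^sub>\<infinity>j\<in>distinct_tuples n. \<eta> (\<lambda>i\<in>{..<n}. c (j i) - t))))
         \<longlongrightarrow> (LINT x|lborel_Rn n. \<eta> x * of_real (sine_det n x))) at_top"
      by (rule core) (rule K_space_fourier_vanishes[OF \<eta>])
    then show ?thesis unfolding det_mat_eq_perm_det sine_det_def .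
  qed
  show ?thesis using gap one many by blast
qed

end
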